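(* Let $(X_t)_{t\ge0}$ be the unique strong solution of $dX_t=\sigma\,dB_t+b(X_t)\,dt$, with $\sigma$, $b(\cdot)$ and the points $a<b$ as specified in the context. Then $(X_t)$ is positive recurrent, i.e. $E_yT_x<\infty$ for all $x,y\in\mathbb{R}$, and $(X_t)$ is regenerative at the points $a$ and $b$.
   Context: **The diffusion.** Let $(B_t)$ be a standard one-dimensional Brownian motion with its filtration $(\mathcal{F}_t)$ satisfying the usual conditions. Let $D,k_BT>0$ be constants, $\sigma=\sqrt{2D}$, and $b(x)=-\frac{D}{k_BT}U'(x)$, where $U$ is the truncated double well potential $$U(x)=\begin{cases}Q(x), & |x|\le K-\epsilon,\\ g(|x|), & |x|\in(K-\epsilon,K+\epsilon),\\ k(|x|-K)+Q(K), & |x|\ge K+\epsilon,\end{cases}\qquad Q(x)=h^2x^4-\tfrac12\lambda^2x^2 .$$ Here $h,\lambda\neq 0$, $k>0$, $K\ge|\lambda/h|$, $0<\epsilon<K$, and $g$ is a smooth function chosen so that $U\in C^1(\mathbb{R})$ has bounded derivative and the drift $b(\cdot)$ is Lipschitz continuous. Set $-a=b=|\lambda/(2h)|$, the minimizers of $Q$ (the letter $b$ denotes both this point and, as $b(\cdot)$, the drift). **Notation.** $P_y$ is the law on $C([0,\infty))$ of the solution $X$ with $X_0=y$, $E_y$ is the expectation under $P_y$, and $X_t(\omega)=\omega(t)$ is the coordinate process. $T_x:=\inf\{s:X_s=x\}$ and $\theta_\tau X_\cdot:=X_{\tau+\cdot}$. **Regenerative.** $(X_t)$ is regenerative at a point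 $x$ if for every stopping time $\tau$ and every Borel set $A\subseteq C([0,\infty))$, $P(\theta_\tau X_\cdot\in A\mid\mathcal{F}_\tau)=P_x(A)$ a.s. on $\{\tau<\infty,\ X_\tau=x\}$. *)

theory Defs
  imports "HOL-Probability.Probability"
begin

section \<open>The path space $C([0,\infty))$\<close>

text \<open>Paths are extensional on \<open>{0..}\<close>, so that equality of paths is equality on $[0,\infty)$.\<close>

definition path_carrier :: "(real \<Rightarrow> real) set" where
  "path_carrier = {w \<in> extensional {0..}. continuous_on {0..} w}"

text \<open>The topology of uniform convergence on compact sets, and its Borel sets.\<close>

definition path_topology :: "(real \<Rightarrow> real) topology" where
  "path_topology = topology_generated_by
     {{v \<in> path_carrier. \<forall>t\<in>{0..r}. \<bar>v t - w t\<bar> < e} | w r e.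
        w \<in> path_carrier \<and> 0 \<le> r \<and> 0 < e}"

definition path_borel :: "(real \<Rightarrow> real) measure" where
  "path_borel = sigma path_carrier {V. openin path_topology V}"

definition hitting_time :: "real \<Rightarrow> (real \<Rightarrow> real) \<Rightarrow> ennreal" where
  "hitting_time x w = Inf {ennreal s | s. 0 \<le> s \<and> w s = x}"

definition sample_path :: "(real \<Rightarrow> 'a \<Rightarrow> real) \<Rightarrow> 'a \<Rightarrow> real \<Rightarrow> real" where
  "sample_path X \<omega> = (\<lambda>t\<in>{0..}. X t \<omega>)"

definition shifted_path :: "(real \<Rightarrow> 'a \<Rightarrow> real) \<Rightarrow> ('a \<Rightarrow> ennreal) \<Rightarrow> 'a \<Rightarrow> real \<Rightarrow> real" where
  "shifted_path X \<tau> \<omega> = (\<lambda>t\<in>{0..}. X (enn2real (\<tau> \<omega>) + t) \<omega>)"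

section \<open>Brownian motion and strong solutions\<close>

text \<open>Filtrations are indexed by \<^typ>\<open>ennreal\<close>, so that stopping times may take the value
  \<open>\<infinity>\<close>; the \<open>\<sigma>\<close>-algebra \<open>F \<infinity>\<close> plays the role of $\mathcal{F}_\infty$.\<close>

definition usual_conditions :: "'a measure \<Rightarrow> (ennreal \<Rightarrow> 'a measure) \<Rightarrow> bool" where
  "usual_conditions M F \<longleftrightarrow>
     filtration (space M) F \<and> (\<forall>t. subalgebra M (F t)) \<and>
     complete_measure M \<and> null_sets M \<subseteq> sets (F 0) \<and>
     (\<forall>t<\<infinity>. sets (F t) = (\<Inter>s\<in>{t<..<\<infinity>}. sets (F s)))"

definition adapted :: "(ennreal \<Rightarrow> 'a measure) \<Rightarrow> (real \<Rightarrow> 'a \<Rightarrow> real) \<Rightarrow> bool" where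
  "adapted F X \<longleftrightarrow> (\<forall>t\<ge>0. X t \<in> borel_measurable (F (ennreal t)))"

definition brownian_motion ::
  "'a measure \<Rightarrow> (ennreal \<Rightarrow> 'a measure) \<Rightarrow> (real \<Rightarrow> 'a \<Rightarrow> real) \<Rightarrow> bool" where
  "brownian_motion M F B \<longleftrightarrow>
     adapted F B \<and>
     (AE \<omega> in M. B 0 \<omega> = 0) \<and>
     (AE \<omega> in M. continuous_on {0..} (\<lambda>t. B t \<omega>)) \<and>
     (\<forall>s t. 0 \<le> s \<and> s < t \<longrightarrow>
        distributed M lborel (\<lambda>\<omega>. B t \<omega> - B s \<omega>) (normal_density 0 (sqrt (t - s))) \<and>
        prob_space.indep_set M (sets (F (ennreal s)))
          (sets (vimage_algebra (space M) (\<lambda>\<omega>. B t \<omega> - B s \<omega>) borel)))"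

text \<open>Since the diffusion coefficient \<open>\<sigma>\<close> is constant and \<open>B 0 = 0\<close> almost surely, the stochastic
  integral in the integrated form of $dX_t = \sigma\,dB_t + \beta(X_t)\,dt$ is \<open>\<sigma> * B t\<close>.\<close>

definition strong_solution ::
  "'a measure \<Rightarrow> (ennreal \<Rightarrow> 'a measure) \<Rightarrow> (real \<Rightarrow> 'a \<Rightarrow> real) \<Rightarrow>
   real \<Rightarrow> (real \<Rightarrow> real) \<Rightarrow> (real \<Rightarrow> 'a \<Rightarrow> real) \<Rightarrow> bool" where
  "strong_solution M F B \<sigma> \<beta> X \<longleftrightarrow>
     adapted F X \<and>
     (\<forall>\<omega>\<in>space M. continuous_on {0..} (\<lambda>t. X t \<omega>)) \<and>
     (AE \<omega> in M. \<forall>t\<ge>0. X t \<omega> = X 0 \<omega> + \<sigma> * B t \<omega> + integral {0..t} (\<lambda>s. \<beta> (X s \<omega>)))"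

text \<open>The law on path space of the solution started at \<open>y\<close>; the description is proper whenever
  \<open>\<beta>\<close> is Lipschitz, by existence and pathwise uniqueness.\<close>

definition solution_law ::
  "'a measure \<Rightarrow> (ennreal \<Rightarrow> 'a measure) \<Rightarrow> (real \<Rightarrow> 'a \<Rightarrow> real) \<Rightarrow>
   real \<Rightarrow> (real \<Rightarrow> real) \<Rightarrow> real \<Rightarrow> (real \<Rightarrow> real) measure" where
  "solution_law M F B \<sigma> \<beta> y =
     (THE P. \<exists>X. strong_solution M F B \<sigma> \<beta> X \<and> (AE \<omega> in M. X 0 \<omega> = y) \<and>
                 P = distr M path_borel (sample_path X))"

section \<open>Positive recurrence and regeneration\<close>

definition positive_recurrent :: "(real \<Rightarrow> (real \<Rightarrow> real) measure) \<Rightarrow> bool" where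
  "positive_recurrent P \<longleftrightarrow> (\<forall>x y. (\<integral>\<^sup>+ w. hitting_time x w \<partial>P y) < \<infinity>)"

text \<open>The conditional probability given \<open>F \<tau>\<close> is the conditional expectation of the indicator;
  \<open>shifted_path\<close> is only meaningful on \<open>\<tau> < \<infinity>\<close>, an event of \<open>F \<tau>\<close>, and the indicator is
  restricted to it.\<close>

definition regenerative_at ::
  "'a measure \<Rightarrow> (ennreal \<Rightarrow> 'a measure) \<Rightarrow> (real \<Rightarrow> (real \<Rightarrow> real) measure) \<Rightarrow>
   (real \<Rightarrow> 'a \<Rightarrow> real) \<Rightarrow> real \<Rightarrow> bool" where
  "regenerative_at M F P X x \<longleftrightarrow>
     (\<forall>\<tau> A. stopping_time F \<tau> \<and> A \<in> sets path_borel \<longrightarrow>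
        (AE \<omega> in M. \<tau> \<omega> < \<infinity> \<and> X (enn2real (\<tau> \<omega>)) \<omega> = x \<longrightarrow>
           real_cond_exp M (filtration.pre_sigma (space M) F \<tau>)
             (indicator {\<omega>' \<in> space M. \<tau> \<omega>' < \<infinity> \<and> shifted_path X \<tau> \<omega>' \<in> A}) \<omega>
           = measure (P x) A))"

section \<open>The truncated double well\<close>

definition double_well :: "real \<Rightarrow> real \<Rightarrow> real \<Rightarrow> real" where
  "double_well h l x = h\<^sup>2 * x ^ 4 - 1 / 2 * l\<^sup>2 * x\<^sup>2"

definition truncated_double_well ::
  "real \<Rightarrow> real \<Rightarrow> real \<Rightarrow> real \<Rightarrow> real \<Rightarrow> (real \<Rightarrow> real) \<Rightarrow> real \<Rightarrow> real" where
  "truncated_double_well h l k K \<epsilon> g x =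
     (if \<bar>x\<bar> \<le> K - \<epsilon> then double_well h l x
      else if \<bar>x\<bar> < K + \<epsilon> then g \<bar>x\<bar>
      else k * (\<bar>x\<bar> - K) + double_well h l K)"

definition smooth_on_open :: "real set \<Rightarrow> (real \<Rightarrow> real) \<Rightarrow> bool" where
  "smooth_on_open S g \<longleftrightarrow> (\<forall>n. (deriv ^^ n) g differentiable_on S)"

definition drift :: "real \<Rightarrow> real \<Rightarrow> (real \<Rightarrow> real) \<Rightarrow> real \<Rightarrow> real" where
  "drift D kBT U x = - (D / kBT) * deriv U x"

end

theory Submission
  imports Defs
begin

text \<open>The noise is additive, so the equation is solved pathwise: a solution started at \<open>y\<close> is a
  measurable function of the path of \<open>y + \<sigma> B\<close>, by Picard iteration. After a stopping time \<open>\<tau>\<close> with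
  \<open>X \<tau> = x\<close> it is the same function of the increments of \<open>B\<close> after \<open>\<tau>\<close>, hence regeneration reduces to
  the strong Markov property of Brownian motion.

  Recurrence needs no stochastic calculus. Outside a bounded set the drift points towards the origin
  with constant speed, so \<open>x\<^sup>2\<close> is a Lyapunov function for the chain \<open>X 0, X 1, X 2, \<dots>\<close>: its mean
  decreases by a multiple of \<open>\<bar>X n\<bar>\<close>, up to a constant, at each step. From a bounded set \<open>x\<close> is
  hit within unit time with probability bounded below. Summing both estimates over \<open>n\<close>, on the
  event that \<open>X 0, \<dots>, X n\<close> lie on one side of \<open>x\<close>, bounds the mean hitting time of \<open>x\<close>.\<close>

text \<open>Three gaps separate the definitions from this plan. The Borel sets of the path space
  come from a topology, whereas processes are known only time by time; a countable base with
  rational data bridges this, so that a path-valued map is measurable as soon as its coordinates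
  are. \<open>B\<close> is continuous only almost surely, so it is replaced by a version
  \<open>W\<close> all of whose paths are continuous; the exceptional null set lies in
  \<open>F 0\<close>, which keeps \<open>W\<close> adapted. Finally, the Lyapunov estimate expands
  the square of \<open>X (n+1)\<close>, the sum of \<open>X n\<close>, a noise increment and the
  integral of the drift over \<open>[n, n+1]\<close>. The product of \<open>X n\<close> with the
  noise has mean zero and the product with the drift integral yields the decrease. But the drift is
  evaluated there at \<open>X (n+r)\<close>, and moving the inward pull back to \<open>X n\<close>
  costs a multiple of the distance between the two states. As the drift is bounded, the mean of this
  distance is bounded uniformly in \<open>n\<close>.\<close>

section \<open>Continuous processes at random times and their time integrals\<close>

text \<open>Rounding \<open>T\<close> down to the dyadic grid leaves countably many values and stays
  in the initial segment \<open>S\<close>. Only \<open>Z s\<close> with \<open>s\<close> in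
  \<open>S\<close> is consulted, so for \<open>S = {0..r}\<close> the sigma-algebra \<open>N\<close>
  may be that of time \<open>r\<close>: this is progressive measurability of a continuous
  process.\<close>

lemma measurable_process_at:
  fixes Z :: "real \<Rightarrow> 'a \<Rightarrow> real"
  assumes S: "S \<subseteq> {0..}" "\<And>r s. s \<in> S \<Longrightarrow> 0 \<le> r \<Longrightarrow> r \<le> s \<Longrightarrow> r \<in> S"
    and Z: "\<And>s. s \<in> S \<Longrightarrow> Z s \<in> borel_measurable N"
    and cont: "\<And>\<omega>. \<omega> \<in> space N \<Longrightarrow> continuous_on S (\<lambda>s. Z s \<omega>)"
    and T: "T \<in> borel_measurable N" "\<And>\<omega>. \<omega> \<in> space N \<Longrightarrow> T \<omega> \<in> S"
  shows "(\<lambda>\<omega>. Z (T \<omega>) \<omega>) \<in> borel_measurable N"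
proof -
  define Tn where "Tn n \<omega> = real_of_int \<lfloor>T \<omega> * 2 ^ n\<rfloor> / 2 ^ n" for n :: nat and \<omega>
  have bd: "0 \<le> Tn n \<omega>" "Tn n \<omega> \<le> T \<omega>" "T \<omega> - (1/2)^n \<le> Tn n \<omega>" if "\<omega> \<in> space N" for n \<omega>
  proof -
    have "0 \<le> T \<omega>" using T(2)[OF that] S(1) by auto
    then show "0 \<le> Tn n \<omega>" by (simp add: Tn_def)
    show "Tn n \<omega> \<le> T \<omega>" by (simp add: Tn_def field_simps)
    have "T \<omega> * 2^n - 1 \<le> real_of_int \<lfloor>T \<omega> * 2 ^ n\<rfloor>" by linarith
    then have "(T \<omega> * 2^n - 1) / 2^n \<le> Tn n \<omega>" unfolding Tn_def by (intro divide_right_mono) auto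
    then show "T \<omega> - (1/2)^n \<le> Tn n \<omega>" by (simp add: diff_divide_distrib power_divide)
  qed
  have inS: "Tn n \<omega> \<in> S" if "\<omega> \<in> space N" for n \<omega>
    using S(2)[OF T(2)[OF that] bd(1,2)[OF that]] .
  \<comment> \<open>\<open>measurable_compose_countable\<close> ranges over all integers, hence also
    over grid times outside \<open>S\<close>, where nothing is known about \<open>Z\<close>.\<close>
  define Z' where "Z' s = (if s \<in> S then Z s else (\<lambda>_. 0))" for s
  have Z'm: "Z' s \<in> borel_measurable N" for s using Z by (auto simp: Z'_def)
  note T(1)[measurable]
  have "(\<lambda>\<omega>. Z' (real_of_int \<lfloor>T \<omega> * 2 ^ n\<rfloor> / 2 ^ n) \<omega>) \<in> borel_measurable N" for n
    by (rule measurable_compose_countable[where f="\<lambda>i \<omega>. Z' (real_of_int i / 2 ^ n) \<omega>"])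
       (use Z'm in \<open>auto\<close>)
  then have m: "(\<lambda>\<omega>. Z' (Tn n \<omega>) \<omega>) \<in> borel_measurable N" for n by (simp add: Tn_def)
  show ?thesis
  proof (rule borel_measurable_LIMSEQ_real[OF _ m])
    fix \<omega> assume w: "\<omega> \<in> space N"
    have "(\<lambda>n. Tn n \<omega>) \<longlonglongrightarrow> T \<omega>"
    proof (rule tendsto_sandwich)
      show "(\<lambda>n. T \<omega> - (1/2)^n) \<longlonglongrightarrow> T \<omega>"
        by (auto intro!: tendsto_eq_intros LIMSEQ_power_zero)
      show "(\<lambda>n. T \<omega>) \<longlonglongrightarrow> T \<omega>" by simp
    qed (use bd[OF w] in \<open>auto intro!: always_eventually\<close>)
    then have "(\<lambda>n. Z (Tn n \<omega>) \<omega>) \<longlonglongrightarrow> Z (T \<omega>) \<omega>"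
      by (rule continuous_on_tendsto_compose[OF cont[OF w]]) (use T(2)[OF w] inS[OF w] in auto)
    then show "(\<lambda>n. Z' (Tn n \<omega>) \<omega>) \<longlonglongrightarrow> Z (T \<omega>) \<omega>"
      using inS[OF w] by (simp add: Z'_def)
  qed
qed

lemma measurable_integral_process:
  fixes Z :: "real \<Rightarrow> 'a \<Rightarrow> real"
  assumes Z: "\<And>s. 0 \<le> s \<Longrightarrow> s \<le> t \<Longrightarrow> Z s \<in> borel_measurable N"
    and cont: "\<And>\<omega>. \<omega> \<in> space N \<Longrightarrow> continuous_on {0..t} (\<lambda>s. Z s \<omega>)"
    and "0 \<le> t"
  shows "(\<lambda>\<omega>. integral {0..t} (\<lambda>s. Z s \<omega>)) \<in> borel_measurable N"
proof -
  \<comment> \<open>Joint measurability is needed to integrate over time. Clamping the time to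
    \<open>[0,t]\<close> makes the process total and changes nothing on the range of
    integration.\<close>
  have "(\<lambda>p. Z (max 0 (min t (snd p))) (fst p)) \<in> borel_measurable (N \<Otimes>\<^sub>M lborel)"
    by (rule measurable_process_at[where S="{0..t}" and Z="\<lambda>s p. Z s (fst p)"])
       (use assms in \<open>auto simp: space_pair_measure intro: measurable_compose[OF measurable_fst]\<close>)
  then have [measurable]: "(\<lambda>(\<omega>, s). Z (max 0 (min t s)) \<omega>) \<in> borel_measurable (N \<Otimes>\<^sub>M lborel)"
    by (simp add: case_prod_beta)
  have "(\<lambda>\<omega>. LINT s|lborel. indicator {0..t} s *\<^sub>R Z (max 0 (min t s)) \<omega>) \<in> borel_measurable N"
    by (rule lborel.borel_measurable_lebesgue_integral) measurable
  moreover have "integral {0..t} (\<lambda>s. Z s \<omega>) = (LINT s|lborel. indicator {0..t} s *\<^sub>R Z (max 0 (min t s)) \<omega>)"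
    if "\<omega> \<in> space N" for \<omega>
  proof -
    have "integral {0..t} (\<lambda>s. Z s \<omega>) = (LINT s:{0..t}|lborel. Z s \<omega>)"
      using set_borel_integral_eq_integral(2)[OF borel_integrable_atLeastAtMost'[OF cont[OF that]]] by simp
    then show ?thesis
      unfolding set_lebesgue_integral_def by (auto intro!: Bochner_Integration.integral_cong simp: indicator_def)
  qed
  ultimately show ?thesis by (subst measurable_cong) auto
qed

section \<open>Borel sets of the path space\<close>

definition path_nbhd :: "(real \<Rightarrow> real) \<Rightarrow> real \<Rightarrow> real \<Rightarrow> (real \<Rightarrow> real) set" where
  "path_nbhd w r e = {v \<in> path_carrier. \<forall>t\<in>{0..r}. \<bar>v t - w t\<bar> < e}"

lemma path_topology_eq:
  "path_topology = topology_generated_by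
     {path_nbhd w r e | w r e. w \<in> path_carrier \<and> 0 \<le> r \<and> 0 < e}"
  by (simp add: path_topology_def path_nbhd_def)

lemma path_carrier_continuous_on: "w \<in> path_carrier \<Longrightarrow> S \<subseteq> {0..} \<Longrightarrow> continuous_on S w"
  by (auto simp: path_carrier_def intro: continuous_on_subset)

lemma path_nbhd_self: "w \<in> path_carrier \<Longrightarrow> 0 < e \<Longrightarrow> w \<in> path_nbhd w r e"
  by (auto simp: path_nbhd_def)

lemma openin_path_nbhd: "w \<in> path_carrier \<Longrightarrow> 0 \<le> r \<Longrightarrow> 0 < e \<Longrightarrow> openin path_topology (path_nbhd w r e)"
  unfolding path_topology_eq by (rule topology_generated_by_Basis) auto

lemma openin_path_subset: "openin path_topology V \<Longrightarrow> V \<subseteq> path_carrier"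
proof -
  have "topspace path_topology \<subseteq> path_carrier"
    unfolding path_topology_eq by (auto simp: path_nbhd_def)
  then show "openin path_topology V \<Longrightarrow> V \<subseteq> path_carrier"
    using openin_subset by blast
qed

lemma space_path_borel: "space path_borel = path_carrier"
  unfolding path_borel_def using openin_path_subset by (intro space_measure_of) auto

lemma sets_path_borel: "sets path_borel = sigma_sets path_carrier {V. openin path_topology V}"
  unfolding path_borel_def using openin_path_subset by (intro sets_measure_of) auto

text \<open>By compactness the largest distance between \<open>v\<close> and \<open>w\<close> on
  \<open>[0,r]\<close> is attained, hence strictly below \<open>e\<close>; what is left of
  \<open>e\<close> serves as the radius around \<open>v\<close>.\<close>

lemma path_nbhd_shrink:
  assumes v: "v \<in> path_nbhd w r e" and w: "w \<in> path_carrier" and r: "0 \<le> r"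
  obtains d where "0 < d" "path_nbhd v r d \<subseteq> path_nbhd w r e"
proof -
  have vc: "v \<in> path_carrier" using v by (simp add: path_nbhd_def)
  have "continuous_on {0..r} (\<lambda>t. \<bar>v t - w t\<bar>)"
    using path_carrier_continuous_on[of _ "{0..r}"] vc w by (intro continuous_intros) auto
  then obtain s where s: "s \<in> {0..r}" "\<And>t. t \<in> {0..r} \<Longrightarrow> \<bar>v t - w t\<bar> \<le> \<bar>v s - w s\<bar>"
    using continuous_attains_sup[of "{0..r}" "\<lambda>t. \<bar>v t - w t\<bar>"] r by auto
  have "path_nbhd v r (e - \<bar>v s - w s\<bar>) \<subseteq> path_nbhd w r e"
    unfolding path_nbhd_def by (clarsimp) (smt (verit, best) atLeastAtMost_iff s(2))
  moreover have "0 < e - \<bar>v s - w s\<bar>" using v s by (auto simp: path_nbhd_def)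
  ultimately show ?thesis using that by blast
qed

text \<open>The neighbourhoods are given only as a subbase. Induction over the generated topology
  shows that they form a base: an intersection takes the longer horizon and the smaller
  radius.\<close>

lemma openin_path_nbhd_subset:
  assumes "openin path_topology V" "v \<in> V"
  shows "\<exists>r\<ge>0. \<exists>e>0. path_nbhd v r e \<subseteq> V"
proof -
  have "generate_topology_on {path_nbhd w r e | w r e. w \<in> path_carrier \<and> 0 \<le> r \<and> 0 < e} V"
    using assms(1) unfolding path_topology_eq by (rule openin_topology_generated_by)
  then show ?thesis using assms(2)
  proof (induction arbitrary: v)
    case (Int a b)
    obtain r e where 1: "r \<ge> 0" "e > 0" "path_nbhd v r e \<subseteq> a" using Int.IH(1) Int.prems by blast
    obtain r' e' where 2: "r' \<ge> 0" "e' > 0" "path_nbhd v r' e' \<subseteq> b" using Int.IH(2) Int.prems by blast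
    have "path_nbhd v (max r r') (min e e') \<subseteq> a \<inter> b"
      using 1 2 by (force simp: path_nbhd_def)
    then show ?case using 1 2 by (intro exI[of _ "max r r'"] conjI exI[of _ "min e e'"]) auto
  next
    case (UN K)
    then show ?case by (meson UnionE Union_upper subset_trans)
  next
    case (Basis s)
    then show ?case using path_nbhd_shrink by (smt (verit) mem_Collect_eq)
  qed auto
qed

lemma measurable_path_eval:
  assumes "0 \<le> t" shows "(\<lambda>w. w t) \<in> borel_measurable path_borel"
proof (rule borel_measurableI)
  fix S :: "real set" assume S: "open S"
  have "openin path_topology ((\<lambda>w. w t) -` S \<inter> path_carrier)"
  proof (subst openin_subopen, safe)
    fix w assume w: "w t \<in> S" "w \<in> path_carrier"
    obtain e where e: "e > 0" "\<And>y. dist y (w t) < e \<Longrightarrow> y \<in> S" using S w(1) unfolding open_dist by blast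
    have "path_nbhd w t e \<subseteq> (\<lambda>w. w t) -` S \<inter> path_carrier"
      using e(2) assms by (auto simp: path_nbhd_def dist_real_def)
    then show "\<exists>T. openin path_topology T \<and> w \<in> T \<and> T \<subseteq> (\<lambda>w. w t) -` S \<inter> path_carrier"
      using openin_path_nbhd[OF w(2) assms e(1)] path_nbhd_self[OF w(2) e(1)] by blast
  qed
  then show "(\<lambda>w. w t) -` S \<inter> space path_borel \<in> sets path_borel"
    by (simp add: space_path_borel sets_path_borel)
qed

text \<open>A uniformly continuous path is caught by finitely many rational tubes, so these countably many
  sets form a base of the topology.\<close>

definition path_tubes :: "(rat \<times> rat \<times> rat \<times> rat) list \<Rightarrow> (real \<Rightarrow> real) set" where
  "path_tubes l = {v \<in> path_carrier. \<forall>(c, d, q, e)\<in>set l.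
     \<forall>t\<in>{of_rat c..of_rat d} \<inter> {0..}. \<bar>v t - of_rat q\<bar> \<le> of_rat e}"

lemma path_tubes_subset_nbhd:
  assumes v: "v \<in> path_carrier" and r: "0 \<le> r" and e: "0 < e"
  shows "\<exists>l. v \<in> path_tubes l \<and> path_tubes l \<subseteq> path_nbhd v r e"
proof -
  \<comment> \<open>The horizon is rounded up to an integer so that cells of length
    \<open>1 / Suc m\<close> fill it exactly.\<close>
  obtain n :: nat where n: "r < real n" using reals_Archimedean2 by blast
  have "uniformly_continuous_on {0..real n} v"
    by (intro compact_uniformly_continuous path_carrier_continuous_on[OF v]) auto
  then obtain d where d: "d > 0" "\<And>s t. s \<in> {0..real n} \<Longrightarrow> t \<in> {0..real n} \<Longrightarrow> \<bar>s - t\<bar> < d \<Longrightarrow> \<bar>v s - v t\<bar> < e/8"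
    unfolding uniformly_continuous_on_def dist_real_def using e by (metis divide_pos_pos zero_less_numeral)
  obtain m :: nat where m: "1 / real (Suc m) < d" using d(1) nat_approx_posE by blast
  \<comment> \<open>On each cell \<open>v\<close> varies by less than \<open>e/8\<close> and the
    rational \<open>q i\<close> is within \<open>e/8\<close> of its value at the left end, so
    \<open>v\<close> stays within \<open>e/4 < e'\<close> of \<open>q i\<close>. Any path of the
    tube is within \<open>e' < e/2\<close> of \<open>q i\<close>, hence within
    \<open>3/4 * e\<close> of \<open>v\<close>.\<close>
  obtain e' where e': "e/4 < of_rat e'" "of_rat e' < e/2"
    using of_rat_dense[of "e/4" "e/2"] e by auto
  have rat_near: "\<exists>q. \<bar>x - of_rat q\<bar> < e/8" for x :: real
  proof -
    obtain q where "x - e/8 < of_rat q" "of_rat q < x + e/8"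
      using of_rat_dense[of "x - e/8" "x + e/8"] e by auto
    then have "\<bar>x - of_rat q\<bar> < e/8" by linarith
    then show ?thesis by blast
  qed
  obtain q where q: "\<And>i::nat. \<bar>v (real i / real (Suc m)) - of_rat (q i)\<bar> < e/8"
    using choice[OF allI[OF rat_near], of "\<lambda>i. v (real i / real (Suc m))"] by blast
  define l :: "(rat \<times> rat \<times> rat \<times> rat) list" where "l = map (\<lambda>i. (of_nat i / of_nat (Suc m), of_nat (Suc i) / of_nat (Suc m), q i, e')) [0..<n * Suc m]"
  have l: "path_tubes l = {w \<in> path_carrier. \<forall>i<n * Suc m.
     \<forall>t\<in>{real i / real (Suc m)..real (Suc i) / real (Suc m)}. \<bar>w t - of_rat (q i)\<bar> \<le> of_rat e'}"
  proof -
    have "{real i / real (Suc m)..real (Suc i) / real (Suc m)} \<inter> {0..} = {real i / real (Suc m)..real (Suc i) / real (Suc m)}" for i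
      by (auto intro: order_trans[rotated])
    then show ?thesis
      unfolding path_tubes_def l_def
      by (simp add: of_rat_divide of_rat_add atLeast0LessThan del: of_nat_Suc)
        (simp only: Ball_def lessThan_iff)
  qed
  have cell: "real i / real (Suc m) \<in> {0..real n}" "real (Suc i) / real (Suc m) \<le> real n" if "i < n * Suc m" for i
  proof -
    have "real (Suc i) \<le> real (n * Suc m)" using that by (subst of_nat_le_iff) simp
    then show "real (Suc i) / real (Suc m) \<le> real n" by (subst divide_le_eq) (simp only: of_nat_mult of_nat_0_less_iff zero_less_Suc if_True)
    moreover have "real i / real (Suc m) \<le> real (Suc i) / real (Suc m)"
      by (intro divide_right_mono) auto
    ultimately show "real i / real (Suc m) \<in> {0..real n}" by simp
  qed
  have close: "\<bar>v t - of_rat (q i)\<bar> < e/4"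
    if i: "i < n * Suc m" and t: "t \<in> {real i / real (Suc m)..real (Suc i) / real (Suc m)}" for i t
  proof -
    have "0 \<le> real i / real (Suc m)" by simp
    then have "0 \<le> t" using t by (metis atLeastAtMost_iff order_trans)
    moreover have "\<bar>t - real i / real (Suc m)\<bar> \<le> 1 / real (Suc m)" using t by (auto simp: add_divide_distrib)
    ultimately have "\<bar>v t - v (real i / real (Suc m))\<bar> < e/8"
      using m cell[OF i] t by (intro d(2)) auto
    then show ?thesis using q[of i] by linarith
  qed
  have "v \<in> path_tubes l" unfolding l using v close e' by force
  moreover have "path_tubes l \<subseteq> path_nbhd v r e"
  proof
    fix w assume w: "w \<in> path_tubes l"
    then have wc: "w \<in> path_carrier" by (simp add: path_tubes_def)
    moreover have "\<bar>w t - v t\<bar> < e" if t: "t \<in> {0..r}" for t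
    proof -
      define i where "i = nat \<lfloor>t * real (Suc m)\<rfloor>"
      have t0: "0 \<le> t * real (Suc m)" using t by simp
      have i1: "real i \<le> t * real (Suc m)" "t * real (Suc m) < real (Suc i)"
        unfolding i_def using t0 by linarith+
      have "t * real (Suc m) < real n * real (Suc m)" using t n by (intro mult_strict_right_mono) auto
      then have "real i < real (n * Suc m)" using i1 by (simp only: of_nat_mult)
      then have i: "i < n * Suc m" by linarith
      have ti: "t \<in> {real i / real (Suc m)..real (Suc i) / real (Suc m)}"
        using i1 by (auto simp: divide_le_eq le_divide_eq simp del: of_nat_Suc)
      have "\<bar>w t - of_rat (q i)\<bar> \<le> of_rat e'" using w i ti unfolding l by blast
      then show ?thesis using close[OF i ti] e' e by linarith
    qed
    ultimately show "w \<in> path_nbhd v r e" by (simp add: path_nbhd_def)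
  qed
  ultimately show ?thesis by blast
qed

text \<open>The bound is a closed condition, so by continuity it passes from rational times to all
  times. This is why the tubes are defined with a weak inequality.\<close>

lemma ball_continuous_le_iff_rat:
  assumes v: "continuous_on {0..} v"
  shows "(\<forall>t\<in>{of_rat c..of_rat d} \<inter> {0::real..}. \<bar>v t - q\<bar> \<le> (e::real)) \<longleftrightarrow>
         (\<forall>s::rat. c \<le> s \<and> s \<le> d \<and> 0 \<le> s \<longrightarrow> \<bar>v (of_rat s) - q\<bar> \<le> e)"
proof safe
  fix s :: rat assume "\<forall>t\<in>{of_rat c..of_rat d} \<inter> {0::real..}. \<bar>v t - q\<bar> \<le> e" "c \<le> s" "s \<le> d" "0 \<le> s"
  then show "\<bar>v (of_rat s) - q\<bar> \<le> e" by (simp add: of_rat_less_eq)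
next
  fix t :: real assume *: "\<forall>s::rat. c \<le> s \<and> s \<le> d \<and> 0 \<le> s \<longrightarrow> \<bar>v (of_rat s) - q\<bar> \<le> e"
    and t: "t \<in> {of_rat c..of_rat d}" "t \<ge> 0"
  \<comment> \<open>Rational times approach \<open>t\<close> from the left, which requires room
    between \<open>c'\<close> and \<open>t\<close>; without room \<open>t = c'\<close> is itself
    rational.\<close>
  define c' where "c' = max c 0"
  have c': "real_of_rat c' \<le> t" using t by (auto simp: c'_def max_def)
  show "\<bar>v t - q\<bar> \<le> e"
  proof (cases "real_of_rat c' = t")
    case True
    then show ?thesis using * t by (metis atLeastAtMost_iff c'_def max.cobounded1 max.cobounded2 of_rat_less_eq)
  next
    case False
    then have lt: "real_of_rat c' < t" using c' by simp
    have "\<exists>s::rat. max (of_rat c') (t - 1 / real (Suc n)) < of_rat s \<and> of_rat s < t" for n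
      using of_rat_dense[of "max (of_rat c') (t - 1 / real (Suc n))" t] lt by auto
    then obtain s :: "nat \<Rightarrow> rat" where s: "\<And>n. max (of_rat c') (t - 1 / real (Suc n)) < of_rat (s n)" "\<And>n. of_rat (s n) < t"
      by metis
    have "(\<lambda>n. of_rat (s n)) \<longlonglongrightarrow> t"
    proof (rule tendsto_sandwich[OF always_eventually always_eventually])
      show "(\<lambda>n. t - 1 / real (Suc n)) \<longlonglongrightarrow> t"
        using tendsto_diff[OF tendsto_const[of t] LIMSEQ_inverse_real_of_nat] by (simp add: divide_inverse)
    qed (use s in \<open>auto intro!: less_imp_le\<close>)
    moreover have s0: "c \<le> s n \<and> s n \<le> d \<and> 0 \<le> s n" for n
    proof -
      have "real_of_rat c' < of_rat (s n)" using s(1)[of n] by simp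
      then have "c' < s n" by (simp add: of_rat_less)
      moreover have "real_of_rat (s n) < of_rat d" using s(2)[of n] t by auto
      then have "s n < d" by (simp add: of_rat_less)
      ultimately show ?thesis by (auto simp: c'_def)
    qed
    ultimately have "(\<lambda>n. v (of_rat (s n))) \<longlonglongrightarrow> v t"
      by (intro continuous_on_tendsto_compose[OF v]) (use t(2) s0 in auto)
    then have "(\<lambda>n. \<bar>v (of_rat (s n)) - q\<bar>) \<longlonglongrightarrow> \<bar>v t - q\<bar>" by (intro tendsto_intros)
    moreover have "\<bar>v (of_rat (s n)) - q\<bar> \<le> e" for n using * s0 by blast
    ultimately show ?thesis by (intro LIMSEQ_le_const2) auto
  qed
qed

text \<open>There are only countably many lists of rational data, so an open set is a countable
  union of tubes, and membership in a tube is a countable condition on coordinates at rational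
  times.\<close>

lemma measurable_path_borel:
  assumes f: "\<And>\<omega>. \<omega> \<in> space N \<Longrightarrow> f \<omega> \<in> path_carrier"
    and m: "\<And>t. 0 \<le> t \<Longrightarrow> (\<lambda>\<omega>. f \<omega> t) \<in> borel_measurable N"
  shows "f \<in> measurable N path_borel"
  unfolding path_borel_def
proof (rule measurable_measure_of)
  show "f \<in> space N \<rightarrow> path_carrier" using f by auto
  show "{V. openin path_topology V} \<subseteq> Pow path_carrier" using openin_path_subset by auto
  have "{\<omega> \<in> space N. f \<omega> \<in> path_tubes l} \<in> sets N" for l
  proof -
    have "{\<omega> \<in> space N. f \<omega> \<in> path_tubes l} = {\<omega> \<in> space N. \<forall>(c, d, q, e)\<in>set l.
       \<forall>s::rat. c \<le> s \<and> s \<le> d \<and> 0 \<le> s \<longrightarrow> \<bar>f \<omega> (of_rat s) - of_rat q\<bar> \<le> of_rat e}"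
    proof -
      have "f \<omega> \<in> path_tubes l \<longleftrightarrow> (\<forall>(c, d, q, e)\<in>set l.
         \<forall>s::rat. c \<le> s \<and> s \<le> d \<and> 0 \<le> s \<longrightarrow> \<bar>f \<omega> (of_rat s) - of_rat q\<bar> \<le> of_rat e)"
        if "\<omega> \<in> space N" for \<omega>
      proof -
        have "continuous_on {0..} (f \<omega>)" using path_carrier_continuous_on[OF f[OF that]] by simp
        then show ?thesis
          unfolding path_tubes_def mem_Collect_eq using f[OF that]
          by (simp only: ball_continuous_le_iff_rat simp_thms)
      qed
      then show ?thesis by blast
    qed
    also have "\<dots> \<in> sets N"
    proof -
      have "Measurable.pred N (\<lambda>\<omega>. c \<le> s \<and> s \<le> d \<and> 0 \<le> s \<longrightarrow> \<bar>f \<omega> (of_rat s) - of_rat q\<bar> \<le> of_rat e)"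
        for c d q e s :: rat
      proof (cases "0 \<le> s")
        case True
        then have [measurable]: "(\<lambda>\<omega>. f \<omega> (of_rat s)) \<in> borel_measurable N" by (intro m) simp
        show ?thesis by measurable
      qed simp
      then have "Measurable.pred N (\<lambda>\<omega>. \<forall>(c, d, q, e)\<in>set l.
         \<forall>s::rat. c \<le> s \<and> s \<le> d \<and> 0 \<le> s \<longrightarrow> \<bar>f \<omega> (of_rat s) - of_rat q\<bar> \<le> of_rat e)"
        by (intro pred_intros_finite) (auto intro!: pred_intros_countable simp: split_beta)
      then show ?thesis by (simp add: Measurable.pred_def)
    qed
    finally show ?thesis .
  qed
  note tubes = this
  fix V assume "V \<in> {V. openin path_topology V}"
  then have V: "openin path_topology V" by simp
  have "V = (\<Union>l\<in>{l. path_tubes l \<subseteq> V}. path_tubes l)"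
  proof -
    have "\<exists>l. v \<in> path_tubes l \<and> path_tubes l \<subseteq> V" if "v \<in> V" for v
      using openin_path_nbhd_subset[OF V that] path_tubes_subset_nbhd[of v] openin_path_subset[OF V] that
      by (meson subset_iff)
    then show ?thesis by blast
  qed
  then have "f -` V \<inter> space N = (\<Union>l\<in>{l. path_tubes l \<subseteq> V}. {\<omega> \<in> space N. f \<omega> \<in> path_tubes l})"
    by auto
  also have "\<dots> \<in> sets N"
    using tubes by (intro sets.countable_UN') auto
  finally show "f -` V \<inter> space N \<in> sets N" .
qed

section \<open>Integral equations with a Lipschitz drift\<close>

primrec picard :: "(real \<Rightarrow> real) \<Rightarrow> (real \<Rightarrow> real) \<Rightarrow> nat \<Rightarrow> real \<Rightarrow> real" where
  "picard \<beta> u 0 = u"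
| "picard \<beta> u (Suc n) = (\<lambda>t. u t + integral {0..t} (\<lambda>s. \<beta> (picard \<beta> u n s)))"

text \<open>Given as a limit of explicit iterates, and not as the unique fixed point, so that
  measurable dependence on \<open>u\<close> passes to the limit.\<close>

definition flow :: "(real \<Rightarrow> real) \<Rightarrow> (real \<Rightarrow> real) \<Rightarrow> real \<Rightarrow> real" where
  "flow \<beta> u t = lim (\<lambda>n. picard \<beta> u n t)"

definition integral_solution :: "(real \<Rightarrow> real) \<Rightarrow> (real \<Rightarrow> real) \<Rightarrow> (real \<Rightarrow> real) \<Rightarrow> bool" where
  "integral_solution \<beta> u z \<longleftrightarrow> continuous_on {0..} z \<and>
     (\<forall>t\<ge>0. z t = u t + integral {0..t} (\<lambda>s. \<beta> (z s)))"

lemma continuous_on_indefinite_integral: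
  assumes "continuous_on {0..} (f :: real \<Rightarrow> real)"
  shows "continuous_on {0..} (\<lambda>t. integral {0..t} f)"
proof (rule continuous_on_eq_continuous_within[THEN iffD2], intro ballI)
  fix t :: real assume t: "t \<in> {0..}"
  have "f integrable_on {0..t + 1}"
    using assms by (intro integrable_continuous_interval) (auto intro: continuous_on_subset)
  then have "continuous_on {0..t + 1} (\<lambda>t. integral {0..t} f)"
    by (rule indefinite_integral_continuous_1)
  then have "continuous (at t within {0..t + 1}) (\<lambda>t. integral {0..t} f)"
    using t by (simp add: continuous_on_eq_continuous_within)
  moreover have "at t within {0..} = at t within {0..t + 1}"
    by (rule at_within_nhd[where S="{..<t + 1}"]) auto
  ultimately show "continuous (at t within {0..}) (\<lambda>t. integral {0..t} f)" by simp
qed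

lemma continuous_bounded_interval:
  assumes "continuous_on {0..} (f :: real \<Rightarrow> real)"
  shows "\<exists>A. \<forall>s\<in>{0..T}. \<bar>f s\<bar> \<le> A"
proof -
  have "continuous_on {0..T} f" by (rule continuous_on_subset[OF assms]) auto
  then have "bounded (f ` {0..T})" by (intro compact_imp_bounded compact_continuous_image) auto
  then show ?thesis by (auto simp: bounded_iff)
qed

locale lipschitz_drift =
  fixes \<beta> :: "real \<Rightarrow> real" and L :: real
  assumes lipschitz: "L-lipschitz_on UNIV \<beta>" and L_pos: "0 < L"
begin

lemma drift_continuous: "continuous_on S \<beta>"
  using lipschitz_on_continuous_on[OF lipschitz] continuous_on_subset by blast

lemma drift_comp_continuous: "continuous_on S z \<Longrightarrow> continuous_on S (\<lambda>s. \<beta> (z s))"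
  using continuous_on_compose2[OF drift_continuous] by blast

lemma drift_diff_le: "\<bar>\<beta> x - \<beta> y\<bar> \<le> L * \<bar>x - y\<bar>"
  using lipschitz_onD[OF lipschitz] by (auto simp: dist_real_def)

lemma drift_measurable [measurable]: "\<beta> \<in> borel_measurable borel"
  using drift_continuous by (rule borel_measurable_continuous_onI)

text \<open>The integral operator halves the norm weighted by \<open>exp (2 L t)\<close>.\<close>

lemma integral_drift_diff_le:
  assumes z: "continuous_on {0..} z" and y: "continuous_on {0..} y"
    and le: "\<And>s. 0 \<le> s \<Longrightarrow> s \<le> T \<Longrightarrow> \<bar>z s - y s\<bar> \<le> A * exp (2 * L * s)"
    and t: "0 \<le> t" "t \<le> T"
  shows "\<bar>integral {0..t} (\<lambda>s. \<beta> (z s)) - integral {0..t} (\<lambda>s. \<beta> (y s))\<bar> \<le> A / 2 * exp (2 * L * t)"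
proof -
  have A: "0 \<le> A" using le[of 0] t by auto
  have sub: "{0..t} \<subseteq> {0..}" by auto
  have i: "(\<lambda>s. \<beta> (z s)) integrable_on {0..t}" "(\<lambda>s. \<beta> (y s)) integrable_on {0..t}"
    using drift_comp_continuous[OF continuous_on_subset[OF z sub]]
      drift_comp_continuous[OF continuous_on_subset[OF y sub]]
    by (auto intro: integrable_continuous_interval)
  have ftc: "((\<lambda>s. L * A * exp (2 * L * s)) has_integral
      (A / 2 * exp (2 * L * t) - A / 2 * exp (2 * L * 0))) {0..t}"
    using t(1)
    by (intro fundamental_theorem_of_calculus)
       (auto intro!: derivative_eq_intros simp: has_real_derivative_iff_has_vector_derivative[symmetric])
  have "norm (integral {0..t} (\<lambda>s. \<beta> (z s) - \<beta> (y s))) \<le> integral {0..t} (\<lambda>s. L * A * exp (2 * L * s))"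
  proof (rule integral_norm_bound_integral)
    fix s assume s: "s \<in> {0..t}"
    have "\<bar>\<beta> (z s) - \<beta> (y s)\<bar> \<le> L * \<bar>z s - y s\<bar>" by (rule drift_diff_le)
    also have "\<dots> \<le> L * (A * exp (2 * L * s))" using le[of s] s t L_pos by (intro mult_left_mono) auto
    finally show "norm (\<beta> (z s) - \<beta> (y s)) \<le> L * A * exp (2 * L * s)" by (simp add: mult.assoc)
  qed (use i ftc in \<open>auto intro: integrable_diff\<close>)
  also have "\<dots> \<le> A / 2 * exp (2 * L * t)" using integral_unique[OF ftc] A by simp
  finally show ?thesis using i by (simp add: Henstock_Kurzweil_Integration.integral_diff)
qed

lemma picard_continuous:
  assumes "continuous_on {0..} u" shows "continuous_on {0..} (picard \<beta> u n)"
  by (induction n)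
     (use assms in \<open>auto intro!: continuous_on_add continuous_on_indefinite_integral drift_comp_continuous\<close>)

lemma picard_step:
  assumes u: "continuous_on {0..} u" and T: "0 \<le> T"
  obtains A where "\<And>n s. 0 \<le> s \<Longrightarrow> s \<le> T \<Longrightarrow>
    \<bar>picard \<beta> u (Suc n) s - picard \<beta> u n s\<bar> \<le> A * (1/2)^n * exp (2 * L * s)"
proof -
  have "continuous_on {0..} (\<lambda>s. picard \<beta> u (Suc 0) s - picard \<beta> u 0 s)"
    by (rule continuous_on_diff[OF picard_continuous[OF u] picard_continuous[OF u]])
  from continuous_bounded_interval[OF this] obtain A where
    A: "\<And>s. s \<in> {0..T} \<Longrightarrow> \<bar>picard \<beta> u (Suc 0) s - picard \<beta> u 0 s\<bar> \<le> A" by blast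
  have A0: "0 \<le> A" using A[of 0] T by auto
  have "\<bar>picard \<beta> u (Suc n) s - picard \<beta> u n s\<bar> \<le> A * (1/2)^n * exp (2 * L * s)"
    if "0 \<le> s" "s \<le> T" for n s
    using that
  proof (induction n arbitrary: s)
    case 0
    have "A * 1 \<le> A * exp (2 * L * s)" using A0 L_pos 0 by (intro mult_left_mono) auto
    then show ?case using A[of s] 0 by auto
  next
    case (Suc n)
    have "\<bar>integral {0..s} (\<lambda>s. \<beta> (picard \<beta> u (Suc n) s)) - integral {0..s} (\<lambda>s. \<beta> (picard \<beta> u n s))\<bar>
        \<le> A * (1/2)^n / 2 * exp (2 * L * s)"
      using Suc.IH Suc.prems by (intro integral_drift_diff_le[where T=T] picard_continuous u) auto
    then show ?case by simp
  qed
  then show ?thesis using that by blast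
qed

lemma picard_uniform_limit:
  assumes u: "continuous_on {0..} u" and T: "0 \<le> T"
  shows "uniform_limit {0..T} (\<lambda>n t. picard \<beta> u n t) (flow \<beta> u) sequentially"
proof -
  obtain A where A: "\<And>n s. 0 \<le> s \<Longrightarrow> s \<le> T \<Longrightarrow>
    \<bar>picard \<beta> u (Suc n) s - picard \<beta> u n s\<bar> \<le> A * (1/2)^n * exp (2 * L * s)"
    using picard_step[OF u T] by blast
  have A0: "0 \<le> A" using A[of 0 0] T by auto
  \<comment> \<open>The iterates are the partial sums of a telescoping series, so the geometric
    bound on the steps feeds the M-test.\<close>
  have "uniformly_convergent_on {0..T} (\<lambda>n t. \<Sum>i<n. picard \<beta> u (Suc i) t - picard \<beta> u i t)"
  proof (rule Weierstrass_m_test')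
    show "norm (picard \<beta> u (Suc n) s - picard \<beta> u n s) \<le> A * exp (2 * L * T) * (1/2)^n"
      if "s \<in> {0..T}" for n s
    proof -
      have "A * (1/2)^n * exp (2 * L * s) \<le> A * (1/2)^n * exp (2 * L * T)"
        using that A0 L_pos by (intro mult_left_mono) auto
      then show ?thesis using A[of s n] that by (auto simp: mult_ac)
    qed
    show "summable (\<lambda>n. A * exp (2 * L * T) * (1/2)^n)" by (intro summable_mult summable_geometric) auto
  qed
  then obtain l where "uniform_limit {0..T} (\<lambda>n t. \<Sum>i<n. picard \<beta> u (Suc i) t - picard \<beta> u i t) l sequentially"
    unfolding uniformly_convergent_on_def by blast
  then have "uniform_limit {0..T} (\<lambda>n t. u t + (\<Sum>i<n. picard \<beta> u (Suc i) t - picard \<beta> u i t)) (\<lambda>t. u t + l t) sequentially"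
    by (intro uniform_limit_intros)
  moreover have "u t + (\<Sum>i<n. picard \<beta> u (Suc i) t - picard \<beta> u i t) = picard \<beta> u n t" for n t
    by (subst sum_lessThan_telescope) simp
  ultimately have l: "uniform_limit {0..T} (\<lambda>n t. picard \<beta> u n t) (\<lambda>t. u t + l t) sequentially"
    by simp
  have "flow \<beta> u t = u t + l t" if "t \<in> {0..T}" for t
    unfolding flow_def using tendsto_uniform_limitI[OF l that] by (rule limI)
  then show ?thesis
    using l uniform_limit_cong'[of "{0..T}" "picard \<beta> u" "picard \<beta> u" "flow \<beta> u" "\<lambda>t. u t + l t"] by simp
qed

lemma picard_LIMSEQ:
  assumes "continuous_on {0..} u" "0 \<le> t"
  shows "(\<lambda>n. picard \<beta> u n t) \<longlonglongrightarrow> flow \<beta> u t"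
  using tendsto_uniform_limitI[OF picard_uniform_limit[OF assms]] assms(2) by auto

text \<open>The limit is taken in the Picard recursion: uniform convergence on compact intervals
  survives composition with the Lipschitz drift and integration.\<close>

lemma flow_solution:
  assumes u: "continuous_on {0..} u"
  shows "integral_solution \<beta> u (flow \<beta> u)"
  unfolding integral_solution_def
proof (intro conjI allI impI)
  have cT: "continuous_on {0..T} (flow \<beta> u)" if "0 \<le> T" for T
    by (rule uniform_limit_theorem[OF always_eventually picard_uniform_limit[OF u that]])
       (auto intro: continuous_on_subset[OF picard_continuous[OF u]])
  show "continuous_on {0..} (flow \<beta> u)"
  proof (rule continuous_on_eq_continuous_within[THEN iffD2], intro ballI)
    fix t :: real assume t: "t \<in> {0..}"
    have "at t within {0..} = at t within {0..t + 1}"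
      by (rule at_within_nhd[where S="{..<t + 1}"]) auto
    then show "continuous (at t within {0..}) (flow \<beta> u)"
      using cT[of "t + 1"] t by (simp add: continuous_on_eq_continuous_within)
  qed
  fix t :: real assume t: "0 \<le> t"
  have "uniform_limit {0..t} (\<lambda>n s. \<beta> (picard \<beta> u n s)) (\<lambda>s. \<beta> (flow \<beta> u s)) sequentially"
    by (rule uniform_limit_compose_uniformly_continuous_on[OF picard_uniform_limit[OF u t]
          lipschitz_on_uniformly_continuous[OF lipschitz]]) auto
  moreover have "continuous_on {0..t} (\<lambda>s. \<beta> (picard \<beta> u n s))" for n
    by (intro drift_comp_continuous continuous_on_subset[OF picard_continuous[OF u]]) auto
  ultimately obtain I J where "\<And>n. ((\<lambda>s. \<beta> (picard \<beta> u n s)) has_integral I n) {0..t}"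
      "((\<lambda>s. \<beta> (flow \<beta> u s)) has_integral J) {0..t}" "I \<longlonglongrightarrow> J"
    by (rule uniform_limit_integral[where f="\<lambda>n s. \<beta> (picard \<beta> u n s)" and F=sequentially]) auto
  then have "(\<lambda>n. integral {0..t} (\<lambda>s. \<beta> (picard \<beta> u n s))) \<longlonglongrightarrow> integral {0..t} (\<lambda>s. \<beta> (flow \<beta> u s))"
    using integral_unique by (metis (no_types, lifting) ext)
  then have "(\<lambda>n. picard \<beta> u (Suc n) t) \<longlonglongrightarrow> u t + integral {0..t} (\<lambda>s. \<beta> (flow \<beta> u s))"
    by (auto intro: tendsto_add)
  moreover have "(\<lambda>n. picard \<beta> u (Suc n) t) \<longlonglongrightarrow> flow \<beta> u t"
    using picard_LIMSEQ[OF u t] by (rule LIMSEQ_Suc)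
  ultimately show "flow \<beta> u t = u t + integral {0..t} (\<lambda>s. \<beta> (flow \<beta> u s))"
    using LIMSEQ_unique by blast
qed

text \<open>In place of Gronwall's inequality the halving estimate is iterated: the difference of
  two solutions is at most \<open>A / 2^n\<close> in the weighted norm, for every
  \<open>n\<close>.\<close>

lemma integral_solution_unique:
  assumes z: "integral_solution \<beta> u z" and y: "integral_solution \<beta> u y" and t: "0 \<le> t"
  shows "z t = y t"
proof -
  have c: "continuous_on {0..} z" "continuous_on {0..} y" using z y by (auto simp: integral_solution_def)
  have "continuous_on {0..} (\<lambda>s. z s - y s)" using c by (rule continuous_on_diff)
  from continuous_bounded_interval[OF this] obtain A where
    A: "\<And>s. s \<in> {0..t} \<Longrightarrow> \<bar>z s - y s\<bar> \<le> A" by blast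
  have A0: "0 \<le> A" using A[of 0] t by auto
  have le: "\<bar>z s - y s\<bar> \<le> A * (1/2)^n * exp (2 * L * s)" if "0 \<le> s" "s \<le> t" for s n
    using that
  proof (induction n arbitrary: s)
    case 0
    have "A * 1 \<le> A * exp (2 * L * s)" using A0 L_pos 0 by (intro mult_left_mono) auto
    then show ?case using A[of s] 0 by auto
  next
    case (Suc n)
    have "\<bar>integral {0..s} (\<lambda>s. \<beta> (z s)) - integral {0..s} (\<lambda>s. \<beta> (y s))\<bar> \<le> A * (1/2)^n / 2 * exp (2 * L * s)"
      using Suc.IH Suc.prems by (intro integral_drift_diff_le[where T=t] c) auto
    moreover have "z s = u s + integral {0..s} (\<lambda>s. \<beta> (z s))" "y s = u s + integral {0..s} (\<lambda>s. \<beta> (y s))"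
      using z y Suc.prems unfolding integral_solution_def by blast+
    ultimately show ?case by simp
  qed
  have "(\<lambda>n. A * (1/2)^n * exp (2 * L * t)) \<longlonglongrightarrow> A * 0 * exp (2 * L * t)"
    by (intro tendsto_intros LIMSEQ_power_zero) auto
  then have "\<bar>z t - y t\<bar> \<le> A * 0 * exp (2 * L * t)"
    by (rule LIMSEQ_le_const) (use le[OF t] in auto)
  then show ?thesis by simp
qed

lemma flow_unique: "continuous_on {0..} u \<Longrightarrow> integral_solution \<beta> u z \<Longrightarrow> 0 \<le> t \<Longrightarrow> z t = flow \<beta> u t"
  using integral_solution_unique flow_solution by blast

lemma integral_solution_cong:
  assumes "\<And>t. 0 \<le> t \<Longrightarrow> u t = u' t" "\<And>t. 0 \<le> t \<Longrightarrow> z t = z' t"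
  shows "integral_solution \<beta> u z \<longleftrightarrow> integral_solution \<beta> u' z'"
proof -
  have "continuous_on {0..} z \<longleftrightarrow> continuous_on {0..} z'"
    using assms(2) by (intro continuous_on_cong) auto
  moreover have "integral {0..t} (\<lambda>s. \<beta> (z s)) = integral {0..t} (\<lambda>s. \<beta> (z' s))" for t
    using assms(2) by (intro integral_cong) auto
  ultimately show ?thesis unfolding integral_solution_def using assms by auto
qed

text \<open>Time homogeneity, path by path: after \<open>s\<close> the same equation holds, started
  at \<open>z s\<close> and driven by the later increments of \<open>u\<close>. As no exceptional
  set depends on \<open>s\<close>, the time may be chosen separately for each path, in particular as
  a stopping time.\<close>

lemma integral_solution_shift:
  assumes z: "integral_solution \<beta> u z" and s: "0 \<le> s"
  shows "integral_solution \<beta> (\<lambda>t. z s + (u (s + t) - u s)) (\<lambda>t. z (s + t))"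
  unfolding integral_solution_def
proof (intro conjI allI impI)
  have c: "continuous_on {0..} z" using z by (simp add: integral_solution_def)
  show "continuous_on {0..} (\<lambda>t. z (s + t))"
    using s by (intro continuous_on_compose2[OF c]) (auto intro!: continuous_intros)
  fix t :: real assume t: "0 \<le> t"
  have "continuous_on {0..s + t} (\<lambda>r. \<beta> (z r))"
    by (intro drift_comp_continuous continuous_on_subset[OF c]) auto
  then have i: "(\<lambda>r. \<beta> (z r)) integrable_on {0..s + t}" by (rule integrable_continuous_interval)
  then have "integral {0..s} (\<lambda>r. \<beta> (z r)) + integral {s..s + t} (\<lambda>r. \<beta> (z r)) = integral {0..s + t} (\<lambda>r. \<beta> (z r))"
    using s t by (intro Henstock_Kurzweil_Integration.integral_combine) auto
  moreover have "integral {s..s + t} (\<lambda>r. \<beta> (z r)) = integral {0..t} (\<lambda>r. \<beta> (z (s + r)))"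
  proof -
    have "(\<lambda>r. \<beta> (z r)) integrable_on {s..s + t}"
      using i s t by (auto intro: integrable_on_subinterval)
    then have "((\<lambda>r. \<beta> (z r)) has_integral integral {s..s + t} (\<lambda>r. \<beta> (z r))) (cbox s (s + t))"
      by (simp add: has_integral_integral)
    from has_integral_affinity[OF this, of 1 s]
    have "((\<lambda>r. \<beta> (z (s + r))) has_integral integral {s..s + t} (\<lambda>r. \<beta> (z r))) {0..t}"
      by (simp add: add.commute image_affinity_atLeastAtMost)
    then show ?thesis by (simp add: integral_unique)
  qed
  ultimately show "z (s + t) = z s + (u (s + t) - u s) + integral {0..t} (\<lambda>r. \<beta> (z (s + r)))"
    using z s t unfolding integral_solution_def by (simp add: algebra_simps)
qed

text \<open>Measurability of the driving path is asked only up to time \<open>t\<close>; with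
  \<open>N\<close> the sigma-algebra of time \<open>t\<close> this yields adaptedness of the
  solution.\<close>

lemma measurable_flow:
  assumes u: "\<And>s. 0 \<le> s \<Longrightarrow> s \<le> t \<Longrightarrow> (\<lambda>\<omega>. u \<omega> s) \<in> borel_measurable N"
    and c: "\<And>\<omega>. \<omega> \<in> space N \<Longrightarrow> continuous_on {0..} (u \<omega>)" and t: "0 \<le> t"
  shows "(\<lambda>\<omega>. flow \<beta> (u \<omega>) t) \<in> borel_measurable N"
proof (rule borel_measurable_LIMSEQ_real)
  show "(\<lambda>n. picard \<beta> (u \<omega>) n t) \<longlonglongrightarrow> flow \<beta> (u \<omega>) t" if "\<omega> \<in> space N" for \<omega>
    using picard_LIMSEQ c that t by blast
  have "(\<lambda>\<omega>. picard \<beta> (u \<omega>) n s) \<in> borel_measurable N" if "0 \<le> s" "s \<le> t" for n s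
    using that
  proof (induction n arbitrary: s)
    case 0
    then show ?case using u by simp
  next
    case (Suc n)
    note [measurable] = Suc.IH u
    have "(\<lambda>\<omega>. integral {0..s} (\<lambda>r. \<beta> (picard \<beta> (u \<omega>) n r))) \<in> borel_measurable N"
    proof (rule measurable_integral_process)
      show "(\<lambda>\<omega>. \<beta> (picard \<beta> (u \<omega>) n r)) \<in> borel_measurable N" if "0 \<le> r" "r \<le> s" for r
        using Suc.IH[of r] that Suc.prems by (intro measurable_compose[OF _ drift_measurable]) auto
      show "continuous_on {0..s} (\<lambda>r. \<beta> (picard \<beta> (u \<omega>) n r))" if "\<omega> \<in> space N" for \<omega>
        by (intro drift_comp_continuous continuous_on_subset[OF picard_continuous[OF c[OF that]]]) auto
    qed (use Suc in auto)
    then show ?case using u[of s] Suc.prems by simp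
  qed
  then show "(\<lambda>\<omega>. picard \<beta> (u \<omega>) n t) \<in> borel_measurable N" for n using t by auto
qed

end

section \<open>The strong Markov property of Brownian motion\<close>

text \<open>For fixed \<open>G\<close> both sides are finite measures in \<open>E\<close>, so
  Dynkin's lemma applies. \<open>E\<close> ranges over the sigma-algebra generated by the given
  sets, which may be smaller than \<open>sets N\<close>: in \<open>markov\<close> it is first a
  single grid algebra.\<close>

lemma (in prob_space) indep_law_extend:
  assumes G: "G \<in> events" and X: "X \<in> measurable M N" and Y: "Y \<in> measurable M N"
    and P: "\<P> \<subseteq> sets N" "Int_stable \<P>"
    and eq: "\<And>E. E \<in> \<P> \<Longrightarrow> prob (G \<inter> {\<omega> \<in> space M. X \<omega> \<in> E}) = prob G * prob {\<omega> \<in> space M. Y \<omega> \<in> E}"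
    and E: "E \<in> sigma_sets (space N) \<P>"
  shows "prob (G \<inter> {\<omega> \<in> space M. X \<omega> \<in> E}) = prob G * prob {\<omega> \<in> space M. Y \<omega> \<in> E}"
proof -
  have sub: "\<P> \<subseteq> Pow (space N)" using P(1) sets.sets_into_space by blast
  have sig: "sigma_sets (space N) \<P> \<subseteq> sets N" using P(1) by (rule sets.sigma_sets_subset)
  have mX: "{\<omega> \<in> space M. X \<omega> \<in> A} \<in> events" if "A \<in> sets N" for A
    using measurable_sets[OF X that] by (simp add: vimage_def Int_def conj_commute)
  have mY: "{\<omega> \<in> space M. Y \<omega> \<in> A} \<in> events" if "A \<in> sets N" for A
    using measurable_sets[OF Y that] by (simp add: vimage_def Int_def conj_commute)
  show ?thesis using P(2) sub E
  proof (induction rule: sigma_sets_induct_disjoint)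
    case (basic A)
    then show ?case by (rule eq)
  next
    case empty
    then show ?case by simp
  next
    case (compl A)
    then have A: "A \<in> sets N" using sig by blast
    have "prob (G \<inter> {\<omega> \<in> space M. X \<omega> \<in> space N - A}) = prob (G - G \<inter> {\<omega> \<in> space M. X \<omega> \<in> A})"
      using measurable_space[OF X] sets.sets_into_space[OF G] by (intro arg_cong[where f=prob]) auto
    also have "\<dots> = prob G - prob (G \<inter> {\<omega> \<in> space M. X \<omega> \<in> A})"
      using G mX[OF A] by (intro finite_measure_Diff) auto
    also have "\<dots> = prob G * (1 - prob {\<omega> \<in> space M. Y \<omega> \<in> A})"
      using compl by (simp add: algebra_simps)
    also have "1 - prob {\<omega> \<in> space M. Y \<omega> \<in> A} = prob (space M - {\<omega> \<in> space M. Y \<omega> \<in> A})"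
      using prob_compl[OF mY[OF A]] by simp
    also have "space M - {\<omega> \<in> space M. Y \<omega> \<in> A} = {\<omega> \<in> space M. Y \<omega> \<in> space N - A}"
      using measurable_space[OF Y] by auto
    finally show ?case .
  next
    case (union A)
    then have A: "A i \<in> sets N" for i using sig by blast
    have "(\<lambda>i. prob (G \<inter> {\<omega> \<in> space M. X \<omega> \<in> A i})) sums prob (\<Union>i. G \<inter> {\<omega> \<in> space M. X \<omega> \<in> A i})"
      using mX[OF A] G union.hyps(1) by (intro finite_measure_UNION) (auto simp: disjoint_family_on_def)
    moreover have "(\<lambda>i. prob {\<omega> \<in> space M. Y \<omega> \<in> A i}) sums prob (\<Union>i. {\<omega> \<in> space M. Y \<omega> \<in> A i})"
      using mY[OF A] union.hyps(1) by (intro finite_measure_UNION) (auto simp: disjoint_family_on_def)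
    then have "(\<lambda>i. prob G * prob {\<omega> \<in> space M. Y \<omega> \<in> A i}) sums (prob G * prob (\<Union>i. {\<omega> \<in> space M. Y \<omega> \<in> A i}))"
      by (rule sums_mult)
    ultimately have "prob (\<Union>i. G \<inter> {\<omega> \<in> space M. X \<omega> \<in> A i}) = prob G * prob (\<Union>i. {\<omega> \<in> space M. Y \<omega> \<in> A i})"
      using union by (simp add: sums_unique2)
    moreover have "(\<Union>i. G \<inter> {\<omega> \<in> space M. X \<omega> \<in> A i}) = G \<inter> {\<omega> \<in> space M. X \<omega> \<in> \<Union>(range A)}"
      "(\<Union>i. {\<omega> \<in> space M. Y \<omega> \<in> A i}) = {\<omega> \<in> space M. Y \<omega> \<in> \<Union>(range A)}" by auto
    ultimately show ?case by simp
  qed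
qed

text \<open>As an identity of measures the product rule can be integrated; restriction to
  \<open>G\<close> becomes a density.\<close>

lemma (in prob_space) indep_law_distr:
  assumes G: "G \<in> events" and X: "X \<in> measurable M N" and Y: "Y \<in> measurable M N"
    and eq: "\<And>E. E \<in> sets N \<Longrightarrow> prob (G \<inter> {\<omega> \<in> space M. X \<omega> \<in> E}) = prob G * prob {\<omega> \<in> space M. Y \<omega> \<in> E}"
  shows "distr (density M (indicator G)) N X = density (distr M N Y) (\<lambda>_. ennreal (prob G))"
proof (rule measure_eqI)
  fix E assume "E \<in> sets (distr (density M (indicator G)) N X)"
  then have E: "E \<in> sets N" by simp
  note [measurable] = G X Y E
  have "emeasure (distr (density M (indicator G)) N X) E = emeasure (density M (indicator G)) (X -` E \<inter> space M)"
    by (subst emeasure_distr) auto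
  also have "\<dots> = (\<integral>\<^sup>+\<omega>. indicator G \<omega> * indicator (X -` E \<inter> space M) \<omega> \<partial>M)"
    using measurable_sets[OF X E] by (intro emeasure_density) auto
  also have "\<dots> = (\<integral>\<^sup>+\<omega>. indicator (G \<inter> (X -` E \<inter> space M)) \<omega> \<partial>M)"
    by (simp only: indicator_inter_arith)
  also have "\<dots> = emeasure M (G \<inter> (X -` E \<inter> space M))"
    using measurable_sets[OF X E] G by (intro nn_integral_indicator) auto
  also have "\<dots> = ennreal (prob G * prob {\<omega> \<in> space M. Y \<omega> \<in> E})"
    using eq[OF E] by (simp add: emeasure_eq_measure vimage_def Int_def conj_commute)
  also have "\<dots> = ennreal (prob G) * emeasure (distr M N Y) E"
    by (simp add: emeasure_distr emeasure_eq_measure ennreal_mult vimage_def Int_def conj_commute)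
  also have "\<dots> = emeasure (density (distr M N Y) (\<lambda>_. ennreal (prob G))) E"
    by (simp add: emeasure_density_const)
  finally show "emeasure (distr (density M (indicator G)) N X) E
      = emeasure (density (distr M N Y) (\<lambda>_. ennreal (prob G))) E" .
qed simp

lemma (in prob_space) indep_law_nn_integral:
  assumes G: "G \<in> events" and X: "X \<in> measurable M N" and Y: "Y \<in> measurable M N"
    and eq: "\<And>E. E \<in> sets N \<Longrightarrow> prob (G \<inter> {\<omega> \<in> space M. X \<omega> \<in> E}) = prob G * prob {\<omega> \<in> space M. Y \<omega> \<in> E}"
    and f: "f \<in> borel_measurable N"
  shows "(\<integral>\<^sup>+\<omega>. indicator G \<omega> * f (X \<omega>) \<partial>M) = ennreal (prob G) * (\<integral>\<^sup>+\<omega>. f (Y \<omega>) \<partial>M)"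
proof -
  note [measurable] = G X Y f
  have "(\<integral>\<^sup>+\<omega>. indicator G \<omega> * f (X \<omega>) \<partial>M) = (\<integral>\<^sup>+x. f x \<partial>distr (density M (indicator G)) N X)"
    by (simp add: nn_integral_distr nn_integral_density)
  also have "\<dots> = ennreal (prob G) * (\<integral>\<^sup>+\<omega>. f (Y \<omega>) \<partial>M)"
    by (subst indep_law_distr[OF G X Y eq]) (simp_all add: nn_integral_density nn_integral_cmult nn_integral_distr)
  finally show ?thesis .
qed

section \<open>Dyadic increments as generators of the Borel sets\<close>

text \<open>\<open>measurable_path_borel\<close> applied to the identity map: it is measurable from
  the generated sigma-algebra, so preimages of Borel sets, that is the sets themselves, belong to
  it.\<close>

lemma sigma_algebra_path_evals:
  assumes sub: "\<P> \<subseteq> Pow path_carrier"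
    and ev: "\<And>t. 0 \<le> t \<Longrightarrow> (\<lambda>w. w t) \<in> borel_measurable (sigma path_carrier \<P>)"
  shows "sets path_borel \<subseteq> sigma_sets path_carrier \<P>"
proof -
  have sp: "space (sigma path_carrier \<P>) = path_carrier" using sub by (rule space_measure_of)
  have id: "(\<lambda>w. w) \<in> measurable (sigma path_carrier \<P>) path_borel"
    by (rule measurable_path_borel) (use ev sp in auto)
  have "E \<in> sets (sigma path_carrier \<P>)" if "E \<in> sets path_borel" for E
  proof -
    have "E \<subseteq> path_carrier" using sets.sets_into_space[OF that] by (simp add: space_path_borel)
    moreover have "(\<lambda>w. w) -` E \<inter> space (sigma path_carrier \<P>) \<in> sets (sigma path_carrier \<P>)"
      using id that by (rule measurable_sets)
    ultimately show ?thesis using sp by (simp add: Int_absorb2)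
  qed
  then show ?thesis using sub by auto
qed

text \<open>Increments are the coordinates in which box events of Brownian motion factorise. A
  regular grid lets all cells share one law, so that an induction on their number suffices;
  refinement and continuity recover the remaining times.\<close>

definition grid_increment :: "nat \<Rightarrow> (real \<Rightarrow> real) \<Rightarrow> nat \<Rightarrow> real" where
  "grid_increment m w i = (case i of 0 \<Rightarrow> w 0 | Suc j \<Rightarrow> w (real (Suc j) / 2 ^ m) - w (real j / 2 ^ m))"

definition grid_boxes :: "nat \<Rightarrow> (real \<Rightarrow> real) set set" where
  "grid_boxes m = {{w \<in> path_carrier. \<forall>i<n. grid_increment m w i \<in> A i} | n A. \<forall>i. A i \<in> sets borel}"

abbreviation grid_algebra :: "nat \<Rightarrow> (real \<Rightarrow> real) measure" where
  "grid_algebra m \<equiv> sigma path_carrier (grid_boxes m)"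

lemma grid_boxes_subset: "grid_boxes m \<subseteq> Pow path_carrier"
  by (auto simp: grid_boxes_def)

lemma sets_grid_algebra: "sets (grid_algebra m) = sigma_sets path_carrier (grid_boxes m)"
  using grid_boxes_subset by (rule sets_measure_of)

lemma space_grid_algebra: "space (grid_algebra m) = path_carrier"
  using grid_boxes_subset by (rule space_measure_of)

lemma grid_increment_sum: "(\<Sum>i\<le>k. grid_increment m w i) = w (real k / 2 ^ m)"
  by (induction k) (auto simp: grid_increment_def)

lemma measurable_grid_eval: "(\<lambda>w. w (real k / 2 ^ m)) \<in> borel_measurable (grid_algebra m)"
proof -
  have "(\<lambda>w. grid_increment m w i) \<in> borel_measurable (grid_algebra m)" for i
  proof (rule measurableI)
    fix A :: "real set" assume A: "A \<in> sets borel"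
    have "(\<lambda>w. grid_increment m w i) -` A \<inter> space (grid_algebra m)
        = {w \<in> path_carrier. \<forall>j<Suc i. grid_increment m w j \<in> (if j = i then A else UNIV)}"
      by (auto simp: space_grid_algebra)
    also have "\<dots> \<in> grid_boxes m" unfolding grid_boxes_def using A
      by (intro CollectI exI[of _ "Suc i"] exI[of _ "\<lambda>j. if j = i then A else UNIV"]) auto
    finally show "(\<lambda>w. grid_increment m w i) -` A \<inter> space (grid_algebra m) \<in> sets (grid_algebra m)"
      unfolding sets_grid_algebra by (rule sigma_sets.Basic)
  qed simp
  then have "(\<lambda>w. \<Sum>i\<le>k. grid_increment m w i) \<in> borel_measurable (grid_algebra m)" by (rule borel_measurable_sum)
  then show ?thesis by (simp add: grid_increment_sum)
qed

lemma grid_boxes_in_sets: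
  assumes sp: "space N = path_carrier" and ev: "\<And>k::nat. (\<lambda>w. w (real k / 2 ^ m)) \<in> borel_measurable N"
  shows "grid_boxes m \<subseteq> sets N"
proof
  fix E assume "E \<in> grid_boxes m"
  then obtain n A where E: "E = {w \<in> space N. \<forall>i<n. grid_increment m w i \<in> A i}" and A: "\<And>i. A i \<in> sets borel"
    unfolding grid_boxes_def sp by blast
  have [measurable]: "(\<lambda>w. grid_increment m w i) \<in> borel_measurable N" for i
    using ev[of 0] by (cases i) (auto simp: grid_increment_def intro!: borel_measurable_diff ev simp del: of_nat_Suc)
  note A[measurable]
  show "E \<in> sets N" unfolding E by measurable
qed

text \<open>A coarse grid point is a point of every finer dyadic grid. Monotonicity is what makes
  the union of these algebras closed under intersection.\<close>

lemma grid_algebra_mono: "m \<le> m' \<Longrightarrow> sets (grid_algebra m) \<subseteq> sets (grid_algebra m')"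
proof -
  assume "m \<le> m'"
  then obtain d where d: "m' = m + d" using le_Suc_ex by blast
  have "grid_boxes m \<subseteq> sets (grid_algebra m')"
  proof (rule grid_boxes_in_sets[OF space_grid_algebra])
    fix k
    have "real k / 2 ^ m = real (k * 2 ^ d) / 2 ^ m'" by (simp add: d power_add)
    then show "(\<lambda>w. w (real k / 2 ^ m)) \<in> borel_measurable (grid_algebra m')"
      using measurable_grid_eval by metis
  qed
  then have "sigma_sets (space (grid_algebra m')) (grid_boxes m) \<subseteq> sets (grid_algebra m')"
    by (rule sets.sigma_sets_subset)
  then show ?thesis by (simp add: sets_grid_algebra space_grid_algebra)
qed

lemma grid_algebra_subset: "sets (grid_algebra m) \<subseteq> sets path_borel"
proof -
  have "grid_boxes m \<subseteq> sets path_borel"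
    by (rule grid_boxes_in_sets[OF space_path_borel]) (rule measurable_path_eval, simp)
  then have "sigma_sets (space path_borel) (grid_boxes m) \<subseteq> sets path_borel"
    by (rule sets.sigma_sets_subset)
  then show ?thesis by (simp add: sets_grid_algebra space_path_borel)
qed

text \<open>The value of a continuous path at \<open>t\<close> is the limit of its values at the
  dyadic times below \<open>t\<close>.\<close>

lemma path_borel_grid_algebras: "sets path_borel \<subseteq> sigma_sets path_carrier (\<Union>m. sets (grid_algebra m))"
proof (rule sigma_algebra_path_evals)
  show sub: "(\<Union>m. sets (grid_algebra m)) \<subseteq> Pow path_carrier"
    using sets.sets_into_space by (fastforce simp: space_grid_algebra)
  fix t :: real assume t: "0 \<le> t"
  let ?N = "sigma path_carrier (\<Union>m. sets (grid_algebra m))"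
  have sp: "space ?N = path_carrier" using sub by (rule space_measure_of)
  have ev: "(\<lambda>w. w (real k / 2 ^ m)) \<in> borel_measurable ?N" for k m :: nat
  proof -
    have "sets (grid_algebra m) \<subseteq> sets ?N" using sub by (auto simp: sets_measure_of)
    then show ?thesis
      using measurable_grid_eval measurable_mono[of borel borel] sp space_grid_algebra
      by (metis borel_measurable_subalgebra)
  qed
  show "(\<lambda>w. w t) \<in> borel_measurable ?N"
  proof (rule borel_measurable_LIMSEQ_real)
    show "(\<lambda>w. w (real (nat \<lfloor>t * 2 ^ m\<rfloor>) / 2 ^ m)) \<in> borel_measurable ?N" for m by (rule ev)
    fix w assume "w \<in> space ?N"
    then have c: "continuous_on {0..} w" using path_carrier_continuous_on[of w "{0..}"] by (simp add: sp)
    have "(\<lambda>m. real (nat \<lfloor>t * 2 ^ m\<rfloor>) / 2 ^ m) \<longlonglongrightarrow> t"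
    proof (rule tendsto_sandwich)
      show "(\<lambda>n. t - (1/2)^n) \<longlonglongrightarrow> t" by (auto intro!: tendsto_eq_intros LIMSEQ_power_zero)
      show "(\<lambda>n. t) \<longlonglongrightarrow> t" by simp
      have "t - (1/2)^n \<le> real (nat \<lfloor>t * 2 ^ n\<rfloor>) / 2 ^ n" "real (nat \<lfloor>t * 2 ^ n\<rfloor>) / 2 ^ n \<le> t" for n :: nat
      proof -
        have r: "real (nat \<lfloor>t * 2 ^ n\<rfloor>) = real_of_int \<lfloor>t * 2 ^ n\<rfloor>" using t by simp
        have "(t * 2^n - 1) / 2^n \<le> real_of_int \<lfloor>t * 2 ^ n\<rfloor> / 2 ^ n" by (intro divide_right_mono) auto
        then show "t - (1/2)^n \<le> real (nat \<lfloor>t * 2 ^ n\<rfloor>) / 2 ^ n"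
          unfolding r by (simp add: diff_divide_distrib power_divide)
        show "real (nat \<lfloor>t * 2 ^ n\<rfloor>) / 2 ^ n \<le> t" unfolding r by (simp add: divide_le_eq)
      qed
      then show "\<forall>\<^sub>F n in sequentially. t - (1/2)^n \<le> real (nat \<lfloor>t * 2 ^ n\<rfloor>) / 2 ^ n"
        "\<forall>\<^sub>F n in sequentially. real (nat \<lfloor>t * 2 ^ n\<rfloor>) / 2 ^ n \<le> t" by auto
    qed
    then show "(\<lambda>m. w (real (nat \<lfloor>t * 2 ^ m\<rfloor>) / 2 ^ m)) \<longlonglongrightarrow> w t"
      by (rule continuous_on_tendsto_compose[OF c]) (use t in auto)
  qed
qed

lemma Int_stable_grid_boxes: "Int_stable (grid_boxes m)"
proof (rule Int_stableI)
  fix E E' assume "E \<in> grid_boxes m" "E' \<in> grid_boxes m"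
  then obtain n A n' A' where E: "E = {w \<in> path_carrier. \<forall>i<n. grid_increment m w i \<in> A i}"
    and E': "E' = {w \<in> path_carrier. \<forall>i<n'. grid_increment m w i \<in> A' i}"
    and A: "\<And>i. A i \<in> sets borel" "\<And>i. A' i \<in> sets borel"
    unfolding grid_boxes_def by blast
  define A'' where "A'' i = (if i < n then A i else UNIV) \<inter> (if i < n' then A' i else UNIV)" for i
  have "E \<inter> E' = {w \<in> path_carrier. \<forall>i<max n n'. grid_increment m w i \<in> A'' i}"
    unfolding E E' A''_def by (auto simp: less_max_iff_disj)
  moreover have "A'' i \<in> sets borel" for i using A by (auto simp: A''_def)
  ultimately show "E \<inter> E' \<in> grid_boxes m" unfolding grid_boxes_def by blast
qed

abbreviation gauss :: "real \<Rightarrow> real measure" where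
  "gauss v \<equiv> density lborel (normal_density 0 (sqrt v))"

section \<open>The Markov property at fixed times\<close>

text \<open>Continuity and the start at 0 are required at every point, so that the equation can be
  solved pathwise everywhere; \<open>brownian_modification\<close> provides such a version of
  \<open>B\<close>. \<open>increment\<close> states independence from the past and the Gaussian law
  in one formula on sets, the form used in the induction below.\<close>

locale brownian = prob_space M for M :: "'a measure" +
  fixes F :: "ennreal \<Rightarrow> 'a measure" and W :: "real \<Rightarrow> 'a \<Rightarrow> real"
  assumes filt: "filtration (space M) F" and subalg: "\<And>t. subalgebra M (F t)"
    and adapted: "\<And>t. 0 \<le> t \<Longrightarrow> W t \<in> borel_measurable (F (ennreal t))"
    and continuous: "\<And>\<omega>. continuous_on {0..} (\<lambda>t. W t \<omega>)"
    and start: "\<And>\<omega>. W 0 \<omega> = 0"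
    and increment: "\<And>s t G A. 0 \<le> s \<Longrightarrow> s < t \<Longrightarrow> G \<in> sets (F (ennreal s)) \<Longrightarrow> A \<in> sets borel \<Longrightarrow>
      prob (G \<inter> {\<omega> \<in> space M. W t \<omega> - W s \<omega> \<in> A}) = prob G * measure (gauss (t - s)) A"
begin

sublocale filtration "space M" F by (rule filt)

lemma F_sub: "sets (F t) \<subseteq> events"
  using subalg[of t] by (auto simp: subalgebra_def)

lemma F_measurable: "f \<in> borel_measurable (F t) \<Longrightarrow> f \<in> borel_measurable M"
  using measurable_from_subalg[OF subalg] .

lemma F_measurable_mono: "s \<le> t \<Longrightarrow> f \<in> borel_measurable (F s) \<Longrightarrow> f \<in> borel_measurable (F t)"
  by (rule borel_measurable_subalgebra[OF sets_F_mono]) (simp_all add: space_F)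

definition increment_path :: "real \<Rightarrow> 'a \<Rightarrow> real \<Rightarrow> real" where
  "increment_path s \<omega> = (\<lambda>t\<in>{0..}. W (s + t) \<omega> - W s \<omega>)"

lemma increment_path_carrier: "0 \<le> s \<Longrightarrow> increment_path s \<omega> \<in> path_carrier"
proof -
  assume s: "0 \<le> s"
  have "continuous_on {0..} (\<lambda>t. W (s + t) \<omega> - W s \<omega>)"
    using s by (auto intro!: continuous_intros continuous_on_compose2[OF continuous[of \<omega>]])
  moreover have "continuous_on {0..} (increment_path s \<omega>) \<longleftrightarrow> continuous_on {0..} (\<lambda>t. W (s + t) \<omega> - W s \<omega>)"
    by (intro continuous_on_cong) (auto simp: increment_path_def)
  ultimately show ?thesis by (auto simp: path_carrier_def increment_path_def)
qed

lemma measurable_W_at: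
  assumes "T \<in> borel_measurable M" "\<And>\<omega>. \<omega> \<in> space M \<Longrightarrow> 0 \<le> T \<omega>"
  shows "(\<lambda>\<omega>. W (T \<omega>) \<omega>) \<in> borel_measurable M"
proof (rule measurable_process_at[where S="{0..}" and Z=W])
  show "W s \<in> borel_measurable M" if "s \<in> {0..}" for s
    by (rule F_measurable[OF adapted]) (use that in simp)
qed (use assms continuous in auto)

lemma measurable_increment_path:
  assumes [measurable]: "T \<in> borel_measurable M" and T: "\<And>\<omega>. \<omega> \<in> space M \<Longrightarrow> 0 \<le> T \<omega>"
  shows "(\<lambda>\<omega>. increment_path (T \<omega>) \<omega>) \<in> measurable M path_borel"
proof (rule measurable_path_borel)
  fix t :: real assume t: "0 \<le> t"
  have "(\<lambda>\<omega>. W (T \<omega> + t) \<omega>) \<in> borel_measurable M" "(\<lambda>\<omega>. W (T \<omega>) \<omega>) \<in> borel_measurable M"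
    using T t by (auto intro!: measurable_W_at)
  then show "(\<lambda>\<omega>. increment_path (T \<omega>) \<omega> t) \<in> borel_measurable M"
    using t by (simp add: increment_path_def)
qed (use T increment_path_carrier in auto)

lemma measurable_increment_path_const [measurable]: "0 \<le> s \<Longrightarrow> increment_path s \<in> measurable M path_borel"
  using measurable_increment_path[of "\<lambda>_. s"] by simp

text \<open>The last increment is independent of all that happens before its cell starts, including
  \<open>G\<close> and the earlier increments, so each cell contributes a Gaussian factor. The
  constant is quantified before \<open>s\<close> and \<open>G\<close> so that different starting
  times can be compared.\<close>

lemma markov_grid_boxes:
  "\<forall>i. A i \<in> sets borel \<Longrightarrow> \<exists>c. \<forall>s\<ge>0. \<forall>G\<in>sets (F (ennreal s)).
     prob (G \<inter> {\<omega> \<in> space M. \<forall>i<n. grid_increment m (increment_path s \<omega>) i \<in> A i}) = prob G * c"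
proof (induction n)
  case 0
  have "G \<inter> space M = G" if "G \<in> sets (F t)" for G t
    using sets.sets_into_space[OF that] by (auto simp: space_F)
  then show ?case by (intro exI[of _ 1]) auto
next
  case (Suc n)
  then obtain c where c: "\<And>s G. 0 \<le> s \<Longrightarrow> G \<in> sets (F (ennreal s)) \<Longrightarrow>
     prob (G \<inter> {\<omega> \<in> space M. \<forall>i<n. grid_increment m (increment_path s \<omega>) i \<in> A i}) = prob G * c" by blast
  show ?case
  proof (cases n)
    case 0
    \<comment> \<open>Entry 0 is the starting value of an increment path, which is always 0, so this
      condition is deterministic.\<close>
    have "{\<omega> \<in> space M. \<forall>i<Suc n. grid_increment m (increment_path s \<omega>) i \<in> A i} = (if 0 \<in> A 0 then space M else {})" for s
      by (auto simp: 0 grid_increment_def increment_path_def)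
    moreover have "G \<inter> space M = G" if "G \<in> sets (F t)" for G t
      using sets.sets_into_space[OF that] by (auto simp: space_F)
    ultimately show ?thesis by (intro exI[of _ "if 0 \<in> A 0 then 1 else 0"]) auto
  next
    case (Suc j)
    show ?thesis
    proof (intro exI[of _ "c * measure (gauss (1 / 2 ^ m)) (A n)"] allI impI ballI)
      fix s :: real and G assume s: "0 \<le> s" and G: "G \<in> sets (F (ennreal s))"
      define H where "H = G \<inter> {\<omega> \<in> space M. \<forall>i<n. grid_increment m (increment_path s \<omega>) i \<in> A i}"
      \<comment> \<open>\<open>r\<close> is the left end of the last cell; \<open>H\<close> is
        decided by time \<open>r\<close>.\<close>
      define r where "r = s + real j / 2 ^ m"
      have gi: "(\<lambda>\<omega>. grid_increment m (increment_path s \<omega>) i) \<in> borel_measurable (F (ennreal r))" if "i < n" for i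
      proof -
        have ip: "(\<lambda>\<omega>. increment_path s \<omega> (real k / 2 ^ m)) \<in> borel_measurable (F (ennreal r))" if "k \<le> j" for k
        proof -
          have "W (s + real k / 2 ^ m) \<in> borel_measurable (F (ennreal r))"
          proof (rule F_measurable_mono[OF _ adapted])
            have "real k / 2 ^ m \<le> real j / 2 ^ m" using that by (intro divide_right_mono) auto
            then show "ennreal (s + real k / 2 ^ m) \<le> ennreal r" by (intro ennreal_leI) (simp add: r_def)
          qed (use s in auto)
          moreover have "W s \<in> borel_measurable (F (ennreal r))"
            by (rule F_measurable_mono[OF _ adapted[OF s]]) (intro ennreal_leI, simp add: r_def)
          ultimately show ?thesis by (simp add: increment_path_def)
        qed
        show ?thesis
          using that Suc ip[of 0]
          by (cases i) (auto simp: grid_increment_def intro!: borel_measurable_diff ip simp del: of_nat_Suc)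
      qed
      have "ennreal s \<le> ennreal r" by (intro ennreal_leI) (simp add: r_def)
      then have "G \<in> sets (F (ennreal r))" using G sets_F_mono by blast
      moreover have "{\<omega> \<in> space M. \<forall>i<n. grid_increment m (increment_path s \<omega>) i \<in> A i} \<in> sets (F (ennreal r))"
      proof -
        have "Measurable.pred (F (ennreal r)) (\<lambda>\<omega>. \<forall>i\<in>{..<n}. grid_increment m (increment_path s \<omega>) i \<in> A i)"
          by (intro pred_intros_finite pred_sets2[OF _ gi]) (use Suc.prems in auto)
        from predE[OF this] show ?thesis by (simp only: space_F Ball_def lessThan_iff)
      qed
      ultimately have H: "H \<in> sets (F (ennreal r))" unfolding H_def by (rule sets.Int)
      have "G \<inter> {\<omega> \<in> space M. \<forall>i<Suc n. grid_increment m (increment_path s \<omega>) i \<in> A i}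
          = H \<inter> {\<omega> \<in> space M. W (r + 1 / 2 ^ m) \<omega> - W r \<omega> \<in> A n}"
      proof -
        have "grid_increment m (increment_path s \<omega>) n = W (r + 1 / 2 ^ m) \<omega> - W r \<omega>" for \<omega>
          by (simp add: Suc grid_increment_def increment_path_def r_def add_divide_distrib ac_simps)
        then have "(\<forall>i<Suc n. grid_increment m (increment_path s \<omega>) i \<in> A i) \<longleftrightarrow>
           (\<forall>i<n. grid_increment m (increment_path s \<omega>) i \<in> A i) \<and> W (r + 1 / 2 ^ m) \<omega> - W r \<omega> \<in> A n" for \<omega>
          by (metis less_Suc_eq)
        then show ?thesis unfolding H_def by blast
      qed
      then have "prob (G \<inter> {\<omega> \<in> space M. \<forall>i<Suc n. grid_increment m (increment_path s \<omega>) i \<in> A i})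
          = prob H * measure (gauss (1 / 2 ^ m)) (A n)"
        using increment[OF _ _ H, of "r + 1 / 2 ^ m" "A n"] Suc.prems s by (simp add: r_def)
      also have "prob H = prob G * c" unfolding H_def by (rule c[OF s G])
      finally show "prob (G \<inter> {\<omega> \<in> space M. \<forall>i<Suc n. grid_increment m (increment_path s \<omega>) i \<in> A i})
        = prob G * (c * measure (gauss (1 / 2 ^ m)) (A n))" by simp
    qed
  qed
qed

text \<open>Dynkin's lemma is applied twice: from boxes to the algebra of one grid, then from the
  increasing union of these algebras to all Borel sets.\<close>

lemma markov:
  assumes s: "0 \<le> s" and G: "G \<in> sets (F (ennreal s))" and E: "E \<in> sets path_borel"
  shows "prob (G \<inter> {\<omega> \<in> space M. increment_path s \<omega> \<in> E}) = prob G * prob {\<omega> \<in> space M. increment_path 0 \<omega> \<in> E}"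
proof -
  have Ge: "G \<in> events" using G F_sub by blast
  have box: "prob (G \<inter> {\<omega> \<in> space M. increment_path s \<omega> \<in> E}) = prob G * prob {\<omega> \<in> space M. increment_path 0 \<omega> \<in> E}"
    if E_box: "E \<in> grid_boxes m" for E m
  proof -
    obtain n A where E: "E = {w \<in> path_carrier. \<forall>i<n. grid_increment m w i \<in> A i}" and A: "\<forall>i. A i \<in> sets borel"
      using E_box unfolding grid_boxes_def by blast
    obtain c where c: "\<And>s G. 0 \<le> s \<Longrightarrow> G \<in> sets (F (ennreal s)) \<Longrightarrow>
     prob (G \<inter> {\<omega> \<in> space M. \<forall>i<n. grid_increment m (increment_path s \<omega>) i \<in> A i}) = prob G * c"
      using markov_grid_boxes[OF A, of n m] by blast
    \<comment> \<open>Time 0 and the whole space identify the constant \<open>c\<close>.\<close>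
    have "space M \<in> sets (F (ennreal 0))" using sets.top[of "F (ennreal 0)"] by (simp add: space_F)
    from c[OF _ this] have "c = prob {\<omega> \<in> space M. \<forall>i<n. grid_increment m (increment_path 0 \<omega>) i \<in> A i}"
      by (simp add: prob_space Int_def)
    then show ?thesis using c[OF s G] increment_path_carrier[OF s] increment_path_carrier[of 0] by (simp add: E)
  qed
  have meas: "increment_path s \<in> measurable M path_borel" "increment_path 0 \<in> measurable M path_borel"
    using s by auto
  have alg: "prob (G \<inter> {\<omega> \<in> space M. increment_path s \<omega> \<in> E}) = prob G * prob {\<omega> \<in> space M. increment_path 0 \<omega> \<in> E}"
    if "E \<in> sets (grid_algebra m)" for E m
  proof (rule indep_law_extend[OF Ge meas _ Int_stable_grid_boxes box])
    show "grid_boxes m \<subseteq> sets path_borel" using grid_algebra_subset[of m] by (auto simp: sets_grid_algebra)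
    show "E \<in> sigma_sets (space path_borel) (grid_boxes m)" using that by (simp add: sets_grid_algebra space_path_borel)
  qed
  show ?thesis
  proof (rule indep_law_extend[OF Ge meas, of "\<Union>m. sets (grid_algebra m)"])
    show "(\<Union>m. sets (grid_algebra m)) \<subseteq> sets path_borel" using grid_algebra_subset by auto
    show "Int_stable (\<Union>m. sets (grid_algebra m))"
    proof (rule Int_stableI)
      fix A B assume "A \<in> (\<Union>m. sets (grid_algebra m))" "B \<in> (\<Union>m. sets (grid_algebra m))"
      then obtain m m' where "A \<in> sets (grid_algebra m)" "B \<in> sets (grid_algebra m')" by blast
      then have "A \<in> sets (grid_algebra (max m m'))" "B \<in> sets (grid_algebra (max m m'))"
        using grid_algebra_mono[of m "max m m'"] grid_algebra_mono[of m' "max m m'"] by auto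
      then show "A \<inter> B \<in> (\<Union>m. sets (grid_algebra m))" by blast
    qed
    show "E \<in> sigma_sets (space path_borel) (\<Union>m. sets (grid_algebra m))"
      using path_borel_grid_algebras E by (auto simp: space_path_borel)
  qed (use alg in blast)
qed

end

section \<open>Half-space boxes and the strong Markov property\<close>

text \<open>A second generator of the Borel sets. The limit from discrete to general stopping times
  needs events that continuous functionals can approximate, which boxes with arbitrary Borel sides
  do not provide; these boxes are zero sets of the continuous functional
  \<open>path_excess\<close>.\<close>

definition path_halfspaces :: "(real \<Rightarrow> real) set set" where
  "path_halfspaces = {{w \<in> path_carrier. \<forall>(t, a)\<in>set L. w t \<le> a} | L. \<forall>(t, a)\<in>set L. 0 \<le> t}"

definition path_excess :: "(real \<times> real) list \<Rightarrow> (real \<Rightarrow> real) \<Rightarrow> real" where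
  "path_excess L w = (\<Sum>(t, a)\<leftarrow>L. max 0 (w t - a))"

lemma path_excess_simps [simp]:
  "path_excess [] w = 0" "path_excess ((t, a) # L) w = max 0 (w t - a) + path_excess L w"
  by (simp_all add: path_excess_def)

lemma path_excess_nonneg: "0 \<le> path_excess L w"
  by (induction L) auto

lemma path_excess_eq_0_iff: "path_excess L w = 0 \<longleftrightarrow> (\<forall>(t, a)\<in>set L. w t \<le> a)"
proof (induction L)
  case (Cons p L)
  obtain t a where [simp]: "p = (t, a)" by (cases p)
  have "path_excess (p # L) w = 0 \<longleftrightarrow> max 0 (w t - a) = 0 \<and> path_excess L w = 0"
    using path_excess_nonneg[of L w] by (simp add: add_nonneg_eq_0_iff)
  then show ?case using Cons by (auto simp: max_def)
qed simp

lemma tendsto_path_excess: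
  assumes "\<forall>(t, a)\<in>set L. (\<lambda>n. f n t) \<longlonglongrightarrow> w t"
  shows "(\<lambda>n. path_excess L (f n)) \<longlonglongrightarrow> path_excess L w"
  using assms
proof (induction L)
  case (Cons p L)
  then show ?case by (cases p) (auto intro!: tendsto_intros)
qed simp

lemma measurable_path_excess:
  "\<forall>(t, a)\<in>set L. 0 \<le> t \<Longrightarrow> path_excess L \<in> borel_measurable path_borel"
proof (induction L)
  case (Cons p L)
  obtain t a where p: "p = (t, a)" by (cases p)
  have [measurable]: "(\<lambda>w. w t) \<in> borel_measurable path_borel" "path_excess L \<in> borel_measurable path_borel"
    using Cons p measurable_path_eval by auto
  have "path_excess (p # L) = (\<lambda>w. max 0 (w t - a) + path_excess L w)" by (auto simp: p)
  then show ?case by simp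
next
  case Nil
  have "path_excess [] = (\<lambda>w. 0)" by auto
  then show ?case by simp
qed

lemma path_halfspaces_sets: "path_halfspaces \<subseteq> sets path_borel"
proof
  fix E assume "E \<in> path_halfspaces"
  then obtain L where L: "\<forall>(t, a)\<in>set L. 0 \<le> t" and E: "E = {w \<in> space path_borel. path_excess L w = 0}"
    unfolding path_halfspaces_def space_path_borel path_excess_eq_0_iff by blast
  note [measurable] = measurable_path_excess[OF L]
  show "E \<in> sets path_borel" unfolding E by measurable
qed

lemma Int_stable_path_halfspaces: "Int_stable path_halfspaces"
proof (rule Int_stableI)
  fix E E' assume "E \<in> path_halfspaces" "E' \<in> path_halfspaces"
  then obtain L L' where "\<forall>(t, a)\<in>set L. 0 \<le> t" "\<forall>(t, a)\<in>set L'. 0 \<le> t"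
    "E = {w \<in> path_carrier. \<forall>(t, a)\<in>set L. w t \<le> a}" "E' = {w \<in> path_carrier. \<forall>(t, a)\<in>set L'. w t \<le> a}"
    unfolding path_halfspaces_def by blast
  then have "E \<inter> E' = {w \<in> path_carrier. \<forall>(t, a)\<in>set (L @ L'). w t \<le> a} \<and> (\<forall>(t, a)\<in>set (L @ L'). 0 \<le> t)" by auto
  then show "E \<inter> E' \<in> path_halfspaces" unfolding path_halfspaces_def by blast
qed

lemma path_borel_halfspaces: "sets path_borel \<subseteq> sigma_sets path_carrier path_halfspaces"
proof (rule sigma_algebra_path_evals)
  show sub: "path_halfspaces \<subseteq> Pow path_carrier" by (auto simp: path_halfspaces_def)
  fix t :: real assume t: "0 \<le> t"
  show "(\<lambda>w. w t) \<in> borel_measurable (sigma path_carrier path_halfspaces)"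
  proof (rule borel_measurableI_le)
    fix a
    have "{w \<in> path_carrier. w t \<le> a} = {w \<in> path_carrier. \<forall>(t, a)\<in>set [(t, a)]. w t \<le> a}" by simp
    also have "\<dots> \<in> path_halfspaces" unfolding path_halfspaces_def using t by (intro CollectI exI[of _ "[(t, a)]"]) simp
    finally show "{w \<in> space (sigma path_carrier path_halfspaces). w t \<le> a} \<in> sets (sigma path_carrier path_halfspaces)"
      using sub by (simp add: space_measure_of sets_measure_of sigma_sets.Basic)
  qed
qed

text \<open>The functionals \<open>exp (- k * path_excess L)\<close> are continuous in the path, so they pass to the
  limit along dyadic stopping times, and they decrease to the indicator of a half-space box.\<close>

lemma exp_neg_mult_LIMSEQ:
  assumes "0 \<le> (c::real)"
  shows "(\<lambda>k. exp (- (real k * c))) \<longlonglongrightarrow> (if c = 0 then 1 else 0)"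
proof (cases "c = 0")
  case False
  then have c: "0 < c" using assms by simp
  have "(\<lambda>k. exp (- c) ^ k) \<longlonglongrightarrow> 0" using c by (intro LIMSEQ_power_zero) simp
  then show ?thesis using False by (simp add: exp_of_nat_mult[symmetric])
qed simp

context brownian
begin

text \<open>The event \<open>G\<close> is split by the value of \<open>K\<close>. On each piece the
  time is fixed and the piece belongs to its past, so \<open>markov\<close> applies, and the
  resulting probabilities add up.\<close>

lemma markov_countable:
  assumes d: "0 \<le> d" and G: "G \<in> events"
    and K: "\<And>k. G \<inter> {\<omega> \<in> space M. K \<omega> = k} \<in> sets (F (ennreal (real k * d)))"
    and E: "E \<in> sets path_borel"
  shows "prob (G \<inter> {\<omega> \<in> space M. increment_path (real (K \<omega>) * d) \<omega> \<in> E})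
    = prob G * prob {\<omega> \<in> space M. increment_path 0 \<omega> \<in> E}"
proof -
  define H where "H k = G \<inter> {\<omega> \<in> space M. K \<omega> = k}" for k :: nat
  have H: "H k \<in> sets (F (ennreal (real k * d)))" for k using K by (simp add: H_def)
  then have He: "H k \<in> events" for k using F_sub by blast
  have mE: "{\<omega> \<in> space M. increment_path (real k * d) \<omega> \<in> E} \<in> events" for k :: nat
    using measurable_sets[OF measurable_increment_path_const E, of "real k * d"] d
    by (simp add: vimage_def Int_def conj_commute)
  have "(\<lambda>k. prob (H k \<inter> {\<omega> \<in> space M. increment_path (real k * d) \<omega> \<in> E}))
      sums prob (\<Union>k. H k \<inter> {\<omega> \<in> space M. increment_path (real k * d) \<omega> \<in> E})"
    using He mE by (intro finite_measure_UNION) (auto simp: disjoint_family_on_def H_def)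
  moreover have "prob (H k \<inter> {\<omega> \<in> space M. increment_path (real k * d) \<omega> \<in> E})
      = prob (H k) * prob {\<omega> \<in> space M. increment_path 0 \<omega> \<in> E}" for k
    using d by (intro markov H E) auto
  moreover have "(\<lambda>k. prob (H k)) sums prob (\<Union>k. H k)"
    using He by (intro finite_measure_UNION) (auto simp: disjoint_family_on_def H_def)
  then have "(\<lambda>k. prob (H k) * prob {\<omega> \<in> space M. increment_path 0 \<omega> \<in> E})
      sums (prob (\<Union>k. H k) * prob {\<omega> \<in> space M. increment_path 0 \<omega> \<in> E})" by (rule sums_mult2)
  ultimately have "prob (\<Union>k. H k \<inter> {\<omega> \<in> space M. increment_path (real k * d) \<omega> \<in> E})
      = prob (\<Union>k. H k) * prob {\<omega> \<in> space M. increment_path 0 \<omega> \<in> E}"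
    using sums_unique2 by simp
  moreover have "(\<Union>k. H k \<inter> {\<omega> \<in> space M. increment_path (real k * d) \<omega> \<in> E})
      = G \<inter> {\<omega> \<in> space M. increment_path (real (K \<omega>) * d) \<omega> \<in> E}" by (auto simp: H_def)
  moreover have "(\<Union>k. H k) = G" using sets.sets_into_space[OF G] by (auto simp: H_def)
  ultimately show ?thesis by simp
qed

lemma pre_sigma_events:
  assumes "stopping_time F \<tau>" shows "sets (pre_sigma \<tau>) \<subseteq> events"
proof
  fix G assume "G \<in> sets (pre_sigma \<tau>)"
  from sets_pre_sigmaD[OF assms this, of top] show "G \<in> events" using F_sub[of top] by auto
qed

lemma stopping_time_measurable:
  assumes "stopping_time F \<tau>" shows "\<tau> \<in> borel_measurable M"
  using measurable_stopping_time[OF assms, of M] F_sub space_F by auto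

text \<open>Here the time is rounded up: whether the rounded time equals a grid point is then
  decided by that point, so \<open>markov_countable\<close> applies. For half-space boxes two limits
  follow, first in the mesh and then in the sharpness \<open>k\<close> of the functional.\<close>

theorem strong_markov:
  assumes \<tau>: "stopping_time F \<tau>" and G: "G \<in> sets (pre_sigma \<tau>)" and fin: "\<And>\<omega>. \<omega> \<in> G \<Longrightarrow> \<tau> \<omega> < \<infinity>"
    and E: "E \<in> sets path_borel"
  shows "prob (G \<inter> {\<omega> \<in> space M. increment_path (enn2real (\<tau> \<omega>)) \<omega> \<in> E})
    = prob G * prob {\<omega> \<in> space M. increment_path 0 \<omega> \<in> E}"
proof -
  define T where "T \<omega> = enn2real (\<tau> \<omega>)" for \<omega>
  have Ge: "G \<in> events" using G pre_sigma_events[OF \<tau>] by blast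
  note [measurable] = Ge stopping_time_measurable[OF \<tau>]
  have T[measurable]: "T \<in> borel_measurable M" unfolding T_def by measurable
  have T0: "0 \<le> T \<omega>" for \<omega> by (simp add: T_def)
  define K where "K m \<omega> = nat \<lceil>T \<omega> * 2 ^ m\<rceil>" for m :: nat and \<omega>
  define Tm where "Tm m \<omega> = real (K m \<omega>) * (1 / 2 ^ m)" for m \<omega>
  have Tm_meas[measurable]: "Tm m \<in> borel_measurable M" for m
    unfolding Tm_def K_def by measurable
  have Tm0: "0 \<le> Tm m \<omega>" for m \<omega> by (simp add: Tm_def)
  have Tm_lim: "(\<lambda>m. Tm m \<omega>) \<longlonglongrightarrow> T \<omega>" for \<omega>
  proof (rule tendsto_sandwich)
    show "(\<lambda>n. T \<omega>) \<longlonglongrightarrow> T \<omega>" by simp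
    show "(\<lambda>n. T \<omega> + (1/2)^n) \<longlonglongrightarrow> T \<omega>" by (auto intro!: tendsto_eq_intros LIMSEQ_power_zero)
    have "T \<omega> \<le> Tm m \<omega>" "Tm m \<omega> \<le> T \<omega> + (1/2)^m" for m
    proof -
      have "real (K m \<omega>) = of_int \<lceil>T \<omega> * 2 ^ m\<rceil>" using T0[of \<omega>] by (simp add: K_def)
      then have "T \<omega> * 2 ^ m \<le> real (K m \<omega>)" "real (K m \<omega>) \<le> T \<omega> * 2 ^ m + 1" by linarith+
      then have "T \<omega> * 2 ^ m / 2 ^ m \<le> real (K m \<omega>) / 2 ^ m" "real (K m \<omega>) / 2 ^ m \<le> (T \<omega> * 2 ^ m + 1) / 2 ^ m"
        by (intro divide_right_mono; simp)+
      then show "T \<omega> \<le> Tm m \<omega>" "Tm m \<omega> \<le> T \<omega> + (1/2)^m"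
        by (simp_all add: Tm_def add_divide_distrib power_divide)
    qed
    then show "\<forall>\<^sub>F n in sequentially. T \<omega> \<le> Tm n \<omega>" "\<forall>\<^sub>F n in sequentially. Tm n \<omega> \<le> T \<omega> + (1/2)^n" by auto
  qed
  have K: "G \<inter> {\<omega> \<in> space M. K m \<omega> = k} \<in> sets (F (ennreal (real k * (1 / 2 ^ m))))" for m k
  proof -
    \<comment> \<open>The rounded index is at most \<open>j\<close> exactly when \<tau> is at most
      the \<open>j\<close>-th grid point, so the event of index \<open>k\<close> is a difference of
      two events known at the \<open>k\<close>-th grid point.\<close>
    have le_iff: "K m \<omega> \<le> j \<longleftrightarrow> \<tau> \<omega> \<le> ennreal (real j * (1 / 2 ^ m))" if "\<omega> \<in> G" for \<omega> j
    proof -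
      have "\<tau> \<omega> = ennreal (T \<omega>)" using fin[OF that] by (simp add: T_def)
      moreover have "K m \<omega> \<le> j \<longleftrightarrow> T \<omega> * 2 ^ m \<le> real j" by (simp add: K_def nat_le_iff ceiling_le_iff)
      ultimately show ?thesis by (simp add: ennreal_le_iff field_simps)
    qed
    have le: "{\<omega> \<in> G. \<tau> \<omega> \<le> ennreal (real j * (1 / 2 ^ m))} \<in> sets (F (ennreal (real k * (1 / 2 ^ m))))" if "j \<le> k" for j
    proof -
      have "real j * (1 / 2 ^ m) \<le> real k * (1 / 2 ^ m)" using that by (intro mult_right_mono) auto
      then have "sets (F (ennreal (real j * (1 / 2 ^ m)))) \<subseteq> sets (F (ennreal (real k * (1 / 2 ^ m))))"
        by (intro sets_F_mono ennreal_leI)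
      then show ?thesis using sets_pre_sigmaD[OF \<tau> G] by blast
    qed
    have sp: "G \<subseteq> space M" using Ge by (rule sets.sets_into_space)
    show ?thesis
    proof (cases k)
      case 0
      then have "G \<inter> {\<omega> \<in> space M. K m \<omega> = k} = {\<omega> \<in> G. \<tau> \<omega> \<le> ennreal (real k * (1 / 2 ^ m))}"
        using le_iff[of _ 0] sp by auto
      then show ?thesis using le[of k] by simp
    next
      case (Suc j)
      have "K m \<omega> = k \<longleftrightarrow> K m \<omega> \<le> k \<and> \<not> K m \<omega> \<le> j" for \<omega> using Suc by auto
      then have "G \<inter> {\<omega> \<in> space M. K m \<omega> = k} = {\<omega> \<in> G. \<tau> \<omega> \<le> ennreal (real k * (1 / 2 ^ m))}
          - {\<omega> \<in> G. \<tau> \<omega> \<le> ennreal (real j * (1 / 2 ^ m))}"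
        using le_iff sp by blast
      then show ?thesis using le[of k] le[of j] Suc by auto
    qed
  qed
  have law: "prob (G \<inter> {\<omega> \<in> space M. increment_path (Tm m \<omega>) \<omega> \<in> E})
    = prob G * prob {\<omega> \<in> space M. increment_path 0 \<omega> \<in> E}" if "E \<in> sets path_borel" for m E
    unfolding Tm_def by (rule markov_countable[OF _ Ge K that]) simp
  have mX: "(\<lambda>\<omega>. increment_path (T \<omega>) \<omega>) \<in> measurable M path_borel"
    "(\<lambda>\<omega>. increment_path (Tm m \<omega>) \<omega>) \<in> measurable M path_borel" for m
    by (intro measurable_increment_path T0 Tm0; measurable)+
  have m0: "increment_path 0 \<in> measurable M path_borel" by simp
  have half: "prob (G \<inter> {\<omega> \<in> space M. increment_path (T \<omega>) \<omega> \<in> E})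
    = prob G * prob {\<omega> \<in> space M. increment_path 0 \<omega> \<in> E}" if E_half: "E \<in> path_halfspaces" for E
  proof -
    obtain L where L: "\<forall>(t, a)\<in>set L. 0 \<le> t" and E: "E = {w \<in> path_carrier. path_excess L w = 0}"
      using E_half unfolding path_halfspaces_def path_excess_eq_0_iff by blast
    define f where "f k w = exp (- (real k * path_excess L w))" for k :: nat and w
    note [measurable] = measurable_path_excess[OF L]
    have f_meas[measurable]: "f k \<in> borel_measurable path_borel" for k unfolding f_def by measurable
    have f_le: "ennreal (f k w) \<le> 1" for k w using path_excess_nonneg[of L w] by (simp add: f_def)
    have f_lim: "(\<lambda>k. ennreal (f k w)) \<longlonglongrightarrow> indicator E w" if "w \<in> path_carrier" for w
    proof -
      have "(\<lambda>k. f k w) \<longlonglongrightarrow> indicator E w"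
        using exp_neg_mult_LIMSEQ[OF path_excess_nonneg[of L w]] that
        unfolding f_def E indicator_def by (auto split: if_splits)
      then show ?thesis using tendsto_ennrealI[of _ "indicator E w"] by (simp add: ennreal_indicator)
    qed
    note [measurable] = mX m0
    \<comment> \<open>First limit, in the mesh with \<open>k\<close> fixed: continuity of the paths
      gives convergence of the functional, and 1 dominates.\<close>
    have *: "(\<integral>\<^sup>+\<omega>. indicator G \<omega> * ennreal (f k (increment_path (T \<omega>) \<omega>)) \<partial>M)
        = ennreal (prob G) * (\<integral>\<^sup>+\<omega>. ennreal (f k (increment_path 0 \<omega>)) \<partial>M)" for k
    proof -
      have "(\<lambda>m. \<integral>\<^sup>+\<omega>. indicator G \<omega> * ennreal (f k (increment_path (Tm m \<omega>) \<omega>)) \<partial>M)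
          \<longlonglongrightarrow> (\<integral>\<^sup>+\<omega>. indicator G \<omega> * ennreal (f k (increment_path (T \<omega>) \<omega>)) \<partial>M)"
      proof (rule nn_integral_dominated_convergence[where w="\<lambda>_. 1"])
        show "AE \<omega> in M. indicator G \<omega> * ennreal (f k (increment_path (Tm m \<omega>) \<omega>)) \<le> 1" for m
          using f_le by (auto simp: indicator_def)
        have "(\<lambda>m. increment_path (Tm m \<omega>) \<omega> t) \<longlonglongrightarrow> increment_path (T \<omega>) \<omega> t" if "0 \<le> t" for \<omega> t
        proof -
          have "(\<lambda>m. W (Tm m \<omega> + t) \<omega>) \<longlonglongrightarrow> W (T \<omega> + t) \<omega>" "(\<lambda>m. W (Tm m \<omega>) \<omega>) \<longlonglongrightarrow> W (T \<omega>) \<omega>"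
            using that T0[of \<omega>] Tm0[of _ \<omega>]
            by (auto intro!: continuous_on_tendsto_compose[OF continuous] tendsto_intros Tm_lim)
          then show ?thesis using that by (auto simp: increment_path_def intro: tendsto_diff)
        qed
        then have "(\<lambda>m. path_excess L (increment_path (Tm m \<omega>) \<omega>)) \<longlonglongrightarrow> path_excess L (increment_path (T \<omega>) \<omega>)" for \<omega>
          using L by (intro tendsto_path_excess) auto
        then have "(\<lambda>m. f k (increment_path (Tm m \<omega>) \<omega>)) \<longlonglongrightarrow> f k (increment_path (T \<omega>) \<omega>)" for \<omega>
          unfolding f_def by (intro tendsto_intros)
        then have "(\<lambda>m. ennreal (f k (increment_path (Tm m \<omega>) \<omega>))) \<longlonglongrightarrow> ennreal (f k (increment_path (T \<omega>) \<omega>))" for \<omega>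
          by (rule tendsto_ennrealI)
        then show "AE \<omega> in M. (\<lambda>m. indicator G \<omega> * ennreal (f k (increment_path (Tm m \<omega>) \<omega>)))
            \<longlonglongrightarrow> indicator G \<omega> * ennreal (f k (increment_path (T \<omega>) \<omega>))"
          by (auto simp: indicator_def)
      qed (auto simp: emeasure_space_1)
      moreover have "(\<integral>\<^sup>+\<omega>. indicator G \<omega> * ennreal (f k (increment_path (Tm m \<omega>) \<omega>)) \<partial>M)
          = ennreal (prob G) * (\<integral>\<^sup>+\<omega>. ennreal (f k (increment_path 0 \<omega>)) \<partial>M)" for m
        by (rule indep_law_nn_integral[OF Ge mX(2) m0 law]) auto
      ultimately show ?thesis using LIMSEQ_unique[OF _ tendsto_const] by simp
    qed
    have mE: "{\<omega> \<in> space M. increment_path (T \<omega>) \<omega> \<in> E} \<in> events" "{\<omega> \<in> space M. increment_path 0 \<omega> \<in> E} \<in> events"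
      using measurable_sets[OF mX(1), of E] measurable_sets[OF m0, of E] path_halfspaces_sets E_half
      by (auto simp: vimage_def Int_def conj_commute)
    \<comment> \<open>Second limit, in \<open>k\<close>: on both sides the functional becomes the
      indicator of \<open>E\<close>.\<close>
    have "(\<lambda>k. \<integral>\<^sup>+\<omega>. indicator G \<omega> * ennreal (f k (increment_path (T \<omega>) \<omega>)) \<partial>M)
        \<longlonglongrightarrow> (\<integral>\<^sup>+\<omega>. indicator (G \<inter> {\<omega> \<in> space M. increment_path (T \<omega>) \<omega> \<in> E}) \<omega> \<partial>M)"
    proof (rule nn_integral_dominated_convergence[where w="\<lambda>_. 1"])
      show "AE \<omega> in M. indicator G \<omega> * ennreal (f k (increment_path (T \<omega>) \<omega>)) \<le> 1" for k
        using f_le by (auto simp: indicator_def)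
      show "AE \<omega> in M. (\<lambda>k. indicator G \<omega> * ennreal (f k (increment_path (T \<omega>) \<omega>)))
          \<longlonglongrightarrow> indicator (G \<inter> {\<omega> \<in> space M. increment_path (T \<omega>) \<omega> \<in> E}) \<omega>"
      proof (rule AE_I2)
        fix \<omega> assume "\<omega> \<in> space M"
        then show "(\<lambda>k. indicator G \<omega> * ennreal (f k (increment_path (T \<omega>) \<omega>)))
          \<longlonglongrightarrow> indicator (G \<inter> {\<omega> \<in> space M. increment_path (T \<omega>) \<omega> \<in> E}) \<omega>"
          using f_lim[OF increment_path_carrier[OF T0], of \<omega> \<omega>]
          by (cases "\<omega> \<in> G"; cases "increment_path (T \<omega>) \<omega> \<in> E") simp_all
      qed
    qed (use mE in \<open>auto simp: emeasure_space_1\<close>)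
    moreover have "(\<lambda>k. \<integral>\<^sup>+\<omega>. ennreal (f k (increment_path 0 \<omega>)) \<partial>M)
        \<longlonglongrightarrow> (\<integral>\<^sup>+\<omega>. indicator {\<omega> \<in> space M. increment_path 0 \<omega> \<in> E} \<omega> \<partial>M)"
    proof (rule nn_integral_dominated_convergence[where w="\<lambda>_. 1"])
      show "AE \<omega> in M. ennreal (f k (increment_path 0 \<omega>)) \<le> 1" for k using f_le by auto
      show "AE \<omega> in M. (\<lambda>k. ennreal (f k (increment_path 0 \<omega>)))
          \<longlonglongrightarrow> indicator {\<omega> \<in> space M. increment_path 0 \<omega> \<in> E} \<omega>"
      proof (rule AE_I2)
        fix \<omega> assume "\<omega> \<in> space M"
        then show "(\<lambda>k. ennreal (f k (increment_path 0 \<omega>)))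
          \<longlonglongrightarrow> indicator {\<omega> \<in> space M. increment_path 0 \<omega> \<in> E} \<omega>"
          using f_lim[OF increment_path_carrier[OF order_refl], of \<omega>]
          by (cases "increment_path 0 \<omega> \<in> E") simp_all
      qed
    qed (use mE in \<open>auto simp: emeasure_space_1\<close>)
    then have "(\<lambda>k. ennreal (prob G) * (\<integral>\<^sup>+\<omega>. ennreal (f k (increment_path 0 \<omega>)) \<partial>M))
        \<longlonglongrightarrow> ennreal (prob G) * (\<integral>\<^sup>+\<omega>. indicator {\<omega> \<in> space M. increment_path 0 \<omega> \<in> E} \<omega> \<partial>M)"
      by (intro ennreal_tendsto_cmult) auto
    ultimately have "(\<integral>\<^sup>+\<omega>. indicator (G \<inter> {\<omega> \<in> space M. increment_path (T \<omega>) \<omega> \<in> E}) \<omega> \<partial>M)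
        = ennreal (prob G) * (\<integral>\<^sup>+\<omega>. indicator {\<omega> \<in> space M. increment_path 0 \<omega> \<in> E} \<omega> \<partial>M)"
      unfolding * by (rule LIMSEQ_unique)
    then have "ennreal (prob (G \<inter> {\<omega> \<in> space M. increment_path (T \<omega>) \<omega> \<in> E}))
        = ennreal (prob G * prob {\<omega> \<in> space M. increment_path 0 \<omega> \<in> E})"
      using mE by (simp add: emeasure_eq_measure ennreal_mult)
    then show ?thesis by simp
  qed
  show ?thesis unfolding T_def[symmetric]
  proof (rule indep_law_extend[OF Ge mX(1) m0 path_halfspaces_sets Int_stable_path_halfspaces half])
    show "E \<in> sigma_sets (space path_borel) path_halfspaces"
      using path_borel_halfspaces E by (auto simp: space_path_borel)
  qed
qed

end

section \<open>Positive recurrence\<close>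

lemma gauss_second_moment:
  assumes v: "0 < v"
  shows "(\<integral>\<^sup>+x. ennreal (x\<^sup>2) \<partial>gauss v) = ennreal v"
proof -
  have "has_bochner_integral lborel (\<lambda>x. normal_density 0 (sqrt v) x * x\<^sup>2) v"
    using normal_moment_even[of "sqrt v" 0 1] v by (simp add: fact_2 power2_eq_square)
  then have "(\<integral>\<^sup>+x. ennreal (normal_density 0 (sqrt v) x * x\<^sup>2) \<partial>lborel) = ennreal v"
    using nn_integral_eq_integral[of lborel "\<lambda>x. normal_density 0 (sqrt v) x * x\<^sup>2"]
    by (auto simp: has_bochner_integral_iff)
  then show ?thesis by (simp add: nn_integral_density ennreal_mult)
qed

lemma gauss_mean: "0 < v \<Longrightarrow> (\<integral>x. x \<partial>gauss v) = 0" "0 < v \<Longrightarrow> integrable (gauss v) (\<lambda>x. x)"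
  using normal_moment_nz_1[of "sqrt v" 0] by (simp_all add: integral_density integrable_density has_bochner_integral_iff)

lemma gauss_positive:
  assumes v: "0 < v" and A: "A \<in> sets borel" and pos: "emeasure lborel A \<noteq> 0"
  shows "0 < measure (gauss v) A"
proof -
  interpret G: prob_space "gauss v" using v by (intro prob_space_normal_density) simp
  have "emeasure (gauss v) A \<noteq> 0"
  proof
    assume "emeasure (gauss v) A = 0"
    then have "(\<integral>\<^sup>+x. ennreal (normal_density 0 (sqrt v) x) * indicator A x \<partial>lborel) = 0"
      using A by (simp add: emeasure_density)
    then have "AE x in lborel. ennreal (normal_density 0 (sqrt v) x) * indicator A x = 0"
      using A by (subst (asm) nn_integral_0_iff_AE) auto
    then have "AE x in lborel. x \<notin> A"
    proof eventually_elim
      fix x assume "ennreal (normal_density 0 (sqrt v) x) * indicator A x = 0"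
      then show "x \<notin> A" using normal_density_pos[of "sqrt v" 0 x] v by (auto simp: indicator_def)
    qed
    then have "emeasure lborel A = 0" using A by (subst (asm) AE_iff_measurable[of A]) auto
    then show False using pos by simp
  qed
  then show ?thesis
    by (simp add: G.emeasure_eq_measure zero_less_measure_iff)
qed

lemma emeasure_lborel_atLeast: "emeasure lborel {a::real..} \<noteq> 0" "emeasure lborel {..a::real} \<noteq> 0"
proof -
  have "emeasure lborel {a..a + 1} \<le> emeasure lborel {a..}" "emeasure lborel {a - 1..a} \<le> emeasure lborel {..a}"
    by (intro emeasure_mono; auto)+
  then show "emeasure lborel {a..} \<noteq> 0" "emeasure lborel {..a} \<noteq> 0" by auto
qed

section \<open>Moments of Brownian increments on past events\<close>

context brownian
begin

lemma distr_increment: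
  assumes "0 \<le> s" "s < t"
  shows "distr M borel (\<lambda>\<omega>. W t \<omega> - W s \<omega>) = gauss (t - s)"
proof (rule measure_eqI)
  interpret G: prob_space "gauss (t - s)" using assms by (intro prob_space_normal_density) simp
  have [measurable]: "W t \<in> borel_measurable M" "W s \<in> borel_measurable M"
    using assms by (auto intro!: F_measurable[OF adapted])
  fix A assume "A \<in> sets (distr M borel (\<lambda>\<omega>. W t \<omega> - W s \<omega>))"
  then have A: "A \<in> sets borel" by simp
  have "space M \<in> sets (F (ennreal s))" using sets.top[of "F (ennreal s)"] by (simp add: space_F)
  from increment[OF assms this A] show "emeasure (distr M borel (\<lambda>\<omega>. W t \<omega> - W s \<omega>)) A = emeasure (gauss (t - s)) A"
    using A by (simp add: emeasure_distr emeasure_eq_measure G.emeasure_eq_measure prob_space Int_def vimage_def conj_commute)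
qed simp

lemma increment_nn_integral:
  assumes st: "0 \<le> s" "s < t" and G: "G \<in> sets (F (ennreal s))" and f: "f \<in> borel_measurable borel"
  shows "(\<integral>\<^sup>+\<omega>. indicator G \<omega> * f (W t \<omega> - W s \<omega>) \<partial>M) = ennreal (prob G) * (\<integral>\<^sup>+x. f x \<partial>gauss (t - s))"
proof -
  have m: "(\<lambda>\<omega>. W t \<omega> - W s \<omega>) \<in> borel_measurable M"
    using st by (intro borel_measurable_diff F_measurable[OF adapted]) auto
  have Ge: "G \<in> events" using G F_sub by blast
  have "space M \<in> sets (F (ennreal s))" using sets.top[of "F (ennreal s)"] by (simp add: space_F)
  note sp = increment[OF st this]
  have "(\<integral>\<^sup>+\<omega>. indicator G \<omega> * f (W t \<omega> - W s \<omega>) \<partial>M) = ennreal (prob G) * (\<integral>\<^sup>+\<omega>. f (W t \<omega> - W s \<omega>) \<partial>M)"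
  proof (rule indep_law_nn_integral[OF Ge m m _ f])
    fix E :: "real set" assume E: "E \<in> sets borel"
    show "prob (G \<inter> {\<omega> \<in> space M. W t \<omega> - W s \<omega> \<in> E}) = prob G * prob {\<omega> \<in> space M. W t \<omega> - W s \<omega> \<in> E}"
      using increment[OF st G E] sp[OF E] by (simp add: prob_space Int_def)
  qed
  also have "(\<integral>\<^sup>+\<omega>. f (W t \<omega> - W s \<omega>) \<partial>M) = (\<integral>\<^sup>+x. f x \<partial>gauss (t - s))"
    using distr_increment[OF st] nn_integral_distr[OF m, of f] f by simp
  finally show ?thesis .
qed

lemma increment_square_nn_integral:
  assumes "0 \<le> s" "s < t" and "G \<in> sets (F (ennreal s))"
  shows "(\<integral>\<^sup>+\<omega>. indicator G \<omega> * ennreal ((W t \<omega> - W s \<omega>)\<^sup>2) \<partial>M) = ennreal (prob G) * ennreal (t - s)"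
  using increment_nn_integral[OF assms, of "\<lambda>x. ennreal (x\<^sup>2)"] gauss_second_moment[of "t - s"] assms by simp

lemma integrable_increment:
  assumes st: "0 \<le> s" "s < t"
  shows "integrable M (\<lambda>\<omega>. W t \<omega> - W s \<omega>)" "(\<integral>\<omega>. W t \<omega> - W s \<omega> \<partial>M) = 0"
    "integrable M (\<lambda>\<omega>. (W t \<omega> - W s \<omega>)\<^sup>2)"
proof -
  have m[measurable]: "(\<lambda>\<omega>. W t \<omega> - W s \<omega>) \<in> borel_measurable M"
    using st by (intro borel_measurable_diff F_measurable[OF adapted]) auto
  show "integrable M (\<lambda>\<omega>. W t \<omega> - W s \<omega>)"
    by (rule integrable_distr[OF m, of "\<lambda>x. x"]) (simp only: distr_increment[OF st] gauss_mean(2) st diff_gt_0_iff_gt)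
  show "(\<integral>\<omega>. W t \<omega> - W s \<omega> \<partial>M) = 0"
    using integral_distr[OF m measurable_ident_sets[OF refl]] unfolding distr_increment[OF st]
    by (simp only: gauss_mean(1) st diff_gt_0_iff_gt)
  have "space M \<in> sets (F (ennreal s))" using sets.top[of "F (ennreal s)"] by (simp add: space_F)
  from increment_square_nn_integral[OF st this]
  have "(\<integral>\<^sup>+\<omega>. indicator (space M) \<omega> * ennreal ((W t \<omega> - W s \<omega>)\<^sup>2) \<partial>M) < \<infinity>"
    by (simp add: prob_space)
  also have "(\<integral>\<^sup>+\<omega>. indicator (space M) \<omega> * ennreal ((W t \<omega> - W s \<omega>)\<^sup>2) \<partial>M) = (\<integral>\<^sup>+\<omega>. ennreal ((W t \<omega> - W s \<omega>)\<^sup>2) \<partial>M)"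
    by (intro nn_integral_cong) simp
  finally show "integrable M (\<lambda>\<omega>. (W t \<omega> - W s \<omega>)\<^sup>2)"
    by (intro integrableI_nonneg) auto
qed

lemma integral_increment_square:
  assumes "0 \<le> s" "s < t" and "G \<in> sets (F (ennreal s))"
  shows "(\<integral>\<omega>. indicator G \<omega> * (W t \<omega> - W s \<omega>)\<^sup>2 \<partial>M) = prob G * (t - s)"
proof -
  have "G \<in> events" using assms(3) F_sub by blast
  then have "integrable M (\<lambda>\<omega>. indicator G \<omega> * (W t \<omega> - W s \<omega>)\<^sup>2)"
    using integrable_mult_indicator[OF _ integrable_increment(3)[OF assms(1,2)]] by simp
  then have "ennreal (\<integral>\<omega>. indicator G \<omega> * (W t \<omega> - W s \<omega>)\<^sup>2 \<partial>M) = (\<integral>\<^sup>+\<omega>. ennreal (indicator G \<omega> * (W t \<omega> - W s \<omega>)\<^sup>2) \<partial>M)"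
    by (subst nn_integral_eq_integral) auto
  also have "\<dots> = (\<integral>\<^sup>+\<omega>. indicator G \<omega> * ennreal ((W t \<omega> - W s \<omega>)\<^sup>2) \<partial>M)"
    by (intro nn_integral_cong) (auto simp: indicator_def)
  also have "\<dots> = ennreal (prob G * (t - s))"
    using increment_square_nn_integral[OF assms] assms by (simp add: ennreal_mult)
  finally show ?thesis
    using assms by (subst (asm) ennreal_inj) (auto intro!: integral_nonneg_AE)
qed

text \<open>This takes the place of the martingale property of a stochastic integral. Independence
  makes the product integrable from integrability of the factors alone, and its mean is the product
  of the means.\<close>

lemma integral_mult_increment:
  assumes st: "0 \<le> s" "s < t" and \<xi>: "\<xi> \<in> borel_measurable (F (ennreal s))" "integrable M \<xi>"
  shows "integrable M (\<lambda>\<omega>. \<xi> \<omega> * (W t \<omega> - W s \<omega>))" "(\<integral>\<omega>. \<xi> \<omega> * (W t \<omega> - W s \<omega>) \<partial>M) = 0"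
proof -
  define D where "D \<omega> = W t \<omega> - W s \<omega>" for \<omega>
  have m: "D \<in> borel_measurable M"
    unfolding D_def using st by (intro borel_measurable_diff F_measurable[OF adapted]) auto
  have "indep_var borel \<xi> borel D"
    unfolding indep_var_eq
  proof (intro conjI indep_setI)
    show "random_variable borel \<xi>" "random_variable borel D" using \<xi> m by auto
    have sF: "sigma_sets (space M) {\<xi> -` A \<inter> space M |A. A \<in> sets borel} \<subseteq> sets (F (ennreal s))"
      using sets.sigma_sets_subset[of "{\<xi> -` A \<inter> space M |A. A \<in> sets borel}" "F (ennreal s)"]
        measurable_sets[OF \<xi>(1)] by (auto simp: space_F)
    then show "sigma_sets (space M) {\<xi> -` A \<inter> space M |A. A \<in> sets borel} \<subseteq> events" using F_sub by blast
    \<comment> \<open>Preimages under a single map already form a sigma-algebra, so every member of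
      the generated one is an event about the increment.\<close>
    have sD: "sigma_sets (space M) {D -` A \<inter> space M |A. A \<in> sets borel} = {D -` A \<inter> space M |A. A \<in> sets borel}"
      using sets_vimage_algebra[of "space M" D borel] sets_vimage_algebra2[of D "space M" borel] by simp
    then show "sigma_sets (space M) {D -` A \<inter> space M |A. A \<in> sets borel} \<subseteq> events"
      using measurable_sets[OF m] by auto
    fix a b assume a: "a \<in> sigma_sets (space M) {\<xi> -` A \<inter> space M |A. A \<in> sets borel}"
      and "b \<in> sigma_sets (space M) {D -` A \<inter> space M |A. A \<in> sets borel}"
    then obtain A where A: "A \<in> sets borel" "b = {\<omega> \<in> space M. W t \<omega> - W s \<omega> \<in> A}"
      unfolding sD by (auto simp: D_def vimage_def Int_def conj_commute)
    have "space M \<in> sets (F (ennreal s))" using sets.top[of "F (ennreal s)"] by (simp add: space_F)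
    from increment[OF st this A(1)] have "prob b = measure (gauss (t - s)) A"
      by (simp add: A(2) prob_space Int_def)
    then show "prob (a \<inter> b) = prob a * prob b"
      using increment[OF st _ A(1), of a] sF a by (auto simp: A(2))
  qed
  then show "integrable M (\<lambda>\<omega>. \<xi> \<omega> * (W t \<omega> - W s \<omega>))" "(\<integral>\<omega>. \<xi> \<omega> * (W t \<omega> - W s \<omega>) \<partial>M) = 0"
    using indep_var_integrable[of \<xi> D] indep_var_lebesgue_integral[of \<xi> D] \<xi>(2)
      integrable_increment(1,2)[OF st, folded D_def]
    by (simp_all add: D_def[symmetric])
qed

text \<open>The random remainder in \<open>lyapunov_pathwise\<close>: it controls how far the noise
  moves the state while the drift acts during \<open>[s, s+1]\<close>.\<close>

definition increment_energy :: "real \<Rightarrow> 'a \<Rightarrow> real" where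
  "increment_energy s \<omega> = integral {0..1} (\<lambda>r. (W (s + r) \<omega> - W s \<omega>)\<^sup>2)"

lemma increment_continuous: "0 \<le> s \<Longrightarrow> continuous_on {0..1} (\<lambda>r. W (s + r) \<omega> - W s \<omega>)"
  by (intro continuous_intros continuous_on_compose2[OF continuous[of \<omega>]]) auto

lemma increment_energy_nonneg: "0 \<le> s \<Longrightarrow> 0 \<le> increment_energy s \<omega>"
  unfolding increment_energy_def
  by (intro integral_nonneg integrable_continuous_interval continuous_on_power increment_continuous) auto

text \<open>By Tonelli's theorem the expectation may be taken first; the squared increment over a
  time \<open>r\<close> contributes \<open>prob G * r\<close>, and \<open>r\<close> is at most
  1.\<close>

lemma integral_increment_energy:
  assumes s: "0 \<le> s" and G: "G \<in> sets (F (ennreal s))"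
  shows "integrable M (\<lambda>\<omega>. indicator G \<omega> * increment_energy s \<omega>)"
    "(\<integral>\<omega>. indicator G \<omega> * increment_energy s \<omega> \<partial>M) \<le> prob G"
proof -
  have [measurable]: "G \<in> events" using G F_sub by blast
  have c2: "continuous_on {0..1} (\<lambda>r. (W (s + r) \<omega> - W s \<omega>)\<^sup>2)" for \<omega>
    by (intro continuous_on_power increment_continuous s)
  have Wm: "W r \<in> borel_measurable M" if "0 \<le> r" for r by (rule F_measurable[OF adapted[OF that]])
  have [measurable]: "increment_energy s \<in> borel_measurable M"
    unfolding increment_energy_def
    using s Wm c2 by (intro measurable_integral_process) auto
  \<comment> \<open>The truncation \<open>max 0\<close> keeps the time nonnegative for every real
    \<open>r\<close>, as measurability on the whole product demands.\<close>
  have [measurable]: "(\<lambda>p. W (s + max 0 (snd p)) (fst p)) \<in> borel_measurable (M \<Otimes>\<^sub>M lborel)"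
    by (rule measurable_process_at[where S="{0..}" and Z="\<lambda>s p. W s (fst p)"])
       (use s continuous Wm in \<open>auto intro: measurable_compose[OF measurable_fst]\<close>)
  have [measurable]: "W s \<in> borel_measurable M" using Wm s by blast
  interpret pair_sigma_finite M lborel ..
  have "(\<integral>\<^sup>+\<omega>. indicator G \<omega> * ennreal (increment_energy s \<omega>) \<partial>M)
      = (\<integral>\<^sup>+\<omega>. (\<integral>\<^sup>+r. indicator G \<omega> * ennreal ((W (s + max 0 r) \<omega> - W s \<omega>)\<^sup>2) * indicator {0..1} r \<partial>lborel) \<partial>M)"
  proof (rule nn_integral_cong)
    fix \<omega> assume "\<omega> \<in> space M"
    have "((\<lambda>r. (W (s + r) \<omega> - W s \<omega>)\<^sup>2) has_integral increment_energy s \<omega>) {0..1}"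
      unfolding increment_energy_def using c2 by (intro integrable_integral integrable_continuous_interval)
    from nn_integral_has_integral_lebesgue'[OF _ this]
    have "ennreal (increment_energy s \<omega>) = (\<integral>\<^sup>+r. ennreal ((W (s + r) \<omega> - W s \<omega>)\<^sup>2) * indicator {0..1} r \<partial>lborel)"
      by simp
    also have "\<dots> = (\<integral>\<^sup>+r. ennreal ((W (s + max 0 r) \<omega> - W s \<omega>)\<^sup>2) * indicator {0..1} r \<partial>lborel)"
      by (intro nn_integral_cong) (auto simp: indicator_def)
    finally show "indicator G \<omega> * ennreal (increment_energy s \<omega>)
      = (\<integral>\<^sup>+r. indicator G \<omega> * ennreal ((W (s + max 0 r) \<omega> - W s \<omega>)\<^sup>2) * indicator {0..1} r \<partial>lborel)"
      by (auto simp: indicator_def)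
  qed
  also have "\<dots> = (\<integral>\<^sup>+r. (\<integral>\<^sup>+\<omega>. indicator G \<omega> * ennreal ((W (s + max 0 r) \<omega> - W s \<omega>)\<^sup>2) * indicator {0..1} r \<partial>M) \<partial>lborel)"
    by (rule Fubini'[symmetric]) measurable
  also have "\<dots> \<le> (\<integral>\<^sup>+r. ennreal (prob G) * indicator {0..1} (r::real) \<partial>lborel)"
  proof (rule nn_integral_mono)
    fix r :: real
    show "(\<integral>\<^sup>+\<omega>. indicator G \<omega> * ennreal ((W (s + max 0 r) \<omega> - W s \<omega>)\<^sup>2) * indicator {0..1} r \<partial>M)
      \<le> ennreal (prob G) * indicator {0..1} r"
    proof (cases "0 < r \<and> r \<le> 1")
      case True
      then have "(\<integral>\<^sup>+\<omega>. indicator G \<omega> * ennreal ((W (s + r) \<omega> - W s \<omega>)\<^sup>2) \<partial>M) = ennreal (prob G) * ennreal r"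
        using increment_square_nn_integral[OF s _ G, of "s + r"] by simp
      also have "\<dots> \<le> ennreal (prob G) * 1" using True by (intro mult_left_mono) auto
      finally show ?thesis using True by simp
    next
      case False
      then show ?thesis by (cases "r = 0") (auto simp: indicator_def)
    qed
  qed
  also have "\<dots> = ennreal (prob G)" by (simp add: nn_integral_cmult)
  finally have le: "(\<integral>\<^sup>+\<omega>. indicator G \<omega> * ennreal (increment_energy s \<omega>) \<partial>M) \<le> ennreal (prob G)" .
  also have eq: "(\<integral>\<^sup>+\<omega>. indicator G \<omega> * ennreal (increment_energy s \<omega>) \<partial>M)
      = (\<integral>\<^sup>+\<omega>. ennreal (indicator G \<omega> * increment_energy s \<omega>) \<partial>M)"
    by (intro nn_integral_cong) (auto simp: indicator_def)
  finally have le': "(\<integral>\<^sup>+\<omega>. ennreal (indicator G \<omega> * increment_energy s \<omega>) \<partial>M) \<le> ennreal (prob G)" .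
  also have "\<dots> < \<infinity>" by simp
  finally show int: "integrable M (\<lambda>\<omega>. indicator G \<omega> * increment_energy s \<omega>)"
    using increment_energy_nonneg[OF s] by (intro integrableI_nonneg) auto
  from le' show "(\<integral>\<omega>. indicator G \<omega> * increment_energy s \<omega> \<partial>M) \<le> prob G"
    using int increment_energy_nonneg[OF s] by (subst (asm) nn_integral_eq_integral) auto
qed

end

text \<open>Only integer times are inspected: this keeps the event measurable at once, and by continuity
  a path that is not one-sided has hit \<open>x\<close>.\<close>

definition one_sided :: "real \<Rightarrow> nat \<Rightarrow> (real \<Rightarrow> real) \<Rightarrow> bool" where
  "one_sided x n w \<longleftrightarrow> (\<forall>i\<le>n. w (real i) < x) \<or> (\<forall>i\<le>n. x < w (real i))"

lemma hitting_time_le: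
  assumes w: "continuous_on {0..} w" and n: "\<not> one_sided x n w"
  shows "hitting_time x w \<le> ennreal (real n)"
proof -
  obtain i j where ij: "i \<le> n" "x \<le> w (real i)" "j \<le> n" "w (real j) \<le> x"
    using n unfolding one_sided_def by (meson not_less)
  have "connected (w ` {0..real n})"
    by (intro connected_continuous_image continuous_on_subset[OF w]) auto
  moreover have "w (real i) \<in> w ` {0..real n}" "w (real j) \<in> w ` {0..real n}" using ij by auto
  ultimately have "x \<in> w ` {0..real n}" using ij unfolding connected_iff_interval by blast
  then obtain s where s: "0 \<le> s" "s \<le> real n" "w s = x" by auto
  have "hitting_time x w \<le> ennreal s"
    unfolding hitting_time_def by (rule Inf_lower) (use s in auto)
  also have "\<dots> \<le> ennreal (real n)" using s by (intro ennreal_leI)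
  finally show ?thesis .
qed

lemma one_sided_antimono: "one_sided x n w \<Longrightarrow> m \<le> n \<Longrightarrow> one_sided x m w"
  unfolding one_sided_def using le_trans by blast

text \<open>One-sidedness is lost once and for all, so the series counts the integers before this
  loss, and by then \<open>x\<close> has been hit. If it is never lost the series is infinite, even
  though \<open>x\<close> may have been hit between integer times.\<close>

lemma hitting_time_le_suminf:
  assumes w: "continuous_on {0..} w"
  shows "hitting_time x w \<le> (\<Sum>n. indicator {w. one_sided x n w} w)"
proof (cases "\<exists>n. \<not> one_sided x n w")
  case True
  define n where "n = (LEAST n. \<not> one_sided x n w)"
  have n: "\<not> one_sided x n w" using True unfolding n_def by (rule LeastI_ex)
  have lt: "one_sided x k w" if "k < n" for k using not_less_Least that unfolding n_def by blast
  have "hitting_time x w \<le> ennreal (real n)" using hitting_time_le[OF w n] .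
  also have "\<dots> = (\<Sum>k<n. indicator {w. one_sided x k w} w)" using lt by (simp add: ennreal_of_nat_eq_real_of_nat)
  also have "\<dots> \<le> (\<Sum>n. indicator {w. one_sided x n w} w)" by (rule sum_le_suminf) auto
  finally show ?thesis .
next
  case False
  have "of_nat n \<le> (\<Sum>n. indicator {w. one_sided x n w} w :: ennreal)" for n
  proof -
    have "(of_nat n :: ennreal) = (\<Sum>k<n. indicator {w. one_sided x k w} w)" using False by simp
    also have "\<dots> \<le> (\<Sum>n. indicator {w. one_sided x n w} w)" by (rule sum_le_suminf) auto
    finally show ?thesis .
  qed
  then have "(\<Sum>n. indicator {w. one_sided x n w} w :: ennreal) = top"
    using ennreal_Ex_less_of_nat by (metis leD top.not_eq_extremum)
  then show ?thesis by simp
qed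

lemma square_add_le: "(a + b)\<^sup>2 \<le> 2 * a\<^sup>2 + 2 * b\<^sup>2" for a b :: real
  using zero_le_power2[of "a - b"] unfolding power2_sum power2_diff by simp

section \<open>The solution driven by \<open>W\<close>\<close>

locale diffusion = brownian M F W + lipschitz_drift \<beta> L
  for M :: "'a measure" and F W \<beta> L +
  fixes \<sigma> :: real
begin

definition sol :: "real \<Rightarrow> real \<Rightarrow> 'a \<Rightarrow> real" where
  "sol y t \<omega> = flow \<beta> (\<lambda>s. y + \<sigma> * W s \<omega>) t"

lemma noise_continuous: "continuous_on {0..} (\<lambda>s. y + \<sigma> * W s \<omega>)"
  by (intro continuous_intros continuous)

lemma sol_solution: "integral_solution \<beta> (\<lambda>s. y + \<sigma> * W s \<omega>) (\<lambda>t. sol y t \<omega>)"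
  unfolding sol_def using flow_solution[OF noise_continuous] .

lemma sol_continuous: "continuous_on {0..} (\<lambda>t. sol y t \<omega>)"
  using sol_solution by (simp add: integral_solution_def)

lemma sol_adapted: "0 \<le> t \<Longrightarrow> sol y t \<in> borel_measurable (F (ennreal t))"
  unfolding sol_def
proof (rule measurable_flow)
  fix s :: real assume "0 \<le> s" "s \<le> t"
  then show "(\<lambda>\<omega>. y + \<sigma> * W s \<omega>) \<in> borel_measurable (F (ennreal t))"
    by (intro borel_measurable_add borel_measurable_times borel_measurable_const
        F_measurable_mono[OF _ adapted] ennreal_leI) auto
qed (use noise_continuous in auto)

lemma sol_start: "sol y 0 \<omega> = y"
  using sol_solution[of y \<omega>] by (simp add: integral_solution_def start)

lemma sol_step:
  assumes "0 \<le> s" "0 \<le> t"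
  shows "sol y (s + t) \<omega> = sol y s \<omega> + \<sigma> * (W (s + t) \<omega> - W s \<omega>) + integral {0..t} (\<lambda>r. \<beta> (sol y (s + r) \<omega>))"
proof -
  have "integral_solution \<beta> (\<lambda>t. sol y s \<omega> + (y + \<sigma> * W (s + t) \<omega> - (y + \<sigma> * W s \<omega>))) (\<lambda>t. sol y (s + t) \<omega>)"
    using integral_solution_shift[OF sol_solution assms(1)] .
  then have "sol y (s + t) \<omega> = (sol y s \<omega> + (y + \<sigma> * W (s + t) \<omega> - (y + \<sigma> * W s \<omega>)))
      + integral {0..t} (\<lambda>r. \<beta> (sol y (s + r) \<omega>))"
    unfolding integral_solution_def using assms(2) by blast
  then show ?thesis by (simp add: right_diff_distrib)
qed

lemma sol_shift_continuous: "0 \<le> s \<Longrightarrow> continuous_on {0..t} (\<lambda>r. sol y (s + r) \<omega>)"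
  by (intro continuous_on_compose2[OF sol_continuous[of y \<omega>]]) (auto intro!: continuous_intros)

end

section \<open>The Lyapunov estimate\<close>

text \<open>What recurrence retains of the potential: a bounded drift which, away from a bounded
  set, pulls inward at a speed bounded below. \<open>C'\<close> absorbs the bounded set.\<close>

locale confined_diffusion = diffusion +
  fixes C C' c :: real
  assumes drift_bounded: "\<And>x. \<bar>\<beta> x\<bar> \<le> C"
    and drift_inward: "\<And>x. x * \<beta> x \<le> C' - c * \<bar>x\<bar>"
    and c_pos: "0 < c" and \<sigma>_pos: "0 < \<sigma>"
begin

lemma integrable_event: "A \<in> events \<Longrightarrow> integrable M (indicator A :: 'a \<Rightarrow> real)"
  by (rule integrable_real_indicator) (simp_all add: emeasure_eq_measure)

lemma C_nonneg: "0 \<le> C"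
  using drift_bounded[of 0] by simp

lemma drift_integral_bound:
  assumes "0 \<le> s" "0 \<le> t"
  shows "\<bar>integral {0..t} (\<lambda>r. \<beta> (sol y (s + r) \<omega>))\<bar> \<le> C * t"
  using integral_bound[of 0 t "\<lambda>r. \<beta> (sol y (s + r) \<omega>)" C] assms drift_bounded
    drift_comp_continuous[OF sol_shift_continuous] by simp

lemma sol_deviation:
  assumes "0 \<le> s" "0 \<le> t"
  shows "\<bar>sol y (s + t) \<omega> - sol y s \<omega> - \<sigma> * (W (s + t) \<omega> - W s \<omega>)\<bar> \<le> C * t"
  using drift_integral_bound[OF assms, of y \<omega>] sol_step[OF assms, of y \<omega>] by linarith

text \<open>The square of \<open>X + \<sigma> * \<Delta> 1 + I\<close> is expanded. The term
  \<open>2 * X * I\<close> gives the decrease \<open>2 * c * \<bar>X\<bar>\<close> and the factors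
  \<open>C + c\<close>; the square of \<open>\<sigma> * \<Delta> 1 + I\<close> is bounded by twice
  the sum of the squares.\<close>

lemma lyapunov_pathwise:
  assumes s: "0 \<le> s"
  shows "(sol y (s + 1) \<omega>)\<^sup>2 \<le> (sol y s \<omega>)\<^sup>2 + 2 * \<sigma> * (sol y s \<omega> * (W (s + 1) \<omega> - W s \<omega>))
    - 2 * c * \<bar>sol y s \<omega>\<bar> + (2 * C' + 2 * (C + c) * (C + \<sigma>) + 2 * C\<^sup>2)
    + 2 * (C + c) * \<sigma> * increment_energy s \<omega> + 2 * \<sigma>\<^sup>2 * (W (s + 1) \<omega> - W s \<omega>)\<^sup>2"
proof -
  define X where "X = sol y s \<omega>"
  define \<Delta> where "\<Delta> r = W (s + r) \<omega> - W s \<omega>" for r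
  define I where "I = integral {0..1} (\<lambda>r. \<beta> (sol y (s + r) \<omega>))"
  have X': "sol y (s + 1) \<omega> = X + \<sigma> * \<Delta> 1 + I"
    using sol_step[OF s, of 1 y \<omega>] by (simp add: X_def \<Delta>_def I_def)
  have c2: "continuous_on {0..1} (\<lambda>r. (\<Delta> r)\<^sup>2)"
    unfolding \<Delta>_def by (intro continuous_on_power increment_continuous s)
  have J: "((\<lambda>r. (\<Delta> r)\<^sup>2) has_integral increment_energy s \<omega>) {0..1}"
    unfolding increment_energy_def \<Delta>_def[symmetric]
    by (intro integrable_integral integrable_continuous_interval c2)
  have rhs: "((\<lambda>r. (C' - c * \<bar>X\<bar> + (C + c) * (C + \<sigma>)) + (C + c) * \<sigma> * (\<Delta> r)\<^sup>2) has_integral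
      ((C' - c * \<bar>X\<bar> + (C + c) * (C + \<sigma>)) + (C + c) * \<sigma> * increment_energy s \<omega>)) {0..1}"
    using has_integral_add[OF has_integral_const_real[of "C' - c * \<bar>X\<bar> + (C + c) * (C + \<sigma>)" 0 1]
        has_integral_mult_right[OF J, of "(C + c) * \<sigma>"]] by simp
  have lhs: "((\<lambda>r. X * \<beta> (sol y (s + r) \<omega>)) has_integral X * I) {0..1}"
    unfolding I_def
    by (intro has_integral_mult_right integrable_integral integrable_continuous_interval
        drift_comp_continuous sol_shift_continuous s)
  have "X * I \<le> (C' - c * \<bar>X\<bar> + (C + c) * (C + \<sigma>)) + (C + c) * \<sigma> * increment_energy s \<omega>"
  proof (rule has_integral_le[OF lhs rhs])
    fix r :: real assume r: "r \<in> {0..1}"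
    define Y where "Y = sol y (s + r) \<omega>"
    have "\<bar>Y - X - \<sigma> * \<Delta> r\<bar> \<le> C * r"
      using sol_deviation[OF s, of r y \<omega>] r by (simp add: X_def Y_def \<Delta>_def)
    also have "\<dots> \<le> C * 1" using r C_nonneg by (intro mult_left_mono) auto
    finally have "\<bar>X - Y\<bar> \<le> C + \<bar>\<sigma> * \<Delta> r\<bar>" by linarith
    \<comment> \<open>The first power is traded for a square, so that second moments of the noise
      suffice.\<close>
    also have "\<bar>\<sigma> * \<Delta> r\<bar> \<le> \<sigma> * (1 + (\<Delta> r)\<^sup>2)"
    proof -
      have "0 \<le> (\<bar>\<Delta> r\<bar> - 1)\<^sup>2" by simp
      then have "\<bar>\<Delta> r\<bar> \<le> 1 + (\<Delta> r)\<^sup>2" unfolding power2_diff using zero_le_power2[of "\<Delta> r"] by simp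
      then show ?thesis using \<sigma>_pos by (simp add: abs_mult)
    qed
    finally have XY: "\<bar>X - Y\<bar> \<le> C + \<sigma> + \<sigma> * (\<Delta> r)\<^sup>2" by (simp add: algebra_simps)
    have "X * \<beta> Y = Y * \<beta> Y + (X - Y) * \<beta> Y" by (simp add: algebra_simps)
    moreover have "(X - Y) * \<beta> Y \<le> \<bar>X - Y\<bar> * C"
    proof -
      have "(X - Y) * \<beta> Y \<le> \<bar>X - Y\<bar> * \<bar>\<beta> Y\<bar>" unfolding abs_mult[symmetric] by (rule abs_ge_self)
      also have "\<dots> \<le> \<bar>X - Y\<bar> * C" by (intro mult_left_mono drift_bounded) simp
      finally show ?thesis .
    qed
    moreover have "Y * \<beta> Y \<le> C' - c * \<bar>Y\<bar>" by (rule drift_inward)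
    moreover have "c * \<bar>X\<bar> \<le> c * (\<bar>Y\<bar> + \<bar>X - Y\<bar>)" using c_pos by (intro mult_left_mono) auto
    ultimately have "X * \<beta> Y \<le> C' - c * \<bar>X\<bar> + (C + c) * \<bar>X - Y\<bar>" by (simp add: algebra_simps)
    also have "(C + c) * \<bar>X - Y\<bar> \<le> (C + c) * (C + \<sigma> + \<sigma> * (\<Delta> r)\<^sup>2)"
      using XY C_nonneg c_pos by (intro mult_left_mono) auto
    finally show "X * \<beta> (sol y (s + r) \<omega>) \<le> C' - c * \<bar>X\<bar> + (C + c) * (C + \<sigma>) + (C + c) * \<sigma> * (\<Delta> r)\<^sup>2"
      by (simp add: Y_def algebra_simps)
  qed
  moreover have "(\<sigma> * \<Delta> 1 + I)\<^sup>2 \<le> 2 * \<sigma>\<^sup>2 * (\<Delta> 1)\<^sup>2 + 2 * C\<^sup>2"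
  proof -
    have "\<bar>I\<bar> \<le> C" using drift_integral_bound[OF s, of 1 y \<omega>] by (simp add: I_def)
    then have "I\<^sup>2 \<le> C\<^sup>2" using C_nonneg by (simp add: abs_le_square_iff[symmetric])
    then show ?thesis using square_add_le[of "\<sigma> * \<Delta> 1" I] by (simp add: power_mult_distrib)
  qed
  moreover have "(sol y (s + 1) \<omega>)\<^sup>2 = X\<^sup>2 + 2 * \<sigma> * (X * \<Delta> 1) + 2 * (X * I) + (\<sigma> * \<Delta> 1 + I)\<^sup>2"
    unfolding X' by (simp add: power2_sum algebra_simps)
  ultimately show ?thesis unfolding X_def[symmetric] \<Delta>_def[symmetric] by (simp add: algebra_simps)
qed

text \<open>The drift displaces the state by at most \<open>C * s\<close>, so the solution inherits
  its second moment from the noise.\<close>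

lemma sol_square_integrable:
  assumes s: "0 \<le> s"
  shows "integrable M (\<lambda>\<omega>. (sol y s \<omega>)\<^sup>2)"
proof (rule Bochner_Integration.integrable_bound)
  have "integrable M (\<lambda>\<omega>. (W s \<omega> - W 0 \<omega>)\<^sup>2)"
    using integrable_increment(3)[of 0 s] s by (cases "s = 0") auto
  then show "integrable M (\<lambda>\<omega>. 2 * (\<bar>y\<bar> + C * s)\<^sup>2 + 2 * \<sigma>\<^sup>2 * (W s \<omega> - W 0 \<omega>)\<^sup>2)" by auto
  show "(\<lambda>\<omega>. (sol y s \<omega>)\<^sup>2) \<in> borel_measurable M"
    using F_measurable[OF sol_adapted[OF s]] by (intro borel_measurable_power)
  show "AE \<omega> in M. norm ((sol y s \<omega>)\<^sup>2) \<le> norm (2 * (\<bar>y\<bar> + C * s)\<^sup>2 + 2 * \<sigma>\<^sup>2 * (W s \<omega> - W 0 \<omega>)\<^sup>2)"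
  proof (rule AE_I2)
    fix \<omega>
    have "\<bar>sol y s \<omega>\<bar> \<le> (\<bar>y\<bar> + C * s) + \<bar>\<sigma> * (W s \<omega> - W 0 \<omega>)\<bar>"
      using sol_deviation[of 0 s y \<omega>] s by (simp add: sol_start)
    then have "\<bar>sol y s \<omega>\<bar>\<^sup>2 \<le> ((\<bar>y\<bar> + C * s) + \<bar>\<sigma> * (W s \<omega> - W 0 \<omega>)\<bar>)\<^sup>2" by (intro power_mono) auto
    also have "\<dots> \<le> 2 * (\<bar>y\<bar> + C * s)\<^sup>2 + 2 * \<bar>\<sigma> * (W s \<omega> - W 0 \<omega>)\<bar>\<^sup>2"
      by (rule square_add_le)
    finally show "norm ((sol y s \<omega>)\<^sup>2) \<le> norm (2 * (\<bar>y\<bar> + C * s)\<^sup>2 + 2 * \<sigma>\<^sup>2 * (W s \<omega> - W 0 \<omega>)\<^sup>2)"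
      by (simp add: power_mult_distrib)
  qed
qed

lemma sol_integrable:
  assumes s: "0 \<le> s"
  shows "integrable M (sol y s)"
proof (rule Bochner_Integration.integrable_bound)
  show "integrable M (\<lambda>\<omega>. 1 + (sol y s \<omega>)\<^sup>2)" using sol_square_integrable[OF s] by auto
  show "sol y s \<in> borel_measurable M" by (rule F_measurable[OF sol_adapted[OF s]])
  have "\<bar>z\<bar> \<le> 1 + z\<^sup>2" for z :: real
  proof -
    have "0 \<le> (\<bar>z\<bar> - 1)\<^sup>2" by simp
    then show ?thesis unfolding power2_diff using zero_le_power2[of z] by simp
  qed
  then show "AE \<omega> in M. norm (sol y s \<omega>) \<le> norm (1 + (sol y s \<omega>)\<^sup>2)"
    by (auto simp: abs_of_nonneg)
qed

text \<open>The constant term of \<open>lyapunov_pathwise\<close> once the energy and the squared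
  unit increment are replaced by the bound 1 for their means.\<close>

definition lyapunov_const :: real where
  "lyapunov_const = (2 * C' + 2 * (C + c) * (C + \<sigma>) + 2 * C\<^sup>2) + 2 * (C + c) * \<sigma> + 2 * \<sigma>\<^sup>2"

text \<open>Since \<open>G\<close> belongs to the past of \<open>s\<close>, the cross term with the
  noise still has mean zero after restriction to \<open>G\<close>. The restriction allows the
  estimate to be used on the event that \<open>x\<close> has not been crossed so far.\<close>

lemma lyapunov_integral:
  assumes s: "0 \<le> s" and G: "G \<in> sets (F (ennreal s))"
  shows "(\<integral>\<omega>. indicator G \<omega> * (sol y (s + 1) \<omega>)\<^sup>2 \<partial>M) \<le> (\<integral>\<omega>. indicator G \<omega> * (sol y s \<omega>)\<^sup>2 \<partial>M)
    - 2 * c * (\<integral>\<omega>. indicator G \<omega> * \<bar>sol y s \<omega>\<bar> \<partial>M) + lyapunov_const * prob G"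
proof -
  define \<Delta> where "\<Delta> \<omega> = W (s + 1) \<omega> - W s \<omega>" for \<omega>
  define K where "K = 2 * C' + 2 * (C + c) * (C + \<sigma>) + 2 * C\<^sup>2"
  have Ge[measurable]: "G \<in> events" using G F_sub by blast
  have ind: "integrable M (\<lambda>\<omega>. indicator G \<omega> * f \<omega>)" if "integrable M f" for f :: "'a \<Rightarrow> real"
    using integrable_mult_indicator[OF Ge that] by simp
  have i1: "integrable M (\<lambda>\<omega>. indicator G \<omega> * (sol y s \<omega>)\<^sup>2)" by (intro ind sol_square_integrable s)
  have i1': "integrable M (\<lambda>\<omega>. indicator G \<omega> * (sol y (s + 1) \<omega>)\<^sup>2)" using s by (intro ind sol_square_integrable) auto
  have i2: "integrable M (\<lambda>\<omega>. indicator G \<omega> * \<bar>sol y s \<omega>\<bar>)" by (intro ind integrable_abs sol_integrable s)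
  have "(\<lambda>\<omega>. indicator G \<omega> * sol y s \<omega>) \<in> borel_measurable (F (ennreal s))"
    using sol_adapted[OF s, of y] G by auto
  then have i3: "integrable M (\<lambda>\<omega>. indicator G \<omega> * sol y s \<omega> * \<Delta> \<omega>)" "(\<integral>\<omega>. indicator G \<omega> * sol y s \<omega> * \<Delta> \<omega> \<partial>M) = 0"
    using integral_mult_increment[OF s, of "s + 1" "\<lambda>\<omega>. indicator G \<omega> * sol y s \<omega>"] ind[OF sol_integrable[OF s]]
    unfolding \<Delta>_def by auto
  have i4: "integrable M (\<lambda>\<omega>. indicator G \<omega> * increment_energy s \<omega>)"
    "(\<integral>\<omega>. indicator G \<omega> * increment_energy s \<omega> \<partial>M) \<le> prob G"
    using integral_increment_energy[OF s G] by auto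
  have i5: "integrable M (\<lambda>\<omega>. indicator G \<omega> * (\<Delta> \<omega>)\<^sup>2)" "(\<integral>\<omega>. indicator G \<omega> * (\<Delta> \<omega>)\<^sup>2 \<partial>M) = prob G"
    using ind[OF integrable_increment(3)[OF s, of "s + 1"]] integral_increment_square[OF s _ G, of "s + 1"]
    unfolding \<Delta>_def by auto
  have i6: "integrable M (indicator G :: 'a \<Rightarrow> real)" "(\<integral>\<omega>. indicator G \<omega> \<partial>M) = prob G"
    using integrable_event[OF Ge] sets.sets_into_space[OF Ge] by (auto simp: Int_absorb2)
  have "(\<integral>\<omega>. indicator G \<omega> * (sol y (s + 1) \<omega>)\<^sup>2 \<partial>M)
    \<le> (\<integral>\<omega>. indicator G \<omega> * (sol y s \<omega>)\<^sup>2 + 2 * \<sigma> * (indicator G \<omega> * sol y s \<omega> * \<Delta> \<omega>)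
      - 2 * c * (indicator G \<omega> * \<bar>sol y s \<omega>\<bar>) + K * indicator G \<omega>
      + 2 * (C + c) * \<sigma> * (indicator G \<omega> * increment_energy s \<omega>) + 2 * \<sigma>\<^sup>2 * (indicator G \<omega> * (\<Delta> \<omega>)\<^sup>2) \<partial>M)"
  proof (rule integral_mono)
    fix \<omega>
    show "indicator G \<omega> * (sol y (s + 1) \<omega>)\<^sup>2 \<le> indicator G \<omega> * (sol y s \<omega>)\<^sup>2 + 2 * \<sigma> * (indicator G \<omega> * sol y s \<omega> * \<Delta> \<omega>)
      - 2 * c * (indicator G \<omega> * \<bar>sol y s \<omega>\<bar>) + K * indicator G \<omega>
      + 2 * (C + c) * \<sigma> * (indicator G \<omega> * increment_energy s \<omega>) + 2 * \<sigma>\<^sup>2 * (indicator G \<omega> * (\<Delta> \<omega>)\<^sup>2)"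
      using lyapunov_pathwise[OF s, of y \<omega>] by (cases "\<omega> \<in> G") (simp_all add: \<Delta>_def K_def)
  qed (intro i1' Bochner_Integration.integrable_add Bochner_Integration.integrable_diff integrable_mult_right i1 i2 i3 i4 i5 i6)+
  also have "\<dots> = (\<integral>\<omega>. indicator G \<omega> * (sol y s \<omega>)\<^sup>2 \<partial>M) + 2 * \<sigma> * 0 - 2 * c * (\<integral>\<omega>. indicator G \<omega> * \<bar>sol y s \<omega>\<bar> \<partial>M)
      + K * prob G + 2 * (C + c) * \<sigma> * (\<integral>\<omega>. indicator G \<omega> * increment_energy s \<omega> \<partial>M) + 2 * \<sigma>\<^sup>2 * prob G"
    using i1 i2 i3 i4(1) i5 i6 by simp
  also have "\<dots> \<le> (\<integral>\<omega>. indicator G \<omega> * (sol y s \<omega>)\<^sup>2 \<partial>M) + 2 * \<sigma> * 0 - 2 * c * (\<integral>\<omega>. indicator G \<omega> * \<bar>sol y s \<omega>\<bar> \<partial>M)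
      + K * prob G + 2 * (C + c) * \<sigma> * prob G + 2 * \<sigma>\<^sup>2 * prob G"
    using mult_left_mono[OF i4(2), of "2 * (C + c) * \<sigma>"] C_nonneg c_pos \<sigma>_pos by simp
  finally show ?thesis by (simp add: lyapunov_const_def K_def algebra_simps)
qed

section \<open>Decay of the probability of staying on one side\<close>

definition unhit :: "real \<Rightarrow> real \<Rightarrow> nat \<Rightarrow> 'a set" where
  "unhit x y n = {\<omega> \<in> space M. one_sided x n (\<lambda>t. sol y t \<omega>)}"

lemma unhit_sets: "unhit x y n \<in> sets (F (ennreal (real n)))"
  "{\<omega> \<in> space M. (\<forall>i\<le>n. sol y (real i) \<omega> < x) \<and> \<bar>sol y (real n) \<omega>\<bar> \<le> R} \<in> sets (F (ennreal (real n)))"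
  "{\<omega> \<in> space M. (\<forall>i\<le>n. x < sol y (real i) \<omega>) \<and> \<bar>sol y (real n) \<omega>\<bar> \<le> R} \<in> sets (F (ennreal (real n)))"
proof -
  have m: "sol y (real i) \<in> borel_measurable (F (ennreal (real n)))" if "i \<le> n" for i
    using that by (intro F_measurable_mono[OF _ sol_adapted] ennreal_leI) auto
  have 1: "{\<omega> \<in> space M. \<forall>i\<le>n. sol y (real i) \<omega> < x} \<in> sets (F (ennreal (real n)))"
    "{\<omega> \<in> space M. \<forall>i\<le>n. x < sol y (real i) \<omega>} \<in> sets (F (ennreal (real n)))"
  proof -
    have "{\<omega> \<in> space (F (ennreal (real n))). sol y (real i) \<omega> < x} \<in> sets (F (ennreal (real n)))"
      "{\<omega> \<in> space (F (ennreal (real n))). x < sol y (real i) \<omega>} \<in> sets (F (ennreal (real n)))" if "i \<in> {..n}" for i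
      using m[of i] that by (auto intro!: borel_measurable_less borel_measurable_const)
    then have "(\<Inter>i\<in>{..n}. {\<omega> \<in> space M. sol y (real i) \<omega> < x}) \<in> sets (F (ennreal (real n)))"
      "(\<Inter>i\<in>{..n}. {\<omega> \<in> space M. x < sol y (real i) \<omega>}) \<in> sets (F (ennreal (real n)))"
      by (intro sets.finite_INT; simp add: space_F)+
    moreover have "(\<Inter>i\<in>{..n}. {\<omega> \<in> space M. sol y (real i) \<omega> < x}) = {\<omega> \<in> space M. \<forall>i\<le>n. sol y (real i) \<omega> < x}"
      "(\<Inter>i\<in>{..n}. {\<omega> \<in> space M. x < sol y (real i) \<omega>}) = {\<omega> \<in> space M. \<forall>i\<le>n. x < sol y (real i) \<omega>}" by auto
    ultimately show "{\<omega> \<in> space M. \<forall>i\<le>n. sol y (real i) \<omega> < x} \<in> sets (F (ennreal (real n)))"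
      "{\<omega> \<in> space M. \<forall>i\<le>n. x < sol y (real i) \<omega>} \<in> sets (F (ennreal (real n)))" by (simp_all only:)
  qed
  have "unhit x y n = {\<omega> \<in> space M. \<forall>i\<le>n. sol y (real i) \<omega> < x} \<union> {\<omega> \<in> space M. \<forall>i\<le>n. x < sol y (real i) \<omega>}"
    unfolding unhit_def one_sided_def by blast
  then show "unhit x y n \<in> sets (F (ennreal (real n)))" using sets.Un[OF 1] by (simp only:)
  have "{\<omega> \<in> space (F (ennreal (real n))). \<bar>sol y (real n) \<omega>\<bar> \<le> R} \<in> sets (F (ennreal (real n)))"
    by (intro borel_measurable_le borel_measurable_abs borel_measurable_const m order_refl)
  then have 2: "{\<omega> \<in> space M. \<bar>sol y (real n) \<omega>\<bar> \<le> R} \<in> sets (F (ennreal (real n)))" by (simp only: space_F)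
  show "{\<omega> \<in> space M. (\<forall>i\<le>n. sol y (real i) \<omega> < x) \<and> \<bar>sol y (real n) \<omega>\<bar> \<le> R} \<in> sets (F (ennreal (real n)))"
    using sets.Int[OF 1(1) 2] unfolding Int_def by (rule back_subst[of "\<lambda>A. A \<in> _"]) auto
  show "{\<omega> \<in> space M. (\<forall>i\<le>n. x < sol y (real i) \<omega>) \<and> \<bar>sol y (real n) \<omega>\<bar> \<le> R} \<in> sets (F (ennreal (real n)))"
    using sets.Int[OF 1(2) 2] unfolding Int_def by (rule back_subst[of "\<lambda>A. A \<in> _"]) auto
qed

lemma unhit_events: "unhit x y n \<in> events"
  using unhit_sets(1) F_sub by blast

lemma unhit_Suc_subset: "unhit x y (Suc n) \<subseteq> unhit x y n"
  unfolding unhit_def using one_sided_antimono[of x "Suc n" _ n] by auto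

text \<open>From a bounded region, a single large increment of the noise carries the path across \<open>x\<close>
  within unit time, because the drift moves it by at most \<open>C\<close>.\<close>

lemma unhit_decay:
  obtains p where "0 < p" "\<And>n. p * prob (unhit x y n \<inter> {\<omega> \<in> space M. \<bar>sol y (real n) \<omega>\<bar> \<le> R})
    \<le> prob (unhit x y n) - prob (unhit x y (Suc n))"
proof -
  \<comment> \<open>Chosen so that \<open>\<sigma> * u = R + C + \<bar>x\<bar>\<close>: starting in
    \<open>[-R, R]\<close> and losing at most \<open>C\<close> to the drift, an increment of at
    least \<open>u\<close> ends at or above \<open>\<bar>x\<bar>\<close>, and one of at most
    \<open>-u\<close> ends at or below \<open>- \<bar>x\<bar>\<close>.\<close>
  define u where "u = (R + C + \<bar>x\<bar>) / \<sigma>"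
  \<comment> \<open>The path may lie on either side of \<open>x\<close>, so the smaller of the two
    crossing probabilities is taken.\<close>
  define p where "p = min (measure (gauss 1) {u..}) (measure (gauss 1) {..-u})"
  have "0 < p" unfolding p_def using gauss_positive[of 1] emeasure_lborel_atLeast by simp
  moreover have "p * prob (unhit x y n \<inter> {\<omega> \<in> space M. \<bar>sol y (real n) \<omega>\<bar> \<le> R})
    \<le> prob (unhit x y n) - prob (unhit x y (Suc n))" for n
  proof -
    define A where "A = {\<omega> \<in> space M. (\<forall>i\<le>n. sol y (real i) \<omega> < x) \<and> \<bar>sol y (real n) \<omega>\<bar> \<le> R}"
    define B where "B = {\<omega> \<in> space M. (\<forall>i\<le>n. x < sol y (real i) \<omega>) \<and> \<bar>sol y (real n) \<omega>\<bar> \<le> R}"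
    define A' where "A' = A \<inter> {\<omega> \<in> space M. W (real n + 1) \<omega> - W (real n) \<omega> \<in> {u..}}"
    define B' where "B' = B \<inter> {\<omega> \<in> space M. W (real n + 1) \<omega> - W (real n) \<omega> \<in> {..-u}}"
    have AB: "A \<in> sets (F (ennreal (real n)))" "B \<in> sets (F (ennreal (real n)))"
      unfolding A_def B_def by (rule unhit_sets)+
    then have ABe: "A \<in> events" "B \<in> events" using F_sub by blast+
    have "(\<lambda>\<omega>. W (real n + 1) \<omega> - W (real n) \<omega>) \<in> borel_measurable M"
      by (intro borel_measurable_diff F_measurable[OF adapted]) auto
    from measurable_sets[OF this, of "{u..}"] measurable_sets[OF this, of "{..-u}"]
    have "{\<omega> \<in> space M. W (real n + 1) \<omega> - W (real n) \<omega> \<in> {u..}} \<in> events"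
      "{\<omega> \<in> space M. W (real n + 1) \<omega> - W (real n) \<omega> \<in> {..-u}} \<in> events"
      by (simp_all add: vimage_def Int_def conj_commute)
    then have A'B'e: "A' \<in> events" "B' \<in> events" unfolding A'_def B'_def using ABe by auto
    have pA: "prob A' = prob A * measure (gauss 1) {u..}" and pB: "prob B' = prob B * measure (gauss 1) {..-u}"
      unfolding A'_def B'_def
      using increment[OF _ _ AB(1), of "real n + 1" "{u..}"] increment[OF _ _ AB(2), of "real n + 1" "{..-u}"] by auto
    have disj: "A \<inter> B = {}" unfolding A_def B_def by auto (metis order.asym order_refl)
    have su: "\<sigma> * u = R + C + \<bar>x\<bar>" using \<sigma>_pos by (simp add: u_def)
    have sub: "A' \<union> B' \<subseteq> unhit x y n - unhit x y (Suc n)"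
    proof
      fix \<omega> assume w: "\<omega> \<in> A' \<union> B'"
      have dev: "\<bar>sol y (real (Suc n)) \<omega> - sol y (real n) \<omega> - \<sigma> * (W (real n + 1) \<omega> - W (real n) \<omega>)\<bar> \<le> C"
        using sol_deviation[of "real n" 1 y \<omega>] by (simp add: add.commute)
      from w show "\<omega> \<in> unhit x y n - unhit x y (Suc n)"
      proof
        assume "\<omega> \<in> A'"
        then have a: "\<omega> \<in> space M" "\<forall>i\<le>n. sol y (real i) \<omega> < x" "\<bar>sol y (real n) \<omega>\<bar> \<le> R"
          "u \<le> W (real n + 1) \<omega> - W (real n) \<omega>" by (auto simp: A'_def A_def)
        have "\<sigma> * u \<le> \<sigma> * (W (real n + 1) \<omega> - W (real n) \<omega>)" using a(4) \<sigma>_pos by (intro mult_left_mono) auto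
        then have "x \<le> sol y (real (Suc n)) \<omega>" using dev a(3) su by linarith
        then have "\<not> one_sided x (Suc n) (\<lambda>t. sol y t \<omega>)"
          unfolding one_sided_def using a(2) by (metis le_SucI not_less order_refl order.asym)
        then show ?thesis using a by (auto simp: unhit_def one_sided_def)
      next
        assume "\<omega> \<in> B'"
        then have a: "\<omega> \<in> space M" "\<forall>i\<le>n. x < sol y (real i) \<omega>" "\<bar>sol y (real n) \<omega>\<bar> \<le> R"
          "W (real n + 1) \<omega> - W (real n) \<omega> \<le> - u" by (auto simp: B'_def B_def)
        have "\<sigma> * (W (real n + 1) \<omega> - W (real n) \<omega>) \<le> \<sigma> * (- u)" using a(4) \<sigma>_pos by (intro mult_left_mono) auto
        then have "sol y (real (Suc n)) \<omega> \<le> x" using dev a(3) su by linarith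
        then have "\<not> one_sided x (Suc n) (\<lambda>t. sol y t \<omega>)"
          unfolding one_sided_def using a(2) by (metis le_SucI not_less order_refl order.asym)
        then show ?thesis using a by (auto simp: unhit_def one_sided_def)
      qed
    qed
    have "unhit x y n \<inter> {\<omega> \<in> space M. \<bar>sol y (real n) \<omega>\<bar> \<le> R} = A \<union> B"
      unfolding unhit_def one_sided_def A_def B_def by blast
    then have "p * prob (unhit x y n \<inter> {\<omega> \<in> space M. \<bar>sol y (real n) \<omega>\<bar> \<le> R}) = p * prob A + p * prob B"
      using finite_measure_Union[OF ABe disj] by (simp add: distrib_left)
    also have "\<dots> \<le> measure (gauss 1) {u..} * prob A + measure (gauss 1) {..-u} * prob B"
      unfolding p_def by (intro add_mono mult_right_mono) auto
    also have "\<dots> = prob (A' \<union> B')"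
    proof -
      have "A' \<inter> B' = {}" using disj by (auto simp: A'_def B'_def)
      then show ?thesis using finite_measure_Union[OF A'B'e] pA pB by (simp add: mult.commute)
    qed
    also have "\<dots> \<le> prob (unhit x y n - unhit x y (Suc n))"
      using sub unhit_events by (intro finite_measure_mono) auto
    also have "\<dots> = prob (unhit x y n) - prob (unhit x y (Suc n))"
      using unhit_events unhit_Suc_subset by (intro finite_measure_Diff) auto
    finally show ?thesis .
  qed
  ultimately show ?thesis using that by blast
qed

text \<open>Far out, the decrease of the mean square pays for the probability of being unhit; within
  \<open>[-R, R]\<close> the loss of unhit probability in the next step pays. Both payments
  telescope, the first to at most \<open>w 0\<close>, the second to at most
  \<open>(K + 1) / p\<close>.\<close>

lemma summable_unhit: "summable (\<lambda>n. prob (unhit x y n))"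
proof -
  define K where "K = max 0 lyapunov_const"
  \<comment> \<open>Then \<open>2 * c * R = K + 1\<close>: beyond \<open>R\<close> the Lyapunov
    decrease exceeds the constant \<open>K\<close> by at least 1. The maximum with 0 in
    \<open>K\<close> keeps \<open>R\<close> positive.\<close>
  define R where "R = (K + 1) / (2 * c)"
  obtain p where p: "0 < p" "\<And>n. p * prob (unhit x y n \<inter> {\<omega> \<in> space M. \<bar>sol y (real n) \<omega>\<bar> \<le> R})
    \<le> prob (unhit x y n) - prob (unhit x y (Suc n))" using unhit_decay by blast
  define q where "q n = prob (unhit x y n \<inter> {\<omega> \<in> space M. \<bar>sol y (real n) \<omega>\<bar> \<le> R})" for n
  define w where "w n = (\<integral>\<omega>. indicator (unhit x y n) \<omega> * (sol y (real n) \<omega>)\<^sup>2 \<partial>M)" for n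
  have w_nonneg: "0 \<le> w n" for n unfolding w_def by (intro integral_nonneg_AE) auto
  have step: "prob (unhit x y n) \<le> w n - w (Suc n) + (K + 1) * q n" for n
  proof -
    define H where "H = unhit x y n \<inter> {\<omega> \<in> space M. \<bar>sol y (real n) \<omega>\<bar> \<le> R}"
    have Um[measurable]: "unhit x y m \<in> events" for m by (rule unhit_events)
    have sm[measurable]: "sol y (real m) \<in> borel_measurable M" for m by (rule F_measurable[OF sol_adapted]) simp
    have H: "H \<in> events" unfolding H_def by measurable
    have ind: "integrable M (\<lambda>\<omega>. indicator (unhit x y m) \<omega> * f \<omega>)" if "integrable M f" for f :: "'a \<Rightarrow> real" and m
      using integrable_mult_indicator[OF unhit_events that] by simp
    have "w (Suc n) \<le> (\<integral>\<omega>. indicator (unhit x y n) \<omega> * (sol y (real n + 1) \<omega>)\<^sup>2 \<partial>M)"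
      unfolding w_def
    proof (rule integral_mono)
      show "indicator (unhit x y (Suc n)) \<omega> * (sol y (real (Suc n)) \<omega>)\<^sup>2
        \<le> indicator (unhit x y n) \<omega> * (sol y (real n + 1) \<omega>)\<^sup>2" for \<omega>
        using unhit_Suc_subset[of x y n] by (auto simp: indicator_def add.commute)
    qed (intro ind sol_square_integrable; simp)+
    also have "\<dots> \<le> w n - 2 * c * (\<integral>\<omega>. indicator (unhit x y n) \<omega> * \<bar>sol y (real n) \<omega>\<bar> \<partial>M)
        + lyapunov_const * prob (unhit x y n)"
      unfolding w_def by (rule lyapunov_integral[OF _ unhit_sets(1)]) simp
    also have "\<dots> \<le> w n - 2 * c * (\<integral>\<omega>. indicator (unhit x y n) \<omega> * \<bar>sol y (real n) \<omega>\<bar> \<partial>M) + K * prob (unhit x y n)"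
      unfolding K_def by (intro add_left_mono mult_right_mono) auto
    finally have 1: "w (Suc n) \<le> w n - 2 * c * (\<integral>\<omega>. indicator (unhit x y n) \<omega> * \<bar>sol y (real n) \<omega>\<bar> \<partial>M) + K * prob (unhit x y n)" .
    \<comment> \<open>Pointwise, \<open>2 * c * \<bar>sol\<bar>\<close> is at least
      \<open>K + 1\<close> on the unhit event outside \<open>H\<close> and nonnegative on
      \<open>H\<close>. The surplus 1 over \<open>K\<close> leaves \<open>prob (unhit x y n)\<close>
      on the left of \<open>step\<close>.\<close>
    have "(K + 1) * prob (unhit x y n) - (K + 1) * q n
        = (\<integral>\<omega>. (K + 1) * indicator (unhit x y n) \<omega> - (K + 1) * indicator H \<omega> \<partial>M)"
      using integrable_event[OF H] integrable_event[OF Um[of n]] sets.sets_into_space[OF H] sets.sets_into_space[OF Um[of n]]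
      by (simp add: q_def H_def[symmetric] Int_absorb2)
    also have "\<dots> \<le> (\<integral>\<omega>. 2 * c * (indicator (unhit x y n) \<omega> * \<bar>sol y (real n) \<omega>\<bar>) \<partial>M)"
    proof (rule integral_mono)
      show "integrable M (\<lambda>\<omega>. (K + 1) * indicator (unhit x y n) \<omega> - (K + 1) * indicator H \<omega>)"
        by (intro Bochner_Integration.integrable_diff integrable_mult_right integrable_event H Um)
      show "integrable M (\<lambda>\<omega>. 2 * c * (indicator (unhit x y n) \<omega> * \<bar>sol y (real n) \<omega>\<bar>))"
        by (intro integrable_mult_right ind integrable_abs sol_integrable) simp
      fix \<omega> assume sp: "\<omega> \<in> space M"
      consider "\<omega> \<notin> unhit x y n" | "\<omega> \<in> H" | "\<omega> \<in> unhit x y n" "R < \<bar>sol y (real n) \<omega>\<bar>"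
        using sp unfolding H_def by fastforce
      then show "(K + 1) * indicator (unhit x y n) \<omega> - (K + 1) * indicator H \<omega>
        \<le> 2 * c * (indicator (unhit x y n) \<omega> * \<bar>sol y (real n) \<omega>\<bar>)"
      proof cases
        case 3
        then have "2 * c * R \<le> 2 * c * \<bar>sol y (real n) \<omega>\<bar>" using c_pos by (intro mult_left_mono) auto
        then show ?thesis using 3 c_pos by (simp add: H_def R_def)
      qed (use c_pos in \<open>auto simp: H_def\<close>)
    qed
    also have "\<dots> = 2 * c * (\<integral>\<omega>. indicator (unhit x y n) \<omega> * \<bar>sol y (real n) \<omega>\<bar> \<partial>M)" by simp
    finally show ?thesis using 1 by (simp add: algebra_simps)
  qed
  have "(\<Sum>n<m. prob (unhit x y n)) \<le> w 0 + (K + 1) / p" for m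
  proof -
    have "(\<Sum>n<m. prob (unhit x y n)) \<le> (\<Sum>n<m. (w n - w (Suc n)) + (K + 1) / p * (prob (unhit x y n) - prob (unhit x y (Suc n))))"
    proof (rule sum_mono)
      fix n
      have "(K + 1) * q n = (K + 1) / p * (p * q n)" using p(1) by simp
      also have "\<dots> \<le> (K + 1) / p * (prob (unhit x y n) - prob (unhit x y (Suc n)))"
        using p by (intro mult_left_mono) (auto simp: q_def K_def)
      finally show "prob (unhit x y n) \<le> (w n - w (Suc n)) + (K + 1) / p * (prob (unhit x y n) - prob (unhit x y (Suc n)))"
        using step[of n] by linarith
    qed
    also have "\<dots> = (w 0 - w m) + (K + 1) / p * (prob (unhit x y 0) - prob (unhit x y m))"
      by (simp only: sum.distrib sum_distrib_left[symmetric] sum_lessThan_telescope'[of w] sum_lessThan_telescope'[of "\<lambda>n. prob (unhit x y n)"])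
    also have "\<dots> \<le> w 0 + (K + 1) / p * 1"
    proof -
      have "prob (unhit x y 0) - prob (unhit x y m) \<le> 1"
        using prob_le_1[of "unhit x y 0"] measure_nonneg[of M "unhit x y m"] by linarith
      then have "(K + 1) / p * (prob (unhit x y 0) - prob (unhit x y m)) \<le> (K + 1) / p * 1"
        using p(1) by (intro mult_left_mono) (auto simp: K_def)
      then show ?thesis using w_nonneg[of m] by linarith
    qed
    finally show ?thesis by simp
  qed
  then show ?thesis by (intro summableI_nonneg_bounded) auto
qed

lemma nn_integral_hitting_time_sol:
  assumes sp: "sample_path (sol y) \<in> measurable M path_borel"
  shows "(\<integral>\<^sup>+w. hitting_time x w \<partial>distr M path_borel (sample_path (sol y))) < \<infinity>"
proof -
  have m: "{w \<in> space path_borel. one_sided x n w} \<in> sets path_borel" for n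
  proof -
    have [measurable]: "(\<lambda>w. w (real i)) \<in> borel_measurable path_borel" for i by (rule measurable_path_eval) simp
    show ?thesis unfolding one_sided_def by measurable
  qed
  have "(\<integral>\<^sup>+w. hitting_time x w \<partial>distr M path_borel (sample_path (sol y)))
      \<le> (\<integral>\<^sup>+w. (\<Sum>n. indicator {w \<in> space path_borel. one_sided x n w} w) \<partial>distr M path_borel (sample_path (sol y)))"
  \<comment> \<open>The comparison is pointwise; measurability enters only for the dominating
    series.\<close>
  proof (rule nn_integral_mono)
    fix w assume "w \<in> space (distr M path_borel (sample_path (sol y)))"
    then have w: "w \<in> space path_borel" by simp
    then have "continuous_on {0..} w" using path_carrier_continuous_on by (simp add: space_path_borel)
    from hitting_time_le_suminf[OF this, of x]
    show "hitting_time x w \<le> (\<Sum>n. indicator {w \<in> space path_borel. one_sided x n w} w)"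
      using w by (simp add: indicator_def)
  qed
  also have "\<dots> = (\<Sum>n. (\<integral>\<^sup>+w. indicator {w \<in> space path_borel. one_sided x n w} w \<partial>distr M path_borel (sample_path (sol y))))"
    using m by (intro nn_integral_suminf) auto
  also have "\<dots> = (\<Sum>n. ennreal (prob (unhit x y n)))"
  proof (rule suminf_cong)
    fix n
    have "(\<integral>\<^sup>+w. indicator {w \<in> space path_borel. one_sided x n w} w \<partial>distr M path_borel (sample_path (sol y)))
        = emeasure M (sample_path (sol y) -` {w \<in> space path_borel. one_sided x n w} \<inter> space M)"
      using m sp by (simp add: emeasure_distr)
    also have "sample_path (sol y) -` {w \<in> space path_borel. one_sided x n w} \<inter> space M = unhit x y n"
      using measurable_space[OF sp] by (auto simp: unhit_def one_sided_def sample_path_def)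
    finally show "(\<integral>\<^sup>+w. indicator {w \<in> space path_borel. one_sided x n w} w \<partial>distr M path_borel (sample_path (sol y)))
        = ennreal (prob (unhit x y n))" by (simp add: emeasure_eq_measure)
  qed
  also have "\<dots> = ennreal (\<Sum>n. prob (unhit x y n))"
    by (rule suminf_ennreal2[OF _ summable_unhit]) simp
  also have "\<dots> < \<infinity>" by simp
  finally show ?thesis .
qed

end

section \<open>Regeneration\<close>

text \<open>\<open>W\<close> is \<open>B\<close> off a measurable null set and 0 on it. By the usual
  conditions this null set belongs to \<open>F 0\<close>, so the modification stays adapted, and
  changing \<open>B\<close> on it does not affect the probabilities of increments.\<close>

lemma brownian_modification:
  assumes "prob_space M" and uc: "usual_conditions M F" and bm: "brownian_motion M F B"
  obtains W where "brownian M F W" "AE \<omega> in M. \<forall>t\<ge>0. W t \<omega> = B t \<omega>"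
proof -
  interpret prob_space M by fact
  have filt: "filtration (space M) F" and subalg: "\<And>t. subalgebra M (F t)" and null: "null_sets M \<subseteq> sets (F 0)"
    using uc unfolding usual_conditions_def by blast+
  interpret filtration "space M" F by (rule filt)
  have ad: "\<And>t. 0 \<le> t \<Longrightarrow> B t \<in> borel_measurable (F (ennreal t))"
    and AE: "AE \<omega> in M. B 0 \<omega> = 0" "AE \<omega> in M. continuous_on {0..} (\<lambda>t. B t \<omega>)"
    and dist: "\<And>s t. 0 \<le> s \<Longrightarrow> s < t \<Longrightarrow> distributed M lborel (\<lambda>\<omega>. B t \<omega> - B s \<omega>) (normal_density 0 (sqrt (t - s)))"
    and ind: "\<And>s t. 0 \<le> s \<Longrightarrow> s < t \<Longrightarrow> indep_set (sets (F (ennreal s)))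
          (sets (vimage_algebra (space M) (\<lambda>\<omega>. B t \<omega> - B s \<omega>) borel))"
    using bm unfolding brownian_motion_def adapted_def by blast+
  have "AE \<omega> in M. B 0 \<omega> = 0 \<and> continuous_on {0..} (\<lambda>t. B t \<omega>)" using AE by eventually_elim auto
  then obtain N where N: "{\<omega> \<in> space M. \<not> (B 0 \<omega> = 0 \<and> continuous_on {0..} (\<lambda>t. B t \<omega>))} \<subseteq> N"
    "emeasure M N = 0" "N \<in> events" by (rule AE_E)
  then have Nn: "N \<in> null_sets M" by auto
  \<comment> \<open>The default 0 also covers points outside \<open>space M\<close>, because the
    locale demands continuity at every point of the type.\<close>
  define W where "W t \<omega> = (if \<omega> \<in> space M - N then B t \<omega> else 0)" for t \<omega>
  have WB: "AE \<omega> in M. \<forall>t. W t \<omega> = B t \<omega>"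
    using AE_not_in[OF Nn] AE_space by eventually_elim (auto simp: W_def)
  have Wad: "W t \<in> borel_measurable (F (ennreal t))" if "0 \<le> t" for t
  proof -
    have "N \<in> sets (F (ennreal t))" using null Nn sets_F_mono[of 0 "ennreal t"] by auto
    then have "space M - N \<in> sets (F (ennreal t))"
      using sets.compl_sets[of N "F (ennreal t)"] by (simp only: space_F)
    then show ?thesis unfolding W_def
      by (intro measurable_If_set ad that borel_measurable_const) (simp only: space_F, metis Diff_subset Int_absorb2)
  qed
  have "brownian M F W"
  proof (intro brownian.intro brownian_axioms.intro)
    show "continuous_on {0..} (\<lambda>t. W t \<omega>)" "W 0 \<omega> = 0" for \<omega>
    proof -
      have *: "B 0 \<omega> = 0 \<and> continuous_on {0..} (\<lambda>t. B t \<omega>)" if "\<omega> \<in> space M - N"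
        using N(1) that by blast
      then show "W 0 \<omega> = 0" unfolding W_def by presburger
      show "continuous_on {0..} (\<lambda>t. W t \<omega>)"
      proof (cases "\<omega> \<in> space M - N")
        case True
        then have "(\<lambda>t. W t \<omega>) = (\<lambda>t. B t \<omega>)" unfolding W_def by presburger
        then show ?thesis using *[OF True] by (simp only:)
      next
        case False
        then have "(\<lambda>t. W t \<omega>) = (\<lambda>t. 0)" unfolding W_def by presburger
        then show ?thesis by (simp only: continuous_on_const)
      qed
    qed
    fix s t :: real and G A assume st: "0 \<le> s" "s < t" and G: "G \<in> sets (F (ennreal s))" and A: "A \<in> sets (borel :: real measure)"
    have Ge: "G \<in> events" using G subalg[of "ennreal s"] unfolding subalgebra_def by blast
    have mB: "B r \<in> borel_measurable M" if "0 \<le> r" for r using measurable_from_subalg[OF subalg ad[OF that]] .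
    have mW: "W r \<in> borel_measurable M" if "0 \<le> r" for r using measurable_from_subalg[OF subalg Wad[OF that]] .
    have D: "{\<omega> \<in> space M. Z t \<omega> - Z s \<omega> \<in> A} \<in> events"
      if "\<And>r. 0 \<le> r \<Longrightarrow> Z r \<in> borel_measurable M" for Z :: "real \<Rightarrow> 'a \<Rightarrow> real"
    proof -
      have "(\<lambda>\<omega>. Z t \<omega> - Z s \<omega>) \<in> borel_measurable M" using st that by (intro borel_measurable_diff) auto
      from measurable_sets[OF this A] show ?thesis by (simp add: vimage_def Int_def conj_commute)
    qed
    have "prob (G \<inter> {\<omega> \<in> space M. W t \<omega> - W s \<omega> \<in> A}) = prob (G \<inter> {\<omega> \<in> space M. B t \<omega> - B s \<omega> \<in> A})"
    proof (rule measure_eq_AE)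
      show "AE \<omega> in M. \<omega> \<in> G \<inter> {\<omega> \<in> space M. W t \<omega> - W s \<omega> \<in> A} \<longleftrightarrow> \<omega> \<in> G \<inter> {\<omega> \<in> space M. B t \<omega> - B s \<omega> \<in> A}"
        using WB by eventually_elim auto
    qed (intro sets.Int Ge D mW mB; assumption)+
    also have "\<dots> = prob G * prob {\<omega> \<in> space M. B t \<omega> - B s \<omega> \<in> A}"
    proof (rule indep_setD[OF ind[OF st] G])
      have "(\<lambda>\<omega>. B t \<omega> - B s \<omega>) -` A \<inter> space M \<in> sets (vimage_algebra (space M) (\<lambda>\<omega>. B t \<omega> - B s \<omega>) borel)"
        using A by (rule in_vimage_algebra)
      then show "{\<omega> \<in> space M. B t \<omega> - B s \<omega> \<in> A} \<in> sets (vimage_algebra (space M) (\<lambda>\<omega>. B t \<omega> - B s \<omega>) borel)"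
        by (simp add: vimage_def Int_def conj_commute)
    qed
    also have "prob {\<omega> \<in> space M. B t \<omega> - B s \<omega> \<in> A} = measure (distr M lborel (\<lambda>\<omega>. B t \<omega> - B s \<omega>)) A"
      using A st mB by (subst measure_distr) (auto simp: vimage_def Int_def conj_commute)
    also have "distr M lborel (\<lambda>\<omega>. B t \<omega> - B s \<omega>) = gauss (t - s)"
      using dist[OF st] by (rule distributed_distr_eq_density)
    finally show "prob (G \<inter> {\<omega> \<in> space M. W t \<omega> - W s \<omega> \<in> A}) = prob G * measure (gauss (t - s)) A" .
  qed (use filt subalg Wad prob_space_axioms in auto)
  moreover have "AE \<omega> in M. \<forall>t\<ge>0. W t \<omega> = B t \<omega>" using WB by eventually_elim auto
  ultimately show ?thesis using that by blast
qed

lemma (in lipschitz_drift) flow_cong: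
  assumes u: "continuous_on {0..} u" and eq: "\<And>s. 0 \<le> s \<Longrightarrow> u s = u' s" and t: "0 \<le> t"
  shows "flow \<beta> u t = flow \<beta> u' t"
proof -
  have u': "continuous_on {0..} u'" using u eq continuous_on_cong[of "{0..}" "{0..}" u u'] by auto
  have "integral_solution \<beta> u' (flow \<beta> u)" using flow_solution[OF u] integral_solution_cong[of u u'] eq by blast
  then show ?thesis using flow_unique[OF u'] t by blast
qed

section \<open>Measurability at a stopping time\<close>

context brownian
begin

lemma process_measurable_at:
  assumes ad: "\<And>t. 0 \<le> t \<Longrightarrow> X t \<in> borel_measurable (F (ennreal t))"
    and c: "\<And>\<omega>. \<omega> \<in> space M \<Longrightarrow> continuous_on {0..} (\<lambda>t. X t \<omega>)"
    and T: "T \<in> borel_measurable M" "\<And>\<omega>. \<omega> \<in> space M \<Longrightarrow> 0 \<le> T \<omega>"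
  shows "(\<lambda>\<omega>. X (T \<omega>) \<omega> :: real) \<in> borel_measurable M"
proof (rule measurable_process_at[where S="{0..}" and Z=X])
  show "X s \<in> borel_measurable M" if "s \<in> {0..}" for s
    by (rule F_measurable[OF ad]) (use that in simp)
qed (use c T in auto)

lemma measurable_sample_path:
  assumes ad: "\<And>t. 0 \<le> t \<Longrightarrow> X t \<in> borel_measurable (F (ennreal t))"
    and c: "\<And>\<omega>. \<omega> \<in> space M \<Longrightarrow> continuous_on {0..} (\<lambda>t. X t \<omega>)"
  shows "sample_path X \<in> measurable M path_borel"
proof (rule measurable_path_borel)
  fix \<omega> assume "\<omega> \<in> space M"
  then have "continuous_on {0..} (sample_path X \<omega>)"
    using c continuous_on_cong[of "{0..}" "{0..}" "sample_path X \<omega>" "\<lambda>t. X t \<omega>"] by (simp add: sample_path_def)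
  then show "sample_path X \<omega> \<in> path_carrier" by (auto simp: path_carrier_def sample_path_def)
next
  fix t :: real assume t: "0 \<le> t"
  then show "(\<lambda>\<omega>. sample_path X \<omega> t) \<in> borel_measurable M"
    using F_measurable[OF ad[OF t]] by (simp add: sample_path_def)
qed

text \<open>Where \<tau> is infinite, \<open>enn2real\<close> returns 0 and the path is not shifted
  at all; the map is therefore defined, with continuous values, on the whole space.\<close>

lemma measurable_shifted_path:
  assumes ad: "\<And>t. 0 \<le> t \<Longrightarrow> X t \<in> borel_measurable (F (ennreal t))"
    and c: "\<And>\<omega>. \<omega> \<in> space M \<Longrightarrow> continuous_on {0..} (\<lambda>t. X t \<omega>)"
    and \<tau>: "stopping_time F \<tau>"
  shows "shifted_path X \<tau> \<in> measurable M path_borel"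
proof (rule measurable_path_borel)
  fix \<omega> assume w: "\<omega> \<in> space M"
  have "continuous_on {0..} (\<lambda>t. X (enn2real (\<tau> \<omega>) + t) \<omega>)"
    by (intro continuous_on_compose2[OF c[OF w]]) (auto intro!: continuous_intros)
  then have "continuous_on {0..} (shifted_path X \<tau> \<omega>)"
    using continuous_on_cong[of "{0..}" "{0..}" "shifted_path X \<tau> \<omega>" "\<lambda>t. X (enn2real (\<tau> \<omega>) + t) \<omega>"]
    by (simp add: shifted_path_def)
  then show "shifted_path X \<tau> \<omega> \<in> path_carrier" by (auto simp: path_carrier_def shifted_path_def)
next
  fix t :: real assume t: "0 \<le> t"
  note [measurable] = stopping_time_measurable[OF \<tau>]
  have "(\<lambda>\<omega>. X (enn2real (\<tau> \<omega>) + t) \<omega>) \<in> borel_measurable M"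
    by (rule process_measurable_at[OF ad c]) (use t in auto)
  then show "(\<lambda>\<omega>. shifted_path X \<tau> \<omega> t) \<in> borel_measurable M"
    using t by (simp add: shifted_path_def)
qed

text \<open>The position at \<tau> is known at \<tau> because a continuous adapted process is
  progressively measurable. This allows the event to be combined with any other event of the
  past.\<close>

lemma hitting_event_pre_sigma:
  assumes ad: "\<And>t. 0 \<le> t \<Longrightarrow> X t \<in> borel_measurable (F (ennreal t))"
    and c: "\<And>\<omega>. \<omega> \<in> space M \<Longrightarrow> continuous_on {0..} (\<lambda>t. X t \<omega>)"
    and \<tau>: "stopping_time F \<tau>"
  shows "{\<omega> \<in> space M. \<tau> \<omega> < \<infinity> \<and> X (enn2real (\<tau> \<omega>)) \<omega> = (x :: real)} \<in> sets (pre_sigma \<tau>)"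
    (is "?H \<in> _")
proof (rule sets_pre_sigmaI[OF \<tau>])
  have fin: "{\<omega> \<in> ?H. \<tau> \<omega> \<le> ennreal r} \<in> sets (F (ennreal r))" if r: "0 \<le> r" for r
  proof -
    \<comment> \<open>Stopped at \<open>r\<close>, the time is measurable with respect to
      \<open>F r\<close> and stays in \<open>{0..r}\<close>, so only values of \<open>X\<close> up
      to \<open>r\<close> are read; on \<open>\<tau> \<le> r\<close> nothing has changed.\<close>
    define T where "T \<omega> = min (\<tau> \<omega>) (ennreal r)" for \<omega>
    have T: "T \<in> borel_measurable (F (ennreal r))"
    proof (rule borel_measurableI_le)
      fix s
      show "{\<omega> \<in> space (F (ennreal r)). T \<omega> \<le> s} \<in> sets (F (ennreal r))"
      proof (cases "ennreal r \<le> s")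
        case True
        then have "{\<omega> \<in> space (F (ennreal r)). T \<omega> \<le> s} = space (F (ennreal r))" by (auto simp: T_def min_le_iff_disj)
        then show ?thesis by (simp only: sets.top)
      next
        case False
        then have "{\<omega> \<in> space (F (ennreal r)). T \<omega> \<le> s} = {\<omega> \<in> space (F (ennreal r)). \<tau> \<omega> \<le> s}"
          by (auto simp: T_def min_le_iff_disj)
        moreover have "s \<le> ennreal r" using False by simp
        ultimately show ?thesis using predE[OF stopping_time_le_const[OF \<tau>]] by (simp only:)
      qed
    qed
    have T_le: "enn2real (T \<omega>) \<le> r" for \<omega>
      using enn2real_mono[of "T \<omega>" "ennreal r"] r by (simp add: T_def)
    have X: "(\<lambda>\<omega>. X (enn2real (T \<omega>)) \<omega>) \<in> borel_measurable (F (ennreal r))"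
    proof (rule measurable_process_at[where S="{0..r}" and Z=X])
      show "X s \<in> borel_measurable (F (ennreal r))" if "s \<in> {0..r}" for s
        by (rule F_measurable_mono[OF _ ad]) (use that in \<open>auto intro: ennreal_leI\<close>)
      show "(\<lambda>\<omega>. enn2real (T \<omega>)) \<in> borel_measurable (F (ennreal r))" using T by (rule borel_measurable_enn2real)
      show "continuous_on {0..r} (\<lambda>s. X s \<omega>)" if "\<omega> \<in> space (F (ennreal r))" for \<omega>
        using c[of \<omega>] that by (auto simp: space_F intro: continuous_on_subset)
    qed (use T_le in auto)
    have "{\<omega> \<in> ?H. \<tau> \<omega> \<le> ennreal r} = {\<omega> \<in> space (F (ennreal r)). \<tau> \<omega> \<le> ennreal r}
        \<inter> {\<omega> \<in> space (F (ennreal r)). X (enn2real (T \<omega>)) \<omega> = x}"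
      by (auto simp: space_F T_def min_absorb1 intro: le_less_trans)
    also have "\<dots> \<in> sets (F (ennreal r))"
      by (intro sets.Int predE[OF stopping_time_le_const[OF \<tau>]] order_refl
          measurable_equality_set[OF X borel_measurable_const])
    finally show ?thesis .
  qed
  show "{\<omega> \<in> ?H. \<tau> \<omega> \<le> t} \<in> sets (F t)" for t
  proof (cases t)
    case (real r)
    then show ?thesis using fin[of r] by simp
  next
    \<comment> \<open>The index \<open>\<infinity>\<close> must be checked as well; since \<tau> is
      finite on the event, this case is a countable union of finite ones.\<close>
    case top
    have "\<exists>n::nat. \<tau> \<omega> \<le> ennreal (real n)" if "\<tau> \<omega> < \<infinity>" for \<omega>
      using ennreal_Ex_less_of_nat[of "\<tau> \<omega>"] that by (auto simp: ennreal_of_nat_eq_real_of_nat intro: less_imp_le)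
    then have "{\<omega> \<in> ?H. \<tau> \<omega> \<le> t} = (\<Union>n::nat. {\<omega> \<in> ?H. \<tau> \<omega> \<le> ennreal (real n)})"
      using top by auto
    moreover have "{\<omega> \<in> ?H. \<tau> \<omega> \<le> ennreal (real n)} \<in> sets (F t)" for n :: nat
      using fin[of "real n"] sets_F_mono[of "ennreal (real n)" t] top by auto
    then have "(\<Union>n::nat. {\<omega> \<in> ?H. \<tau> \<omega> \<le> ennreal (real n)}) \<in> sets (F t)"
      by (intro sets.countable_UN) blast
    ultimately show ?thesis by (simp only:)
  qed
qed

end

section \<open>Regeneration and the law of the solution\<close>

context diffusion
begin

lemma sample_path_sol_measurable: "sample_path (sol y) \<in> measurable M path_borel"
  using measurable_sample_path[OF sol_adapted sol_continuous] .

text \<open>On \<open>H\<close> the shifted path is a fixed measurable function of the Brownian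
  increments after \<tau>, so the event \<open>S\<close> becomes an event about these increments.
  Testing against events \<open>G\<close> of the past then reduces to \<open>strong_markov\<close>
  for \<open>G \<inter> H\<close>.\<close>

lemma process_regenerates:
  assumes ad: "\<And>t. 0 \<le> t \<Longrightarrow> X t \<in> borel_measurable (F (ennreal t))"
    and c: "\<And>\<omega>. \<omega> \<in> space M \<Longrightarrow> continuous_on {0..} (\<lambda>t. X t \<omega>)"
    and sol: "AE \<omega> in M. integral_solution \<beta> (\<lambda>t. X 0 \<omega> + \<sigma> * W t \<omega>) (\<lambda>t. X t \<omega>)"
    and P: "P x = distr M path_borel (sample_path (sol x))"
  shows "regenerative_at M F P X x"
  unfolding regenerative_at_def
proof (intro allI impI, elim conjE)
  fix \<tau> A assume \<tau>: "stopping_time F \<tau>" and A: "A \<in> sets path_borel"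
  define S where "S = {\<omega> \<in> space M. \<tau> \<omega> < \<infinity> \<and> shifted_path X \<tau> \<omega> \<in> A}"
  define H where "H = {\<omega> \<in> space M. \<tau> \<omega> < \<infinity> \<and> X (enn2real (\<tau> \<omega>)) \<omega> = x}"
  define T where "T \<omega> = enn2real (\<tau> \<omega>)" for \<omega>
  \<comment> \<open>The solution map from noise paths to solution paths started at \<open>x\<close>;
    it serves both for the law \<open>P x\<close> and for the path after \<tau>.\<close>
  define \<Psi> where "\<Psi> w = (\<lambda>t\<in>{0..}. flow \<beta> (\<lambda>s. x + \<sigma> * w s) t)" for w :: "real \<Rightarrow> real"
  define E where "E = \<Psi> -` A \<inter> space path_borel"
  have cw: "continuous_on {0..} (\<lambda>s. x + \<sigma> * w s)" if "w \<in> path_carrier" for w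
    using path_carrier_continuous_on[OF that, of "{0..}"] by (intro continuous_intros) auto
  have "\<Psi> \<in> measurable path_borel path_borel"
  proof (rule measurable_path_borel)
    fix w assume "w \<in> space path_borel"
    then have "continuous_on {0..} (flow \<beta> (\<lambda>s. x + \<sigma> * w s))"
      using flow_solution[OF cw] by (simp add: space_path_borel integral_solution_def)
    then have "continuous_on {0..} (\<Psi> w)"
      using continuous_on_cong[of "{0..}" "{0..}" "\<Psi> w" "flow \<beta> (\<lambda>s. x + \<sigma> * w s)"] by (simp add: \<Psi>_def)
    then show "\<Psi> w \<in> path_carrier" by (auto simp: path_carrier_def \<Psi>_def)
  next
    fix t :: real assume t: "0 \<le> t"
    have "(\<lambda>w. flow \<beta> (\<lambda>s. x + \<sigma> * w s) t) \<in> borel_measurable path_borel"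
      by (rule measurable_flow)
         (use t cw measurable_path_eval in \<open>auto simp: space_path_borel\<close>)
    then show "(\<lambda>w. \<Psi> w t) \<in> borel_measurable path_borel" using t by (simp add: \<Psi>_def)
  qed
  then have E: "E \<in> sets path_borel" unfolding E_def using A by (rule measurable_sets)
  have \<Psi>_sol: "sample_path (sol x) \<omega> = \<Psi> (increment_path 0 \<omega>)" for \<omega>
  proof
    fix t
    show "sample_path (sol x) \<omega> t = \<Psi> (increment_path 0 \<omega>) t"
    proof (cases "0 \<le> t")
      case True
      have "flow \<beta> (\<lambda>s. x + \<sigma> * W s \<omega>) t = flow \<beta> (\<lambda>s. x + \<sigma> * increment_path 0 \<omega> s) t"
        by (rule flow_cong[OF noise_continuous _ True]) (simp add: increment_path_def start)
      then show ?thesis using True by (simp add: sample_path_def sol_def \<Psi>_def)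
    qed (simp add: sample_path_def \<Psi>_def)
  qed
  have PA: "measure (P x) A = prob {\<omega> \<in> space M. increment_path 0 \<omega> \<in> E}"
  proof -
    have "sample_path (sol x) -` A \<inter> space M = {\<omega> \<in> space M. increment_path 0 \<omega> \<in> E}"
      using increment_path_carrier[of 0] by (auto simp: \<Psi>_sol E_def space_path_borel)
    then show ?thesis using P measure_distr[OF sample_path_sol_measurable A, of x] by simp
  qed
  have shift: "AE \<omega> in M. \<omega> \<in> H \<longrightarrow> (\<omega> \<in> S \<longleftrightarrow> increment_path (T \<omega>) \<omega> \<in> E)"
    using sol AE_space
  proof eventually_elim
    fix \<omega> assume sol: "integral_solution \<beta> (\<lambda>t. X 0 \<omega> + \<sigma> * W t \<omega>) (\<lambda>t. X t \<omega>)" and w: "\<omega> \<in> space M"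
    show "\<omega> \<in> H \<longrightarrow> (\<omega> \<in> S \<longleftrightarrow> increment_path (T \<omega>) \<omega> \<in> E)"
    proof
      assume "\<omega> \<in> H"
      then have H: "\<tau> \<omega> < \<infinity>" "X (T \<omega>) \<omega> = x" by (auto simp: H_def T_def)
      have T0: "0 \<le> T \<omega>" by (simp add: T_def)
      have ip: "increment_path (T \<omega>) \<omega> \<in> path_carrier" using T0 by (rule increment_path_carrier)
      \<comment> \<open>The random time is inserted path by path. As the state there is
        \<open>x\<close>, the initial value and the earlier noise cancel.\<close>
      have "integral_solution \<beta> (\<lambda>t. X (T \<omega>) \<omega> + (X 0 \<omega> + \<sigma> * W (T \<omega> + t) \<omega> - (X 0 \<omega> + \<sigma> * W (T \<omega>) \<omega>))) (\<lambda>t. X (T \<omega> + t) \<omega>)"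
        using integral_solution_shift[OF sol T0] .
      then have "integral_solution \<beta> (\<lambda>t. x + \<sigma> * increment_path (T \<omega>) \<omega> t) (\<lambda>t. X (T \<omega> + t) \<omega>)"
        by (rule integral_solution_cong[THEN iffD1, rotated 2]) (simp_all add: H increment_path_def right_diff_distrib)
      then have "X (T \<omega> + t) \<omega> = flow \<beta> (\<lambda>s. x + \<sigma> * increment_path (T \<omega>) \<omega> s) t" if "0 \<le> t" for t
        using flow_unique[OF cw[OF ip]] that by blast
      then have "shifted_path X \<tau> \<omega> = \<Psi> (increment_path (T \<omega>) \<omega>)"
        by (auto simp: shifted_path_def \<Psi>_def T_def)
      then show "\<omega> \<in> S \<longleftrightarrow> increment_path (T \<omega>) \<omega> \<in> E"
        using H w ip by (auto simp: S_def E_def space_path_borel)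
    qed
  qed
  note [measurable] = stopping_time_measurable[OF \<tau>]
  have S: "S \<in> events"
  proof -
    have "{\<omega> \<in> space M. \<tau> \<omega> < \<infinity>} \<in> events" by measurable
    moreover have "shifted_path X \<tau> -` A \<inter> space M \<in> events"
      using measurable_shifted_path[OF ad c \<tau>] A by (rule measurable_sets)
    moreover have "S = {\<omega> \<in> space M. \<tau> \<omega> < \<infinity>} \<inter> (shifted_path X \<tau> -` A \<inter> space M)" by (auto simp: S_def)
    ultimately show ?thesis by auto
  qed
  have H: "H \<in> sets (pre_sigma \<tau>)" unfolding H_def by (rule hitting_event_pre_sigma[OF ad c \<tau>])
  then have He: "H \<in> events" using pre_sigma_events[OF \<tau>] by blast
  have HS: "integrable M (\<lambda>\<omega>. indicator H \<omega> * indicator S \<omega> :: real)"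
  proof -
    have "integrable M (indicator (H \<inter> S) :: 'a \<Rightarrow> real)"
      using He S by (intro integrable_real_indicator) (auto simp: emeasure_eq_measure)
    moreover have "indicator (H \<inter> S) = (\<lambda>\<omega>. indicator H \<omega> * indicator S \<omega> :: real)"
      by (rule ext) (rule indicator_inter_arith)
    ultimately show ?thesis by (simp only:)
  qed
  have "subalgebra M (pre_sigma \<tau>)"
    unfolding subalgebra_def using pre_sigma_events[OF \<tau>] by (simp add: space_pre_sigma)
  then interpret finite_measure_subalgebra M "pre_sigma \<tau>"
    by (intro finite_measure_subalgebra.intro finite_measure_axioms finite_measure_subalgebra_axioms.intro)
  \<comment> \<open>The claim concerns \<open>H\<close> only, so the conditional expectation is
    first computed for the product of both indicators; as \<open>H\<close> belongs to the past, its
    indicator is pulled out afterwards.\<close>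
  have "AE \<omega> in M. real_cond_exp M (pre_sigma \<tau>) (\<lambda>\<omega>. indicator H \<omega> * indicator S \<omega>) \<omega> = measure (P x) A * indicator H \<omega>"
  proof (rule real_cond_exp_charact)
    show "integrable M (\<lambda>\<omega>. indicator H \<omega> * indicator S \<omega> :: real)" by (rule HS)
    show "integrable M (\<lambda>\<omega>. measure (P x) A * indicator H \<omega>)"
      using He by (intro integrable_mult_right integrable_real_indicator) (auto simp: emeasure_eq_measure)
    show "(\<lambda>\<omega>. measure (P x) A * indicator H \<omega>) \<in> borel_measurable (pre_sigma \<tau>)"
      using H by (intro borel_measurable_times borel_measurable_const borel_measurable_indicator)
    fix G assume G: "G \<in> sets (pre_sigma \<tau>)"
    then have Ge: "G \<in> events" using pre_sigma_events[OF \<tau>] by blast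
    have "(\<integral>\<omega>\<in>G. (indicator H \<omega> * indicator S \<omega> :: real) \<partial>M) = (\<integral>\<omega>. indicator (G \<inter> H \<inter> S) \<omega> \<partial>M)"
      unfolding set_lebesgue_integral_def by (intro Bochner_Integration.integral_cong) (auto simp: indicator_def)
    also have "\<dots> = prob (G \<inter> H \<inter> S)"
    proof -
      have "G \<inter> H \<inter> S \<inter> space M = G \<inter> H \<inter> S" using sets.sets_into_space[OF Ge] by blast
      then show ?thesis by (simp only: Bochner_Integration.integral_indicator)
    qed
    also have "\<dots> = prob (G \<inter> H \<inter> {\<omega> \<in> space M. increment_path (T \<omega>) \<omega> \<in> E})"
    proof (rule measure_eq_AE)
      show "AE \<omega> in M. \<omega> \<in> G \<inter> H \<inter> S \<longleftrightarrow> \<omega> \<in> G \<inter> H \<inter> {\<omega> \<in> space M. increment_path (T \<omega>) \<omega> \<in> E}"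
        using shift AE_space by eventually_elim auto
      have "(\<lambda>\<omega>. increment_path (T \<omega>) \<omega>) \<in> measurable M path_borel"
        by (rule measurable_increment_path) (auto simp: T_def)
      from measurable_sets[OF this E] have "{\<omega> \<in> space M. increment_path (T \<omega>) \<omega> \<in> E} \<in> events"
        by (simp add: vimage_def Int_def conj_commute)
      then show "G \<inter> H \<inter> {\<omega> \<in> space M. increment_path (T \<omega>) \<omega> \<in> E} \<in> events" using Ge He by auto
    qed (use Ge He S in auto)
    also have "\<dots> = prob (G \<inter> H) * measure (P x) A"
      unfolding PA T_def using G H E by (intro strong_markov[OF \<tau>]) (auto simp: H_def)
    also have "\<dots> = (\<integral>\<omega>. measure (P x) A * indicator (G \<inter> H) \<omega> \<partial>M)"
    proof -
      have "G \<inter> H \<inter> space M = G \<inter> H" using sets.sets_into_space[OF Ge] by blast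
      then show ?thesis by (simp only: Bochner_Integration.integral_indicator integral_mult_right_zero mult.commute)
    qed
    also have "\<dots> = (\<integral>\<omega>\<in>G. (measure (P x) A * indicator H \<omega>) \<partial>M)"
      unfolding set_lebesgue_integral_def by (intro Bochner_Integration.integral_cong) (auto simp: indicator_def)
    finally show "(\<integral>\<omega>\<in>G. (indicator H \<omega> * indicator S \<omega>) \<partial>M) = (\<integral>\<omega>\<in>G. (measure (P x) A * indicator H \<omega>) \<partial>M)" .
  qed
  moreover have "AE \<omega> in M. real_cond_exp M (pre_sigma \<tau>) (\<lambda>\<omega>. indicator H \<omega> * indicator S \<omega>) \<omega>
      = indicator H \<omega> * real_cond_exp M (pre_sigma \<tau>) (indicator S) \<omega>"
  proof (rule real_cond_exp_mult)
    show "integrable M (\<lambda>\<omega>. indicator H \<omega> * indicator S \<omega> :: real)" by (rule HS)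
  qed (use H S in auto)
  ultimately show "AE \<omega> in M. \<tau> \<omega> < \<infinity> \<and> X (enn2real (\<tau> \<omega>)) \<omega> = x \<longrightarrow>
     real_cond_exp M (pre_sigma \<tau>) (indicator {\<omega>' \<in> space M. \<tau> \<omega>' < \<infinity> \<and> shifted_path X \<tau> \<omega>' \<in> A}) \<omega>
       = measure (P x) A"
    unfolding S_def[symmetric] using AE_space by eventually_elim (auto simp: H_def)
qed

lemma strong_solution_integral_solution:
  assumes X: "strong_solution M F B \<sigma> \<beta> X" and WB: "AE \<omega> in M. \<forall>t\<ge>0. W t \<omega> = B t \<omega>"
  shows "AE \<omega> in M. integral_solution \<beta> (\<lambda>t. X 0 \<omega> + \<sigma> * W t \<omega>) (\<lambda>t. X t \<omega>)"
proof -
  have "AE \<omega> in M. \<forall>t\<ge>0. X t \<omega> = X 0 \<omega> + \<sigma> * B t \<omega> + integral {0..t} (\<lambda>s. \<beta> (X s \<omega>))"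
    and c: "\<And>\<omega>. \<omega> \<in> space M \<Longrightarrow> continuous_on {0..} (\<lambda>t. X t \<omega>)"
    using X by (auto simp: strong_solution_def)
  from this(1) WB AE_space show ?thesis
  proof eventually_elim
    fix \<omega> assume *: "\<forall>t\<ge>0. X t \<omega> = X 0 \<omega> + \<sigma> * B t \<omega> + integral {0..t} (\<lambda>s. \<beta> (X s \<omega>))"
      "\<forall>t\<ge>0. W t \<omega> = B t \<omega>" "\<omega> \<in> space M"
    show "integral_solution \<beta> (\<lambda>t. X 0 \<omega> + \<sigma> * W t \<omega>) (\<lambda>t. X t \<omega>)"
      unfolding integral_solution_def
    proof (intro conjI allI impI c *(3))
      fix t :: real assume "0 \<le> t"
      then show "X t \<omega> = X 0 \<omega> + \<sigma> * W t \<omega> + integral {0..t} (\<lambda>s. \<beta> (X s \<omega>))"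
        using *(1,2) by metis
    qed
  qed
qed

text \<open>The two halves of the \<open>THE\<close>: \<open>sol y\<close> is a witness, and
  pathwise uniqueness makes every other solution have the same sample path almost everywhere, hence
  the same law.\<close>

lemma solution_law_eq:
  assumes WB: "AE \<omega> in M. \<forall>t\<ge>0. W t \<omega> = B t \<omega>"
  shows "solution_law M F B \<sigma> \<beta> y = distr M path_borel (sample_path (sol y))"
  unfolding solution_law_def
proof (rule the_equality)
  have "strong_solution M F B \<sigma> \<beta> (sol y)"
    unfolding strong_solution_def adapted_def
  proof (intro conjI)
    show "AE \<omega> in M. \<forall>t\<ge>0. sol y t \<omega> = sol y 0 \<omega> + \<sigma> * B t \<omega> + integral {0..t} (\<lambda>s. \<beta> (sol y s \<omega>))"
      using WB
    proof eventually_elim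
      fix \<omega> assume "\<forall>t\<ge>0. W t \<omega> = B t \<omega>"
      then show "\<forall>t\<ge>0. sol y t \<omega> = sol y 0 \<omega> + \<sigma> * B t \<omega> + integral {0..t} (\<lambda>s. \<beta> (sol y s \<omega>))"
        using sol_solution[of y \<omega>] unfolding sol_start integral_solution_def by metis
    qed
  qed (use sol_adapted sol_continuous in auto)
  then show "\<exists>X. strong_solution M F B \<sigma> \<beta> X \<and> (AE \<omega> in M. X 0 \<omega> = y) \<and>
      distr M path_borel (sample_path (sol y)) = distr M path_borel (sample_path X)"
    by (intro exI[of _ "sol y"]) (simp add: sol_start)
next
  fix P assume "\<exists>X. strong_solution M F B \<sigma> \<beta> X \<and> (AE \<omega> in M. X 0 \<omega> = y) \<and> P = distr M path_borel (sample_path X)"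
  then obtain X where X: "strong_solution M F B \<sigma> \<beta> X" "AE \<omega> in M. X 0 \<omega> = y"
    and P: "P = distr M path_borel (sample_path X)" by blast
  have m: "sample_path X \<in> measurable M path_borel"
    using X(1) unfolding strong_solution_def adapted_def by (intro measurable_sample_path) auto
  have "AE \<omega> in M. sample_path X \<omega> = sample_path (sol y) \<omega>"
    using strong_solution_integral_solution[OF X(1) WB] X(2)
  proof eventually_elim
    fix \<omega> assume "integral_solution \<beta> (\<lambda>t. X 0 \<omega> + \<sigma> * W t \<omega>) (\<lambda>t. X t \<omega>)" "X 0 \<omega> = y"
    then have "integral_solution \<beta> (\<lambda>t. y + \<sigma> * W t \<omega>) (\<lambda>t. X t \<omega>)" by simp
    then have "X t \<omega> = sol y t \<omega>" if "0 \<le> t" for t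
      using integral_solution_unique[OF _ sol_solution] that by blast
    then show "sample_path X \<omega> = sample_path (sol y) \<omega>" by (auto simp: sample_path_def)
  qed
  then show "P = distr M path_borel (sample_path (sol y))"
    unfolding P by (intro distr_cong_AE refl m sample_path_sol_measurable)
qed

end

section \<open>The drift of the truncated double well\<close>

lemma truncated_double_well_deriv_right:
  assumes "K + \<epsilon> < x" "0 < \<epsilon>" "\<epsilon> < K"
  shows "deriv (truncated_double_well h l k K \<epsilon> g) x = k"
proof (rule DERIV_imp_deriv)
  have "((\<lambda>x. k * (x - K) + double_well h l K) has_field_derivative k) (at x)"
    by (auto intro!: derivative_eq_intros)
  then show "(truncated_double_well h l k K \<epsilon> g has_field_derivative k) (at x)"
    by (rule has_field_derivative_transform_within_open[where S="{K + \<epsilon><..}"])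
       (use assms in \<open>auto simp: truncated_double_well_def\<close>)
qed

lemma truncated_double_well_deriv_left:
  assumes "x < - (K + \<epsilon>)" "0 < \<epsilon>" "\<epsilon> < K"
  shows "deriv (truncated_double_well h l k K \<epsilon> g) x = - k"
proof (rule DERIV_imp_deriv)
  have "((\<lambda>x. k * (- x - K) + double_well h l K) has_field_derivative - k) (at x)"
    by (auto intro!: derivative_eq_intros)
  then show "(truncated_double_well h l k K \<epsilon> g has_field_derivative - k) (at x)"
    by (rule has_field_derivative_transform_within_open[where S="{..<- (K + \<epsilon>)}"])
       (use assms in \<open>auto simp: truncated_double_well_def\<close>)
qed

theorem proposition1:
  fixes M :: "'a measure"
    and F :: "ennreal \<Rightarrow> 'a measure"
    and B X :: "real \<Rightarrow> 'a \<Rightarrow> real"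
    and D kBT h l k K \<epsilon> \<sigma> a b :: real
    and g U \<beta> :: "real \<Rightarrow> real"
    and P :: "real \<Rightarrow> (real \<Rightarrow> real) measure"
  assumes "prob_space M"
    and "usual_conditions M F"
    and "brownian_motion M F B"
    and "D > 0" and "kBT > 0"
    and "h \<noteq> 0" and "l \<noteq> 0" and "k > 0" and "K \<ge> \<bar>l / h\<bar>" and "0 < \<epsilon>" and "\<epsilon> < K"
    and "smooth_on_open {K - \<epsilon><..<K + \<epsilon>} g"
    and "U = truncated_double_well h l k K \<epsilon> g"
    and "\<forall>x. U differentiable (at x)" and "continuous_on UNIV (deriv U)"
    and "bounded (range (deriv U))"
    and "\<beta> = drift D kBT U"
    and "\<exists>L. L-lipschitz_on UNIV \<beta>"
    and "\<sigma> = sqrt (2 * D)"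
    and "b = \<bar>l / (2 * h)\<bar>" and "a = - b"
    and "P = solution_law M F B \<sigma> \<beta>"
    and "strong_solution M F B \<sigma> \<beta> X"
  shows "positive_recurrent P \<and>
         regenerative_at M F P X a \<and> regenerative_at M F P X b"
proof -
  obtain W where W: "brownian M F W" and WB: "AE \<omega> in M. \<forall>t\<ge>0. W t \<omega> = B t \<omega>"
    using brownian_modification[OF assms(1-3)] by blast
  obtain L where L: "L-lipschitz_on UNIV \<beta>" using assms(18) by blast
  \<comment> \<open>A Lipschitz constant may be 0, while the weighted norm is set up for a positive
    one.\<close>
  then have L1: "(L + 1)-lipschitz_on UNIV \<beta>" "0 < L + 1"
    using lipschitz_on_le[of L UNIV \<beta> "L + 1"] lipschitz_on_nonneg[OF L] by auto
  obtain C0 where C0: "\<And>x. \<bar>deriv U x\<bar> \<le> C0"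
    using assms(16) unfolding bounded_iff by auto
  \<comment> \<open>The constant speed of the drift where the potential is affine with slope
    \<open>k\<close> or \<open>-k\<close>.\<close>
  define c where "c = D / kBT * k"
  define C where "C = D / kBT * C0"
  have c: "0 < c" using assms by (simp add: c_def)
  have \<beta>: "\<beta> x = - (D / kBT) * deriv U x" for x using assms(17) by (simp add: drift_def)
  have C: "\<bar>\<beta> x\<bar> \<le> C" for x
    unfolding \<beta> C_def abs_mult using C0[of x] assms(4,5) by (intro mult_mono) auto
  then have "0 \<le> C" using abs_ge_zero order_trans by blast
  \<comment> \<open>The constant comes from \<open>\<bar>x\<bar> \<le> K + \<epsilon>\<close>, where
    \<open>x * \<beta> x + c * \<bar>x\<bar>\<close> is at most
    \<open>(C + c) * \<bar>x\<bar>\<close>. Outside, \<open>x * \<beta> x\<close> equals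
    \<open>- c * \<bar>x\<bar>\<close>.\<close>
  have inward: "x * \<beta> x \<le> (C + c) * (K + \<epsilon>) - c * \<bar>x\<bar>" for x
  proof -
    have K: "0 \<le> (C + c) * (K + \<epsilon>)" using \<open>0 \<le> C\<close> c assms(10,11) by auto
    consider "K + \<epsilon> < x" | "x < - (K + \<epsilon>)" | "\<bar>x\<bar> \<le> K + \<epsilon>" by linarith
    then show ?thesis
    proof cases
      case 1
      then have "\<beta> x = - c" "\<bar>x\<bar> = x"
        using truncated_double_well_deriv_right[OF 1 assms(10,11)] assms(10,11)
        unfolding \<beta> assms(13) by (auto simp: c_def)
      then show ?thesis using K by (simp add: mult.commute)
    next
      case 2
      then have "\<beta> x = c" "\<bar>x\<bar> = - x"
        using truncated_double_well_deriv_left[OF 2 assms(10,11)] assms(10,11)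
        unfolding \<beta> assms(13) by (auto simp: c_def)
      then show ?thesis using K by (simp add: mult.commute)
    next
      case 3
      have "x * \<beta> x + c * \<bar>x\<bar> \<le> \<bar>x\<bar> * C + c * \<bar>x\<bar>"
        using abs_ge_self[of "x * \<beta> x"] mult_left_mono[OF C abs_ge_zero, of x x] by (simp add: abs_mult)
      also have "\<dots> = (C + c) * \<bar>x\<bar>" by (simp add: algebra_simps)
      also have "\<dots> \<le> (C + c) * (K + \<epsilon>)" using 3 \<open>0 \<le> C\<close> c by (intro mult_left_mono) auto
      finally show ?thesis by simp
    qed
  qed
  interpret lipschitz_drift \<beta> "L + 1" using L1 by unfold_locales
  interpret brownian M F W by (rule W)
  interpret confined_diffusion M F W \<beta> "L + 1" \<sigma> C "(C + c) * (K + \<epsilon>)" c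
    using C inward c assms(4,19) by unfold_locales auto
  have P: "P y = distr M path_borel (sample_path (sol y))" for y
    unfolding assms(22) by (rule solution_law_eq[OF WB])
  have "positive_recurrent P"
    unfolding positive_recurrent_def P
    using nn_integral_hitting_time_sol[OF sample_path_sol_measurable] by blast
  moreover have "regenerative_at M F P X x" for x
  proof (rule process_regenerates)
    show "X t \<in> borel_measurable (F (ennreal t))" if "0 \<le> t" for t
      using assms(23) that unfolding strong_solution_def adapted_def by blast
    show "continuous_on {0..} (\<lambda>t. X t \<omega>)" if "\<omega> \<in> space M" for \<omega>
      using assms(23) that unfolding strong_solution_def by blast
    show "AE \<omega> in M. integral_solution \<beta> (\<lambda>t. X 0 \<omega> + \<sigma> * W t \<omega>) (\<lambda>t. X t \<omega>)"
      by (rule strong_solution_integral_solution[OF assms(23) WB])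
  qed (rule P)
  ultimately show ?thesis by blast
qed

end
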